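(* Let $N\ge3$, $a,b,d\in\mathbb R$ and $q>1$. Consider the problem $$(W)\qquad \operatorname{div}\left(|x|^{-2a}\nabla v\right)+d\,|x|^{-2(1+a)}v=|x|^b v^q\ \text{ in }\mathbb R^N\setminus\{0\},\qquad v>0\ \text{ in }\mathbb R^N\setminus\{0\}.$$ Set $$\sigma:=\frac{2a+b+2}{q-1},\qquad \rho:=a-\frac{N-2}{2},\qquad \ell:=(\sigma+\rho)^2-\rho^2+d.$$ Then $(W)$ has a solution if and only if $\ell>0$. Moreover: (i) If $d>\rho^2$, then $(W)$ has a unique solution, given by $v_0(x):=\ell^{\frac1{q-1}}|x|^{-\sigma}$ for every $x\in\mathbb R^N\setminus\{0\}$. (ii) If $(\sigma+\rho)^2>\rho^2-d\ge0$ (for $\sigma\ne-\rho$), then $(W)$ has infinitely many solutions, all radially symmetric, and their total set is $\{v_0\}\cup\{v_\gamma:\ \gamma\in(0,\infty)\}$, where $v_0(x)=\ell^{\frac1{q-1}}|x|^{-\sigma}$ and, for every $\gamma\in(0,\infty)$, $v_\gamma$ denotes the unique solution of $(W)$ that satisfies the following limit behavior near zero and at infinity: $(M_{11})$ if $d<\rho^2$ and $\sigma+\rho<-\sqrt{\rho^2-d}$: $\ \dfrac{v_\gamma(x)}{v_0(x)}\to1$ as $|x|\to0$ and $\dfrac{v_\gamma(x)}{|x|^{\rho+\sqrt{\rho^2-d}}}\to\gamma$ as $|x|\to\infty$; $(M_{21})$ if $d<\rho^2$ and $\sigma+\rho>\sqrt{\rho^2-d}$: $\ \dfrac{v_\gamma(x)}{|x|^{\rho-\sqrt{\rho^2-d}}}\to\gamma$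 as $|x|\to0$ and $\dfrac{v_\gamma(x)}{v_0(x)}\to1$ as $|x|\to\infty$; $(M_{12})$ if $d=\rho^2$ and $\sigma<-\rho$: $\ \dfrac{v_\gamma(x)}{v_0(x)}\to1$ as $|x|\to0$ and $\dfrac{v_\gamma(x)}{|x|^{\rho}\log|x|}\to\gamma$ as $|x|\to\infty$; $(M_{22})$ if $d=\rho^2$ and $\sigma>-\rho$: $\ \dfrac{v_\gamma(x)}{|x|^{\rho}\log(1/|x|)}\to\gamma$ as $|x|\to0$ and $\dfrac{v_\gamma(x)}{v_0(x)}\to1$ as $|x|\to\infty$.
   Context: A solution of $(W)$ is a positive function $v\in C^1(\mathbb R^N\setminus\{0\})$ satisfying the equation in the weak (distributional) sense, i.e. for every $\varphi\in C^1_c(\mathbb R^N\setminus\{0\})$, $$-\int|x|^{-2a}\nabla v\cdot\nabla\varphi\,dx+d\int|x|^{-2(1+a)}v\,\varphi\,dx=\int|x|^bv^q\varphi\,dx,$$ the integrals being over $\mathbb R^N$. *)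

theory Defs
  imports "HOL-Analysis.Analysis"
begin

definition C1_on :: "('a::real_inner) set \<Rightarrow> ('a \<Rightarrow> real) \<Rightarrow> bool" where
  "C1_on S f \<longleftrightarrow> (\<exists>g. (\<forall>x\<in>S. GDERIV f x :> g x) \<and> continuous_on S g)"

definition grad :: "('a::real_inner \<Rightarrow> real) \<Rightarrow> 'a \<Rightarrow> 'a" where
  "grad f x = (THE D. GDERIV f x :> D)"

text \<open>The test functions in \<open>C\<^sup>1\<^sub>c(\<real>\<^sup>N - {0})\<close> are represented by their extensions by zero
  to the whole space.\<close>

definition test_function :: "('a::euclidean_space \<Rightarrow> real) \<Rightarrow> bool" where
  "test_function \<phi> \<longleftrightarrow>
     C1_on UNIV \<phi> \<and> compact (closure {x. \<phi> x \<noteq> 0}) \<and> 0 \<notin> closure {x. \<phi> x \<noteq> 0}"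

text \<open>A function on \<open>\<real>\<^sup>N - {0}\<close> is an extensional function (it is \<open>undefined\<close> at the
  origin), so that equality of solutions is equality on \<open>\<real>\<^sup>N - {0}\<close>. The value at the origin
  does not influence the integrals, because every test function vanishes near \<open>0\<close>.\<close>

definition W_solution ::
    "real \<Rightarrow> real \<Rightarrow> real \<Rightarrow> real \<Rightarrow> ('a::euclidean_space \<Rightarrow> real) \<Rightarrow> bool" where
  "W_solution a b d q v \<longleftrightarrow>
     v \<in> (- {0}) \<rightarrow>\<^sub>E {0<..} \<and>
     C1_on (- {0}) v \<and>
     (\<forall>\<phi>. test_function \<phi> \<longrightarrow>
        - (\<integral>x. norm x powr (- 2 * a) * (grad v x \<bullet> grad \<phi> x) \<partial>lborel)
        + d * (\<integral>x. norm x powr (- 2 * (1 + a)) * v x * \<phi> x \<partial>lborel)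
        = (\<integral>x. norm x powr b * v x powr q * \<phi> x \<partial>lborel))"

definition radially_symmetric :: "('a::real_normed_vector \<Rightarrow> real) \<Rightarrow> bool" where
  "radially_symmetric v \<longleftrightarrow> (\<forall>x y. x \<noteq> 0 \<and> y \<noteq> 0 \<and> norm x = norm y \<longrightarrow> v x = v y)"

text \<open>The conjuncts are the conditions \<open>(M\<^sub>1\<^sub>1)\<close>, \<open>(M\<^sub>2\<^sub>1)\<close>, \<open>(M\<^sub>1\<^sub>2)\<close>, \<open>(M\<^sub>2\<^sub>2)\<close>.
  Their case hypotheses are mutually exclusive, and one of them holds whenever
  \<open>(\<sigma> + \<rho>)\<^sup>2 > \<rho>\<^sup>2 - d \<ge> 0\<close>; otherwise the predicate is vacuous.\<close>

definition limit_behavior ::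
    "real \<Rightarrow> real \<Rightarrow> real \<Rightarrow> ('a::real_normed_vector \<Rightarrow> real) \<Rightarrow> real \<Rightarrow> ('a \<Rightarrow> real) \<Rightarrow> bool" where
  "limit_behavior d \<sigma> \<rho> v\<^sub>0 \<gamma> v \<longleftrightarrow>
     (d < \<rho>\<^sup>2 \<and> \<sigma> + \<rho> < - sqrt (\<rho>\<^sup>2 - d) \<longrightarrow>
        ((\<lambda>x. v x / v\<^sub>0 x) \<longlongrightarrow> 1) (at 0) \<and>
        ((\<lambda>x. v x / norm x powr (\<rho> + sqrt (\<rho>\<^sup>2 - d))) \<longlongrightarrow> \<gamma>) at_infinity) \<and>
     (d < \<rho>\<^sup>2 \<and> \<sigma> + \<rho> > sqrt (\<rho>\<^sup>2 - d) \<longrightarrow>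
        ((\<lambda>x. v x / norm x powr (\<rho> - sqrt (\<rho>\<^sup>2 - d))) \<longlongrightarrow> \<gamma>) (at 0) \<and>
        ((\<lambda>x. v x / v\<^sub>0 x) \<longlongrightarrow> 1) at_infinity) \<and>
     (d = \<rho>\<^sup>2 \<and> \<sigma> < - \<rho> \<longrightarrow>
        ((\<lambda>x. v x / v\<^sub>0 x) \<longlongrightarrow> 1) (at 0) \<and>
        ((\<lambda>x. v x / (norm x powr \<rho> * ln (norm x))) \<longlongrightarrow> \<gamma>) at_infinity) \<and>
     (d = \<rho>\<^sup>2 \<and> \<sigma> > - \<rho> \<longrightarrow>
        ((\<lambda>x. v x / (norm x powr \<rho> * ln (1 / norm x))) \<longlongrightarrow> \<gamma>) (at 0) \<and>
        ((\<lambda>x. v x / v\<^sub>0 x) \<longlongrightarrow> 1) at_infinity)"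

end

theory Submission
  imports Defs
begin

text \<open>
  The substitution \<open>v = |x|\<^sup>a u\<close> reduces the problem to \<open>a = 0\<close>. With \<open>w = |x|\<^sup>\<sigma> u\<close> and \<open>t = ln |x|\<close>, the
  equation becomes \<open>w'' - 2kw' + lw + \<Delta>\<^sub>\<theta>w = w\<^sup>q\<close> on the cylinder over the sphere, with \<open>k = \<sigma> + \<rho>\<close>
  (a stationary form of the KPP equation), whose positive equilibrium is \<open>w\<^sub>0 = l\<^bsup>1/(q-1)\<^esup>\<close>.
  As \<open>g \<mapsto> g\<^bsup>q-1\<^esup>\<close> is increasing, a Picone-type comparison principle holds for positive weak sub- and
  supersolutions. Explicit barriers give \<open>l > 0\<close> and \<open>w \<le> w\<^sub>0\<close>, then \<open>w = w\<^sub>0\<close> if \<open>l > k\<^sup>2\<close> (that is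
  \<open>d > \<rho>\<^sup>2\<close>), and \<open>w \<rightarrow> w\<^sub>0\<close> at one end of the cylinder if \<open>0 < l \<le> k\<^sup>2\<close>.

  In the last case a monotone wave \<open>Z(t)\<close> joining \<open>0\<close> to \<open>w\<^sub>0\<close>, with the asymptotics prescribed by the
  linearization at \<open>0\<close>, arises from monotone iteration of a Green operator between explicit barriers.
  A sliding argument shows that there is no other nonconstant solution, even without symmetry: let
  \<open>Z(\<cdot> + c\<^sub>0)\<close> be the largest translate below \<open>w\<close>. At the end where \<open>Z\<close> vanishes, \<open>w\<close> comes close to
  that translate somewhere on each sphere, hence, by Harnack's inequality for the difference, on the
  whole sphere; by comparison \<open>w\<close> is below every larger translate, and so \<open>w = Z(\<cdot> + c\<^sub>0)\<close>.
\<close>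

section \<open>Weak Laplacians\<close>

text \<open>Solutions are only of class \<open>C\<^sup>1\<close>, and no regularity theory is
  invoked. Comparison therefore runs through integral identities, with a truncation that is itself
  \<open>C\<^sup>1\<close> (the square of a positive part), and Harnack's inequality through
  weighted averages over balls. All barriers are functions of |x|, so that their weak Laplacians
  follow from the divergence theorem for the radial field. At the end where the wave vanishes,
  comparison in absolute terms says nothing, since its translates all tend to 0 there; ratios are
  required. This is why the wave is built with exact asymptotics: they give Z(t + c) / Z(t)
  \<rightarrow> exp(\<theta> c), so a translation acts there as a multiplication, and the
  multiplicative constant of Harnack's inequality can be absorbed by a translation. At the other end
  all solutions tend to \<open>w0\<close>, and a factor 1 + \<epsilon> separates them. The
  construction of Z yields neither its monotonicity nor its limit \<open>w0\<close>; both follow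
  from comparison, once Z is read as a radial solution.\<close>

definition test_on :: "'a::euclidean_space set \<Rightarrow> ('a \<Rightarrow> real) \<Rightarrow> ('a \<Rightarrow> 'a) \<Rightarrow> bool" where
  "test_on S \<phi> d\<phi> \<longleftrightarrow> (\<forall>x. GDERIV \<phi> x :> d\<phi> x) \<and> continuous_on UNIV d\<phi> \<and>
     (\<exists>K. compact K \<and> K \<subseteq> S \<and> (\<forall>x. x \<notin> K \<longrightarrow> \<phi> x = 0))"

text \<open>The equation \<Delta>u = h in the sense of distributions, for u of class
  \<open>C\<^sup>1\<close> and continuous h. The gradient is carried as an argument, so that sums,
  products and quotients come with explicit gradients.\<close>

definition weak_lap ::
    "'a::euclidean_space set \<Rightarrow> ('a \<Rightarrow> real) \<Rightarrow> ('a \<Rightarrow> 'a) \<Rightarrow> ('a \<Rightarrow> real) \<Rightarrow> bool" where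
  "weak_lap S u du h \<longleftrightarrow> (\<forall>x\<in>S. GDERIV u x :> du x) \<and> continuous_on S du \<and> continuous_on S h \<and>
     (\<forall>\<phi> d\<phi>. test_on S \<phi> d\<phi> \<longrightarrow> (\<integral>x. du x \<bullet> d\<phi> x \<partial>lborel) = - (\<integral>x. h x * \<phi> x \<partial>lborel))"

lemma GDERIV_isCont: "GDERIV f x :> D \<Longrightarrow> isCont f x"
  unfolding gderiv_def by (rule has_derivative_continuous)

lemma GDERIV_continuous_on: "(\<And>x. x \<in> S \<Longrightarrow> GDERIV f x :> df x) \<Longrightarrow> continuous_on S f"
  by (intro continuous_at_imp_continuous_on ballI GDERIV_isCont)

lemma GDERIV_unique:
  assumes "GDERIV f x :> D" "GDERIV f x :> D'" shows "D = D'"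
proof -
  have "(\<lambda>h. h \<bullet> D) = (\<lambda>h. h \<bullet> D')"
    using assms unfolding gderiv_def by (rule has_derivative_unique)
  then show ?thesis by (metis vector_eq_ldot)
qed

lemma GDERIV_cong_open:
  assumes "GDERIV f x :> D" "open S" "x \<in> S" "\<And>y. y \<in> S \<Longrightarrow> f y = g y"
  shows "GDERIV g x :> D"
  using has_derivative_transform_within_open[of f _ x UNIV S g] assms
  unfolding gderiv_def by blast

lemma GDERIV_along:
  assumes "GDERIV f (p t) :> D" "(p has_vector_derivative p') (at t within U)"
  shows "((\<lambda>t. f (p t)) has_real_derivative (p' \<bullet> D)) (at t within U)"
proof -
  have "((\<lambda>t. f (p t)) has_derivative (\<lambda>h. (h *\<^sub>R p') \<bullet> D)) (at t within U)"
    using has_derivative_compose[of p "\<lambda>h. h *\<^sub>R p'" t U f "\<lambda>h. h \<bullet> D"] assms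
    unfolding gderiv_def has_vector_derivative_def by blast
  then show ?thesis
    by (simp add: has_field_derivative_def mult.commute[of _ "p' \<bullet> D"])
qed

lemma integrable_compact_support:
  fixes f :: "'a::euclidean_space \<Rightarrow> real"
  assumes "compact K" "continuous_on K f" "\<And>x. x \<notin> K \<Longrightarrow> f x = 0"
  shows "integrable lborel f"
proof -
  have "(\<lambda>x. indicator K x *\<^sub>R f x) = f" using assms(3) by (auto simp: indicator_def fun_eq_iff)
  then show ?thesis using borel_integrable_compact[OF assms(1,2)] by simp
qed

text \<open>Otherwise the integrand would vanish almost everywhere, but a nonempty open set is not
  negligible. This turns an integral inequality into a pointwise contradiction in
  \<open>weak_comparison\<close>.\<close>

lemma integral_pos_if_pos_on_open:
  fixes f :: "'a::euclidean_space \<Rightarrow> real"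
  assumes f: "integrable lborel f" "\<And>x. 0 \<le> f x" and U: "open U" "x \<in> U" "\<And>y. y \<in> U \<Longrightarrow> 0 < f y"
  shows "0 < (\<integral>x. f x \<partial>lborel)"
proof -
  have "(\<integral>x. f x \<partial>lborel) \<noteq> 0"
  proof
    assume "(\<integral>x. f x \<partial>lborel) = 0"
    then have AE: "AE y in lborel. f y = 0"
      using integral_nonneg_eq_0_iff_AE[OF f(1)] f(2) by auto
    have "AE y in lborel. y \<notin> U"
      by (rule eventually_mono[OF AE]) (use U(3) in force)
    then have "U \<in> null_sets lborel"
      using AE_iff_null_sets[of U lborel] U(1) by auto
    then have "negligible U"
      by (simp add: negligible_iff_null_sets null_sets_completionI)
    then show False using open_not_negligible[OF U(1)] U(2) by blast
  qed
  moreover have "0 \<le> (\<integral>x. f x \<partial>lborel)"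
    by (rule Bochner_Integration.integral_nonneg) (rule f(2))
  ultimately show ?thesis by simp
qed

text \<open>Squaring removes the corner of the positive part at 0, so that truncations remain
  admissible test functions.\<close>

lemma has_real_derivative_pos_part_square:
  "((\<lambda>r. (max 0 r)\<^sup>2) has_real_derivative 2 * max 0 r) (at (r::real))"
proof -
  consider "r < 0" | "r > 0" | "r = 0" by linarith
  then show ?thesis
  proof cases
    case 1
    show ?thesis
    proof (rule has_field_derivative_transform_within_open[of "\<lambda>_. 0" _ _ "{..<0}"])
      show "((\<lambda>_. 0) has_real_derivative 2 * max 0 r) (at r)" using 1 by simp
    qed (use 1 in auto)
  next
    case 2
    show ?thesis
    proof (rule has_field_derivative_transform_within_open[of "\<lambda>r. r\<^sup>2" _ _ "{0<..}"])
      show "((\<lambda>r. r\<^sup>2) has_real_derivative 2 * max 0 r) (at r)"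
        using 2 by (auto intro!: derivative_eq_intros)
    qed (use 2 in auto)
  next
    case 3
    have "((\<lambda>y::real. (max 0 y)\<^sup>2 / y) \<longlongrightarrow> 0) (at 0)"
    proof (rule Lim_null_comparison[of _ "\<lambda>y. \<bar>y\<bar>"])
      show "\<forall>\<^sub>F y in at (0::real). norm ((max 0 y)\<^sup>2 / y) \<le> \<bar>y\<bar>"
        by (rule eventuallyI) (auto simp: max_def power2_eq_square)
      show "((\<lambda>y. \<bar>y\<bar>) \<longlongrightarrow> 0) (at (0::real))" by (auto intro!: tendsto_eq_intros)
    qed
    then show ?thesis using 3 by (simp add: has_field_derivative_iff)
  qed
qed

section \<open>Test functions\<close>

lemma test_on_mono: "test_on S \<phi> d\<phi> \<Longrightarrow> S \<subseteq> T \<Longrightarrow> test_on T \<phi> d\<phi>"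
  unfolding test_on_def by blast

lemma grad_eq_0_off_support:
  assumes "\<And>x. GDERIV \<phi> x :> d\<phi> x" "compact K" "\<And>x. x \<notin> K \<Longrightarrow> \<phi> x = 0" "x \<notin> K"
  shows "d\<phi> x = 0"
proof -
  have "GDERIV \<phi> x :> 0"
    by (rule GDERIV_cong_open[OF GDERIV_const[of 0], of "- K"])
       (use assms compact_imp_closed in auto)
  then show ?thesis using GDERIV_unique assms(1) by blast
qed

lemma test_onE:
  assumes "test_on S \<phi> d\<phi>"
  obtains K where "compact K" "K \<subseteq> S" "\<And>x. x \<notin> K \<Longrightarrow> \<phi> x = 0" "\<And>x. x \<notin> K \<Longrightarrow> d\<phi> x = 0"
    "\<And>x. GDERIV \<phi> x :> d\<phi> x" "continuous_on UNIV d\<phi>" "continuous_on UNIV \<phi>"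
  using assms GDERIV_continuous_on[of UNIV \<phi> d\<phi>] grad_eq_0_off_support[of \<phi> d\<phi>]
  unfolding test_on_def by metis

text \<open>The open sets \<open>S\<close> and \<open>- K\<close> cover the space, and on the second
  one the extension vanishes. This makes test functions out of products whose factors are defined on
  \<open>S\<close> only.\<close>

lemma test_on_extend:
  assumes "open S" "\<And>x. x \<in> S \<Longrightarrow> GDERIV f x :> df x" "continuous_on S df"
    "compact K" "K \<subseteq> S" "\<And>x. x \<in> S - K \<Longrightarrow> f x = 0"
  shows "test_on S (\<lambda>x. if x \<in> S then f x else 0) (\<lambda>x. if x \<in> S then df x else 0)"
proof -
  let ?f = "\<lambda>x. if x \<in> S then f x else 0" and ?d = "\<lambda>x. if x \<in> S then df x else 0"
  have oK: "open (- K)" using assms(4) compact_imp_closed by blast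
  have g: "GDERIV ?f x :> ?d x" for x
  proof (cases "x \<in> S")
    case True
    then show ?thesis using GDERIV_cong_open[OF assms(2)[OF True] assms(1) True, of ?f] by simp
  next
    case False
    have "GDERIV ?f x :> 0"
      by (rule GDERIV_cong_open[OF GDERIV_const[of 0] oK]) (use False assms in auto)
    then show ?thesis using False by simp
  qed
  have z: "?d x = 0" if "x \<notin> K" for x
    using grad_eq_0_off_support[OF g assms(4) _ that] assms by auto
  have "continuous_on (S \<union> - K) ?d"
  proof (rule continuous_on_open_Un[OF assms(1) oK])
    show "continuous_on S ?d" using assms(3) by simp
    show "continuous_on (- K) ?d"
      using continuous_on_cong[of "-K" "-K" ?d "\<lambda>_. 0"] z by auto
  qed
  moreover have "S \<union> - K = UNIV" using assms(5) by auto
  ultimately show ?thesis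
    unfolding test_on_def using g assms by auto
qed

lemma integrable_mult_test:
  assumes "test_on S \<phi> d\<phi>" "continuous_on S f"
  shows "integrable lborel (\<lambda>x. f x * \<phi> x)" "integrable lborel (\<lambda>x. \<phi> x * f x)"
proof -
  obtain K where K: "compact K" "K \<subseteq> S" "\<And>x. x \<notin> K \<Longrightarrow> \<phi> x = 0" "continuous_on UNIV \<phi>"
    by (rule test_onE[OF assms(1)]) blast
  show "integrable lborel (\<lambda>x. f x * \<phi> x)"
    by (rule integrable_compact_support[OF K(1)])
       (use K assms(2) in \<open>auto intro!: continuous_intros intro: continuous_on_subset\<close>)
  then show "integrable lborel (\<lambda>x. \<phi> x * f x)" by (simp add: mult.commute)
qed

lemma integrable_inner_test:
  assumes "test_on S \<phi> d\<phi>" "continuous_on S X"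
  shows "integrable lborel (\<lambda>x. X x \<bullet> d\<phi> x)"
proof -
  obtain K where K: "compact K" "K \<subseteq> S" "\<And>x. x \<notin> K \<Longrightarrow> d\<phi> x = 0" "continuous_on UNIV d\<phi>"
    by (rule test_onE[OF assms(1)]) blast
  show ?thesis
    by (rule integrable_compact_support[OF K(1)])
       (use K assms(2) in \<open>auto intro!: continuous_intros intro: continuous_on_subset\<close>)
qed

lemma integral_lborel_affine:
  fixes f :: "'a::euclidean_space \<Rightarrow> real"
  assumes "c > 0" "f \<in> borel_measurable borel"
  shows "(\<integral>x. f (t + c *\<^sub>R x) \<partial>lborel) = (\<integral>x. f x \<partial>lborel) / c ^ DIM('a)"
proof -
  have "(\<integral>x. f x \<partial>lborel) = (\<integral>x. f x \<partial>(density (distr lborel borel (\<lambda>x. t + c *\<^sub>R x)) (\<lambda>_. \<bar>c\<bar>^DIM('a))))"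
    using lborel_affine[of c t] assms(1) by simp
  also have "\<dots> = (\<integral>x. c ^ DIM('a) *\<^sub>R f x \<partial>(distr lborel borel (\<lambda>x. t + c *\<^sub>R x)))"
    using assms by (subst integral_density) (auto simp: ennreal_power)
  also have "\<dots> = c ^ DIM('a) * (\<integral>x. f (t + c *\<^sub>R x) \<partial>lborel)"
    using assms by (subst integral_distr) auto
  finally show ?thesis using assms(1) by (simp add: field_simps)
qed

lemma integral_lborel_cbox:
  fixes f :: "'a::euclidean_space \<Rightarrow> real"
  assumes "continuous_on (cbox a b) f" "\<And>x. x \<notin> cbox a b \<Longrightarrow> f x = 0"
  shows "(\<integral>x. f x \<partial>lborel) = integral (cbox a b) f"
proof -
  have i: "integrable lborel f" using integrable_compact_support[OF compact_cbox assms] .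
  have "f = (\<lambda>x. if x \<in> cbox a b then f x else 0)" using assms(2) by auto
  then have "integral UNIV f = integral (cbox a b) f"
    using integral_restrict_UNIV[of "cbox a b" f] by simp
  then show ?thesis using integral_lborel[OF i] by simp
qed

lemma cbox_uminus_norm_le:
  fixes x :: "'a::euclidean_space"
  assumes "norm x \<le> M" shows "x \<in> cbox (- M *\<^sub>R One) (M *\<^sub>R One)"
  using assms Basis_le_norm[of _ x] by (force simp: mem_box abs_le_iff)

text \<open>The divergence theorem is only needed for the radial field; there it is the derivative at
  \<open>\<lambda> = 1\<close> of the scaling law of \<open>\<integral>F(\<lambda>x)dx\<close>.\<close>

lemma integral_radial_derivative:
  fixes F :: "'a::euclidean_space \<Rightarrow> real"
  assumes "test_on S F dF"
  shows "(\<integral>x. x \<bullet> dF x \<partial>lborel) = - real DIM('a) * (\<integral>x. F x \<partial>lborel)"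
proof -
  obtain K where K: "compact K" "\<And>x. x \<notin> K \<Longrightarrow> F x = 0" "\<And>x. x \<notin> K \<Longrightarrow> dF x = 0"
    "\<And>x. GDERIV F x :> dF x" "continuous_on UNIV dF" "continuous_on UNIV F"
    by (rule test_onE[OF assms]) blast
  obtain M where M: "\<And>x. x \<in> K \<Longrightarrow> norm x \<le> M"
    using compact_imp_bounded[OF K(1)] by (auto simp: bounded_iff)
  \<comment> \<open>For 1/2 \<le> \<mu> \<le> 2 the function F(\<mu> x) is supported in the ball of
    radius 2M, so one cube serves for all \<mu>.\<close>
  define C where "C = cbox (- (2*M) *\<^sub>R One) ((2*M) *\<^sub>R (One::'a))"
  have out: "\<mu> *\<^sub>R x \<notin> K" if "x \<notin> C" "\<mu> \<in> {1/2..2}" for \<mu> :: real and x :: 'a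
  proof
    assume "\<mu> *\<^sub>R x \<in> K"
    then have "\<mu> * norm x \<le> M" using M[of "\<mu> *\<^sub>R x"] that by simp
    moreover have "1/2 * norm x \<le> \<mu> * norm x" using that by (intro mult_right_mono) auto
    ultimately have "norm x \<le> 2 * M" by simp
    then show False using cbox_uminus_norm_le that(1) unfolding C_def by blast
  qed
  have cF: "continuous_on A (\<lambda>x. F (g x))" if "continuous_on A g" for A and g :: "'b::topological_space \<Rightarrow> 'a"
    using continuous_on_compose2[OF K(6) that] by simp
  have cdF: "continuous_on A (\<lambda>x. dF (g x))" if "continuous_on A g" for A and g :: "'b::topological_space \<Rightarrow> 'a"
    using continuous_on_compose2[OF K(5) that] by simp
  have I: "integral C (\<lambda>x. F (\<mu> *\<^sub>R x)) = (\<integral>x. F x \<partial>lborel) / \<mu> ^ DIM('a)" if "\<mu> \<in> {1/2..2}" for \<mu>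
  proof -
    have "(\<integral>x. F (0 + \<mu> *\<^sub>R x) \<partial>lborel) = (\<integral>x. F x \<partial>lborel) / \<mu> ^ DIM('a)"
      by (rule integral_lborel_affine) (use that K(6) borel_measurable_continuous_onI in auto)
    moreover have "(\<integral>x. F (\<mu> *\<^sub>R x) \<partial>lborel) = integral C (\<lambda>x. F (\<mu> *\<^sub>R x))"
      unfolding C_def
      by (rule integral_lborel_cbox) (use out[OF _ that] K(2) in \<open>auto intro!: cF continuous_intros simp: C_def\<close>)
    ultimately show ?thesis by simp
  qed
  have "((\<lambda>\<mu>. integral C (\<lambda>x. F (\<mu> *\<^sub>R x))) has_real_derivative integral C (\<lambda>x. x \<bullet> dF (1 *\<^sub>R x))) (at 1 within {1/2..2})"
    unfolding C_def
  proof (rule leibniz_rule_field_derivative[where U = "{1/2..2::real}" and f = "\<lambda>\<mu> x. F (\<mu> *\<^sub>R x)" and fx = "\<lambda>\<mu> x. x \<bullet> dF (\<mu> *\<^sub>R x)"])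
    show "((\<lambda>\<mu>. F (\<mu> *\<^sub>R x)) has_real_derivative x \<bullet> dF (\<mu> *\<^sub>R x)) (at \<mu> within {1/2..2})" for \<mu> x
    proof (rule GDERIV_along[OF K(4)])
      show "((\<lambda>\<mu>. \<mu> *\<^sub>R x) has_vector_derivative x) (at \<mu> within {1/2..2})"
        by (auto intro!: derivative_eq_intros)
    qed
    show "(\<lambda>x. F (\<mu> *\<^sub>R x)) integrable_on cbox (- (2 * M) *\<^sub>R One) ((2 * M) *\<^sub>R One)" for \<mu>
      by (intro integrable_continuous cF continuous_intros)
    show "continuous_on ({1/2..2} \<times> cbox (- (2 * M) *\<^sub>R One) ((2 * M) *\<^sub>R One)) (\<lambda>(\<mu>, x). x \<bullet> dF (\<mu> *\<^sub>R x))"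
      unfolding split_beta by (intro continuous_intros cdF)
  qed auto
  moreover have "((\<lambda>\<mu>. integral C (\<lambda>x. F (\<mu> *\<^sub>R x))) has_real_derivative - real DIM('a) * (\<integral>x. F x \<partial>lborel)) (at 1 within {1/2..2})"
  proof (rule has_field_derivative_transform_within[where d = 1 and f = "\<lambda>\<mu>. (\<integral>x. F x \<partial>lborel) / \<mu> ^ DIM('a)"])
    show "((\<lambda>\<mu>. (\<integral>x. F x \<partial>lborel) / \<mu> ^ DIM('a)) has_real_derivative - real DIM('a) * (\<integral>x. F x \<partial>lborel)) (at 1 within {1/2..2})"
      by (auto intro!: derivative_eq_intros)
  qed (use I in auto)
  moreover have "at (1::real) within {1/2..2} = at 1"
    by (rule at_within_interior) auto
  ultimately have "integral C (\<lambda>x. x \<bullet> dF (1 *\<^sub>R x)) = - real DIM('a) * (\<integral>x. F x \<partial>lborel)"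
    using DERIV_unique by metis
  moreover have "(\<integral>x. x \<bullet> dF x \<partial>lborel) = integral C (\<lambda>x. x \<bullet> dF x)"
    unfolding C_def
    by (rule integral_lborel_cbox) (use out[of _ 1] K(3) in \<open>auto intro!: cdF continuous_intros simp: C_def\<close>)
  ultimately show ?thesis by simp
qed

section \<open>Calculus of weak Laplacians\<close>

lemma weak_lapI:
  assumes "\<And>x. x \<in> S \<Longrightarrow> GDERIV u x :> du x" "continuous_on S du" "continuous_on S h"
    "\<And>\<phi> d\<phi>. test_on S \<phi> d\<phi> \<Longrightarrow> (\<integral>x. du x \<bullet> d\<phi> x \<partial>lborel) = - (\<integral>x. h x * \<phi> x \<partial>lborel)"
  shows "weak_lap S u du h"
  using assms unfolding weak_lap_def by (intro conjI ballI allI impI)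

lemma weak_lapD:
  assumes "weak_lap S u du h"
  shows "\<And>x. x \<in> S \<Longrightarrow> GDERIV u x :> du x" "continuous_on S du" "continuous_on S h"
    "\<And>\<phi> d\<phi>. test_on S \<phi> d\<phi> \<Longrightarrow> (\<integral>x. du x \<bullet> d\<phi> x \<partial>lborel) = - (\<integral>x. h x * \<phi> x \<partial>lborel)"
  using assms unfolding weak_lap_def by simp_all

lemma weak_lap_cmult:
  assumes "weak_lap S u du h"
  shows "weak_lap S (\<lambda>x. c * u x) (\<lambda>x. c *\<^sub>R du x) (\<lambda>x. c * h x)"
proof -
  have "GDERIV (\<lambda>x. c * u x) x :> c *\<^sub>R du x" if "x \<in> S" for x
    using GDERIV_mult[OF GDERIV_const[of c] , of u x "du x"] assms that unfolding weak_lap_def by simp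
  then show ?thesis
    using assms unfolding weak_lap_def by (auto intro!: continuous_intros simp: mult.assoc)
qed

lemma weak_lap_diff:
  assumes "weak_lap S u du h" "weak_lap S v dv k"
  shows "weak_lap S (\<lambda>x. u x - v x) (\<lambda>x. du x - dv x) (\<lambda>x. h x - k x)"
  unfolding weak_lap_def
proof (intro conjI allI impI)
  show "\<forall>x\<in>S. GDERIV (\<lambda>x. u x - v x) x :> du x - dv x"
    using assms unfolding weak_lap_def by (auto intro: GDERIV_diff)
  show "continuous_on S (\<lambda>x. du x - dv x)" "continuous_on S (\<lambda>x. h x - k x)"
    using assms unfolding weak_lap_def by (auto intro!: continuous_intros)
  fix \<phi> d\<phi> assume t: "test_on S \<phi> d\<phi>"
  have "(\<integral>x. (du x - dv x) \<bullet> d\<phi> x \<partial>lborel) = (\<integral>x. du x \<bullet> d\<phi> x \<partial>lborel) - (\<integral>x. dv x \<bullet> d\<phi> x \<partial>lborel)"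
    unfolding inner_diff_left using assms unfolding weak_lap_def
    by (intro Bochner_Integration.integral_diff integrable_inner_test[OF t]) auto
  moreover have "(\<integral>x. (h x - k x) * \<phi> x \<partial>lborel) = (\<integral>x. h x * \<phi> x \<partial>lborel) - (\<integral>x. k x * \<phi> x \<partial>lborel)"
    unfolding left_diff_distrib using assms unfolding weak_lap_def
    by (intro Bochner_Integration.integral_diff integrable_mult_test[OF t]) auto
  moreover have "(\<integral>x. du x \<bullet> d\<phi> x \<partial>lborel) = - (\<integral>x. h x * \<phi> x \<partial>lborel)"
      "(\<integral>x. dv x \<bullet> d\<phi> x \<partial>lborel) = - (\<integral>x. k x * \<phi> x \<partial>lborel)"
    by (rule weak_lapD(4)[OF _ t], rule assms)+
  ultimately show "(\<integral>x. (du x - dv x) \<bullet> d\<phi> x \<partial>lborel) = - (\<integral>x. (h x - k x) * \<phi> x \<partial>lborel)"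
    by linarith
qed

lemma weak_lap_subset:
  assumes "weak_lap S u du h" "T \<subseteq> S" shows "weak_lap T u du h"
proof (rule weak_lapI)
  note D = weak_lapD[OF assms(1)]
  show "GDERIV u x :> du x" if "x \<in> T" for x using D(1)[of x] that assms(2) by auto
  show "continuous_on T du" "continuous_on T h"
    by (rule continuous_on_subset[OF _ assms(2)], rule D)+
  show "(\<integral>x. du x \<bullet> d\<phi> x \<partial>lborel) = - (\<integral>x. h x * \<phi> x \<partial>lborel)" if "test_on T \<phi> d\<phi>" for \<phi> d\<phi>
    by (rule D(4)[OF test_on_mono[OF that assms(2)]])
qed

lemma weak_lap_cong:
  assumes "weak_lap S u du h" "\<And>x. x \<in> S \<Longrightarrow> h x = h' x"
  shows "weak_lap S u du h'"
proof (rule weak_lapI)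
  note D = weak_lapD[OF assms(1)]
  show "GDERIV u x :> du x" if "x \<in> S" for x by (rule D(1)[OF that])
  show "continuous_on S du" by (rule D(2))
  show "continuous_on S h'" using D(3) continuous_on_cong[of S S h h'] assms(2) by auto
  fix \<phi> d\<phi> assume t: "test_on S \<phi> d\<phi>"
  obtain K where "K \<subseteq> S" "\<And>x. x \<notin> K \<Longrightarrow> \<phi> x = 0" by (rule test_onE[OF t]) blast
  then have "h x * \<phi> x = h' x * \<phi> x" for x using assms(2)[of x] by (cases "x \<in> K") auto
  then have "(\<integral>x. h x * \<phi> x \<partial>lborel) = (\<integral>x. h' x * \<phi> x \<partial>lborel)"
    by (intro Bochner_Integration.integral_cong refl)
  then show "(\<integral>x. du x \<bullet> d\<phi> x \<partial>lborel) = - (\<integral>x. h' x * \<phi> x \<partial>lborel)"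
    using D(4)[OF t] by (rule subst)
qed

lemma weak_lap_cong_fun:
  assumes "weak_lap S u du h" "open S" "\<And>x. x \<in> S \<Longrightarrow> u x = u' x"
  shows "weak_lap S u' du h"
proof (rule weak_lapI)
  show "GDERIV u' x :> du x" if "x \<in> S" for x
    by (rule GDERIV_cong_open[OF weak_lapD(1)[OF assms(1) that] assms(2) that assms(3)])
qed (use weak_lapD[OF assms(1)] in blast)+

lemma weak_lap_continuous: "weak_lap S u du h \<Longrightarrow> continuous_on S u"
  by (rule GDERIV_continuous_on) (rule weak_lapD(1))

section \<open>Radial functions in the variable ln |x|\<close>

lemma GDERIV_radial:
  fixes x :: "'a::real_inner"
  assumes "x \<noteq> 0" "(P has_real_derivative P') (at (ln (norm x)))"
  shows "GDERIV (\<lambda>x. P (ln (norm x))) x :> (P' / (norm x)\<^sup>2) *\<^sub>R x"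
proof -
  have "GDERIV (\<lambda>x. ln (norm x)) x :> (1 / norm x) *\<^sub>R sgn x"
    by (rule GDERIV_DERIV_compose[OF GDERIV_norm]) (use assms in \<open>auto intro!: derivative_eq_intros\<close>)
  from GDERIV_DERIV_compose[OF this assms(2)] show ?thesis
    using assms(1) by (simp add: sgn_div_norm power2_eq_square divide_simps)
qed

lemma continuous_on_radial:
  fixes S :: "'a::real_normed_vector set"
  assumes "continuous_on I f" "\<And>x. x \<in> S \<Longrightarrow> x \<noteq> 0 \<and> e * ln (norm x) \<in> I"
  shows "continuous_on S (\<lambda>x. f (e * ln (norm x)))"
proof (rule continuous_on_compose2[OF assms(1)])
  show "continuous_on S (\<lambda>x. e * ln (norm x))"
    using assms(2) by (intro continuous_intros) auto
qed (use assms(2) in auto)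

lemma open_radial:
  fixes I :: "real set"
  assumes "open I"
  shows "open {x::'a::real_normed_vector. x \<noteq> 0 \<and> e * ln (norm x) \<in> I}"
proof -
  have "continuous_on (- {0::'a}) (\<lambda>x. e * ln (norm x))" by (intro continuous_intros) auto
  then have "open ((\<lambda>x. e * ln (norm x)) -` I \<inter> (- {0::'a}))"
    using continuous_on_open_vimage[of "- {0::'a}"] assms by auto
  moreover have "(\<lambda>x. e * ln (norm x)) -` I \<inter> (- {0::'a}) = {x. x \<noteq> 0 \<and> e * ln (norm x) \<in> I}" by auto
  ultimately show ?thesis by simp
qed

lemma has_real_derivative_scale:
  assumes "(f has_real_derivative D) (at (e * t))"
  shows "((\<lambda>t. f (e * t)) has_real_derivative e * D) (at t)"
  using DERIV_chain'[OF DERIV_cmult_Id assms] by (simp add: mult.commute[of D])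

text \<open>The gradient is the field \<open>Q x *\<^sub>R x\<close> with a radial factor
  \<open>Q\<close>. The radial divergence theorem for the product \<phi> Q moves the derivative from
  \<phi> to \<open>Q\<close> and leaves the right-hand side x \<bullet> \<nabla>Q + N Q. The sign
  \<open>e\<close> lets the variable run towards infinity or towards the origin.\<close>

lemma weak_lap_radial:
  fixes f f' f'' :: "real \<Rightarrow> real" and e :: real and I :: "real set"
  defines "S \<equiv> {x::'a::euclidean_space. x \<noteq> 0 \<and> e * ln (norm x) \<in> I}"
  assumes "open I" and e: "e * e = 1"
    and f': "\<And>t. t \<in> I \<Longrightarrow> (f has_real_derivative f' t) (at t)"
    and f'': "\<And>t. t \<in> I \<Longrightarrow> (f' has_real_derivative f'' t) (at t)"
    and cont: "continuous_on I f''"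
  shows "weak_lap S (\<lambda>x. f (e * ln (norm x))) (\<lambda>x. (e * f' (e * ln (norm x)) / (norm x)\<^sup>2) *\<^sub>R x)
     (\<lambda>x. (f'' (e * ln (norm x)) + e * (real DIM('a) - 2) * f' (e * ln (norm x))) / (norm x)\<^sup>2)"
proof -
  define s where "s x = e * ln (norm x)" for x :: 'a
  define Q where "Q x = e * f' (s x) / (norm x)\<^sup>2" for x :: 'a
  define dQ where "dQ x = ((f'' (s x) - 2 * e * f' (s x)) / (norm x)\<^sup>2 / (norm x)\<^sup>2) *\<^sub>R x" for x :: 'a
  define h where "h x = (f'' (s x) + e * (real DIM('a) - 2) * f' (s x)) / (norm x)\<^sup>2" for x :: 'a
  have S: "x \<noteq> 0" "s x \<in> I" if "x \<in> S" for x using that by (auto simp: S_def s_def)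
  have oS: "open S" unfolding S_def by (rule open_radial[OF assms(2)])
  have cf': "continuous_on I f'" using f'' by (meson DERIV_atLeastAtMost_imp_continuous_on DERIV_isCont continuous_at_imp_continuous_on)
  have cs: "continuous_on S (\<lambda>x. f' (s x))" "continuous_on S (\<lambda>x. f'' (s x))"
    unfolding s_def by (rule continuous_on_radial[of I]; use cf' cont S in \<open>auto simp: s_def\<close>)+
  have du: "GDERIV (\<lambda>x. f (s x)) x :> Q x *\<^sub>R x" if "x \<in> S" for x
  proof -
    have "((\<lambda>t. f (e * t)) has_real_derivative (e * f' (s x))) (at (ln (norm x)))"
      using has_real_derivative_scale f'[OF S(2)[OF that]] unfolding s_def .
    from GDERIV_radial[OF S(1)[OF that] this] show ?thesis by (simp add: s_def Q_def)
  qed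
  have dQ: "GDERIV Q x :> dQ x" if "x \<in> S" for x
  proof -
    \<comment> \<open>\<open>Q\<close> is radial as well; in its profile, exp(-2t) stands for 1 /
      |x|^2.\<close>
    let ?P = "\<lambda>t. e * f' (e * t) * exp (- 2 * t)"
    have d: "((\<lambda>t. f' (e * t)) has_real_derivative (e * f'' (s x))) (at (ln (norm x)))"
      using has_real_derivative_scale f''[OF S(2)[OF that]] unfolding s_def .
    have "(?P has_real_derivative ((e * e) * f'' (s x) * exp (- 2 * ln (norm x)) - 2 * e * f' (s x) * exp (- 2 * ln (norm x)))) (at (ln (norm x)))"
      by (rule derivative_eq_intros d refl)+ (simp add: s_def algebra_simps)
    moreover have ex: "exp (- 2 * ln (norm y)) = 1 / (norm y)\<^sup>2" if "y \<in> S" for y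
      using S(1)[OF that] exp_double[of "ln (norm y)"] by (simp add: exp_minus inverse_eq_divide)
    moreover have "(e * e) * f'' (s x) * (1 / (norm x)\<^sup>2) - 2 * e * f' (s x) * (1 / (norm x)\<^sup>2)
        = (f'' (s x) - 2 * e * f' (s x)) / (norm x)\<^sup>2"
      by (simp add: e diff_divide_distrib)
    ultimately have "(?P has_real_derivative (f'' (s x) - 2 * e * f' (s x)) / (norm x)\<^sup>2) (at (ln (norm x)))"
      using that by simp
    from GDERIV_radial[OF S(1)[OF that] this]
    have "GDERIV (\<lambda>x. ?P (ln (norm x))) x :> dQ x" unfolding dQ_def .
    moreover have "?P (ln (norm y)) = Q y" if "y \<in> S" for y
      unfolding ex[OF that] Q_def s_def by simp
    ultimately show ?thesis using GDERIV_cong_open[OF _ oS that] by blast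
  qed
  have cQ: "continuous_on S Q" using dQ by (rule GDERIV_continuous_on)
  have cdQ: "continuous_on S dQ" "continuous_on S h"
    unfolding dQ_def h_def by (intro continuous_intros cs; use S in auto)+
  have eq: "(\<integral>x. (Q x *\<^sub>R x) \<bullet> d\<phi> x \<partial>lborel) = - (\<integral>x. h x * \<phi> x \<partial>lborel)" if t: "test_on S \<phi> d\<phi>" for \<phi> d\<phi>
  proof -
    obtain K where K: "compact K" "K \<subseteq> S" "\<And>x. x \<notin> K \<Longrightarrow> \<phi> x = 0" "\<And>x. x \<notin> K \<Longrightarrow> d\<phi> x = 0"
      "\<And>x. GDERIV \<phi> x :> d\<phi> x" "continuous_on UNIV d\<phi>" "continuous_on UNIV \<phi>"
      by (rule test_onE[OF t]) blast
    let ?F = "\<lambda>x. if x \<in> S then \<phi> x * Q x else 0"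
    let ?dF = "\<lambda>x. if x \<in> S then \<phi> x *\<^sub>R dQ x + Q x *\<^sub>R d\<phi> x else 0"
    have "test_on S ?F ?dF"
    proof (rule test_on_extend[OF oS _ _ K(1,2)])
      show "GDERIV (\<lambda>x. \<phi> x * Q x) x :> \<phi> x *\<^sub>R dQ x + Q x *\<^sub>R d\<phi> x" if "x \<in> S" for x
        by (rule GDERIV_mult[OF K(5) dQ[OF that]])
      show "continuous_on S (\<lambda>x. \<phi> x *\<^sub>R dQ x + Q x *\<^sub>R d\<phi> x)"
        by (intro continuous_intros cQ cdQ continuous_on_subset[OF K(6)] continuous_on_subset[OF K(7)]) auto
    qed (use K(3) in simp)
    from integral_radial_derivative[OF this]
    have *: "(\<integral>x. x \<bullet> ?dF x \<partial>lborel) = - real DIM('a) * (\<integral>x. ?F x \<partial>lborel)" .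
    have F: "?F x = Q x * \<phi> x" for x using K(2) K(3)[of x] by auto
    have dF: "x \<bullet> ?dF x = ((f'' (s x) - 2 * e * f' (s x)) / (norm x)\<^sup>2) * \<phi> x + (Q x *\<^sub>R x) \<bullet> d\<phi> x" for x
    proof (cases "x \<in> S")
      case True
      then have "x \<bullet> ?dF x = \<phi> x * (x \<bullet> dQ x) + Q x * (x \<bullet> d\<phi> x)" by (simp add: inner_add_right)
      moreover have "x \<bullet> dQ x = (f'' (s x) - 2 * e * f' (s x)) / (norm x)\<^sup>2"
      proof -
        have *: "A / c / c * c = A / c" if "c \<noteq> 0" for A c :: real using that by simp
        show ?thesis
          unfolding dQ_def inner_scaleR_right power2_norm_eq_inner[symmetric]
          by (rule *) (use S(1)[OF True] in simp)
      qed
      ultimately show ?thesis by (simp only: inner_scaleR_left mult.commute[of "\<phi> x"])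
    next
      case False
      then have "\<phi> x = 0" "d\<phi> x = 0" using K(2) K(3)[of x] K(4)[of x] by auto
      then show ?thesis using False by simp
    qed
    have i1: "integrable lborel (\<lambda>x. ((f'' (s x) - 2 * e * f' (s x)) / (norm x)\<^sup>2) * \<phi> x)"
      by (rule integrable_mult_test[OF t]) (intro continuous_intros cs; use S in auto)
    have i2: "integrable lborel (\<lambda>x. (Q x *\<^sub>R x) \<bullet> d\<phi> x)"
      by (rule integrable_inner_test[OF t]) (intro continuous_intros cQ)
    have i3: "integrable lborel (\<lambda>x. Q x * \<phi> x)" by (rule integrable_mult_test[OF t cQ])
    have "(\<integral>x. (Q x *\<^sub>R x) \<bullet> d\<phi> x \<partial>lborel) = - ((\<integral>x. ((f'' (s x) - 2 * e * f' (s x)) / (norm x)\<^sup>2) * \<phi> x \<partial>lborel)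
       + (\<integral>x. real DIM('a) * (Q x * \<phi> x) \<partial>lborel))"
      using * unfolding dF F by (subst (asm) Bochner_Integration.integral_add[OF i1 i2]) simp
    also have "\<dots> = - (\<integral>x. ((f'' (s x) - 2 * e * f' (s x)) / (norm x)\<^sup>2) * \<phi> x + real DIM('a) * (Q x * \<phi> x) \<partial>lborel)"
      using i1 i3 by simp
    also have "(\<lambda>x. ((f'' (s x) - 2 * e * f' (s x)) / (norm x)\<^sup>2) * \<phi> x + real DIM('a) * (Q x * \<phi> x)) = (\<lambda>x. h x * \<phi> x)"
    proof -
      have "(A - 2 * e * p) / n * r + N * (e * p / n * r) = (A + e * (N - 2) * p) / n * r" for A p n N r :: real
        unfolding divide_inverse by algebra
      then show ?thesis unfolding h_def Q_def by blast
    qed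
    finally show ?thesis .
  qed
  show ?thesis
    unfolding weak_lap_def s_def[symmetric] Q_def[symmetric] h_def[symmetric]
    by (intro conjI ballI allI impI)
      (rule du eq cdQ(2) continuous_on_scaleR[OF cQ continuous_on_id]; assumption?)+
qed

section \<open>Comparison principle\<close>

text \<open>Picone's device: the two equations are tested with \<open>z G(u/z)\<close> and \<open>u G(u/z)\<close>, where
  \<open>G(r) = ((r - 1)\<^sup>+)\<^sup>2\<close>, because \<open>z\<nabla>u - u\<nabla>z = z\<^sup>2\<nabla>(u/z)\<close>.\<close>

lemma weak_comparison:
  fixes S :: "'a::euclidean_space set"
  assumes S: "open S" and u: "weak_lap S u du hu" and z: "weak_lap S z dz hz"
    and K: "compact K" "K \<subseteq> S" "\<And>x. x \<in> S - K \<Longrightarrow> u x \<le> z x"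
    and zpos: "\<And>x. x \<in> S \<Longrightarrow> z x > 0"
    and h: "\<And>x. x \<in> S \<Longrightarrow> u x > z x \<Longrightarrow> hu x * z x > hz x * u x"
    and xS: "x \<in> S"
  shows "u x \<le> z x"
proof (rule ccontr)
  assume neg: "\<not> u x \<le> z x"
  define G where "G r = (max 0 (r - 1))\<^sup>2" for r :: real
  define G' where "G' r = 2 * max 0 (r - 1)" for r :: real
  have G: "(G has_real_derivative G' r) (at r)" for r
    using has_real_derivative_pos_part_square[of "r + - 1"] DERIV_shift[of "\<lambda>r. (max 0 r)\<^sup>2" "G' r" r "- 1"]
    by (simp add: G_def[abs_def] G'_def)
  have cG: "continuous_on A (\<lambda>x. G (f x))" "continuous_on A (\<lambda>x. G' (f x))"
    if "continuous_on A f" for A and f :: "'a \<Rightarrow> real"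
    unfolding G_def G'_def using that by (auto intro!: continuous_intros)
  have cu: "continuous_on S u" "continuous_on S z" "continuous_on S du" "continuous_on S dz"
      "continuous_on S hu" "continuous_on S hz"
    by (rule weak_lap_continuous[OF u] weak_lap_continuous[OF z] weak_lapD[OF u] weak_lapD[OF z])+
  have gu: "GDERIV u y :> du y" "GDERIV z y :> dz y" if "y \<in> S" for y
    by (rule weak_lapD(1)[OF u that] weak_lapD(1)[OF z that])+
  define r where "r y = u y / z y" for y
  define dr where "dr y = (1 / z y) *\<^sub>R du y - (u y / (z y)\<^sup>2) *\<^sub>R dz y" for y
  have zn: "z y \<noteq> 0" if "y \<in> S" for y using zpos[OF that] by simp
  have gr: "GDERIV r y :> dr y" if "y \<in> S" for y
    unfolding r_def[abs_def] divide_inverse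
    by (rule GDERIV_subst[OF GDERIV_mult[OF gu(1)[OF that] GDERIV_inverse[OF gu(2)[OF that] zn[OF that]]]])
       (simp add: dr_def divide_inverse power2_eq_square)
  have cr: "continuous_on S r" "continuous_on S dr"
    unfolding r_def dr_def by (intro continuous_intros cu; use zn in auto)+
  define T where "T y = G (r y)" for y
  define dT where "dT y = G' (r y) *\<^sub>R dr y" for y
  have gT: "GDERIV T y :> dT y" if "y \<in> S" for y
    unfolding T_def[abs_def] dT_def by (rule GDERIV_DERIV_compose[OF gr[OF that] G])
  have cT: "continuous_on S T" "continuous_on S dT"
    unfolding T_def dT_def by (intro continuous_intros cG cr)+
  \<comment> \<open>Outside \<open>K\<close> the ratio u/z is at most 1, so both test functions are
    supported in the compact set \<open>K\<close>; this replaces boundary conditions.\<close>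
  have T0: "T y = 0" if "y \<in> S - K" for y
    using K(3)[OF that] zpos[of y] that by (simp add: T_def G_def r_def max_def)
  define t1 where "t1 y = (if y \<in> S then z y * T y else 0)" for y
  define d1 where "d1 y = (if y \<in> S then z y *\<^sub>R dT y + T y *\<^sub>R dz y else 0)" for y
  define t2 where "t2 y = (if y \<in> S then u y * T y else 0)" for y
  define d2 where "d2 y = (if y \<in> S then u y *\<^sub>R dT y + T y *\<^sub>R du y else 0)" for y
  have test1: "test_on S t1 d1"
    unfolding t1_def[abs_def] d1_def[abs_def]
    by (rule test_on_extend[OF S _ _ K(1,2)]) (use gu gT T0 cT cu in \<open>auto intro!: GDERIV_mult continuous_intros\<close>)
  have test2: "test_on S t2 d2"
    unfolding t2_def[abs_def] d2_def[abs_def]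
    by (rule test_on_extend[OF S _ _ K(1,2)]) (use gu gT T0 cT cu in \<open>auto intro!: GDERIV_mult continuous_intros\<close>)
  have e1: "(\<integral>y. du y \<bullet> d1 y \<partial>lborel) = - (\<integral>y. hu y * t1 y \<partial>lborel)"
    by (rule weak_lapD(4)[OF u test1])
  have e2: "(\<integral>y. dz y \<bullet> d2 y \<partial>lborel) = - (\<integral>y. hz y * t2 y \<partial>lborel)"
    by (rule weak_lapD(4)[OF z test2])
  \<comment> \<open>The terms containing \<open>T\<close> cancel, and what remains of the integrand
    is z^2 G'(r) |\<nabla>r|^2.\<close>
  have "0 \<le> (\<integral>y. du y \<bullet> d1 y - dz y \<bullet> d2 y \<partial>lborel)"
  proof (rule Bochner_Integration.integral_nonneg)
    fix y
    show "0 \<le> du y \<bullet> d1 y - dz y \<bullet> d2 y"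
    proof (cases "y \<in> S")
      case True
      have "z y *\<^sub>R du y - u y *\<^sub>R dz y = (z y)\<^sup>2 *\<^sub>R dr y"
        using zn[OF True] by (simp add: dr_def scaleR_diff_right power2_eq_square)
      moreover have "du y \<bullet> d1 y - dz y \<bullet> d2 y = (z y *\<^sub>R du y - u y *\<^sub>R dz y) \<bullet> dT y"
        using True by (simp add: d1_def d2_def inner_add_right inner_diff_left inner_commute algebra_simps)
      ultimately show ?thesis by (simp add: dT_def G'_def)
    qed (simp add: d1_def d2_def)
  qed
  also have "\<dots> = (\<integral>y. du y \<bullet> d1 y \<partial>lborel) - (\<integral>y. dz y \<bullet> d2 y \<partial>lborel)"
    by (intro Bochner_Integration.integral_diff integrable_inner_test[OF test1] integrable_inner_test[OF test2] cu)
  also have "\<dots> = - ((\<integral>y. hu y * t1 y \<partial>lborel) - (\<integral>y. hz y * t2 y \<partial>lborel))" using e1 e2 by simp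
  also have "(\<integral>y. hu y * t1 y \<partial>lborel) - (\<integral>y. hz y * t2 y \<partial>lborel) = (\<integral>y. hu y * t1 y - hz y * t2 y \<partial>lborel)"
    by (intro Bochner_Integration.integral_diff[symmetric] integrable_mult_test[OF test1] integrable_mult_test[OF test2] cu)
  finally have le: "(\<integral>y. hu y * t1 y - hz y * t2 y \<partial>lborel) \<le> 0" by simp
  \<comment> \<open>By \<open>h\<close> this is nonnegative everywhere and positive on the open set
    where u > z, while its integral is at most 0; so that set is empty.\<close>
  define P where "P y = hu y * t1 y - hz y * t2 y" for y
  have PS: "P y = (hu y * z y - hz y * u y) * T y" if "y \<in> S" for y
    using that by (simp add: P_def t1_def t2_def algebra_simps)
  have Tpos: "T y > 0 \<longleftrightarrow> u y > z y" "T y \<ge> 0" "T y = 0 \<longleftrightarrow> u y \<le> z y" if "y \<in> S" for y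
    using zpos[OF that] by (auto simp: T_def G_def r_def max_def)
  have Pnn: "P y \<ge> 0" for y
  proof (cases "y \<in> S")
    case True
    then show ?thesis using PS[OF True] Tpos[OF True] h[OF True] by (cases "u y > z y") auto
  qed (simp add: P_def t1_def t2_def)
  have Pint: "integrable lborel P"
    unfolding P_def
    by (intro Bochner_Integration.integrable_diff integrable_mult_test[OF test1] integrable_mult_test[OF test2] cu)
  define U where "U = {y \<in> S. u y - z y > 0}"
  have "open U"
  proof -
    have "open (S \<inter> (\<lambda>y. u y - z y) -` {0<..})"
      by (intro continuous_open_preimage continuous_intros cu S open_greaterThan)
    moreover have "S \<inter> (\<lambda>y. u y - z y) -` {0<..} = U" by (auto simp: U_def)
    ultimately show ?thesis by simp
  qed
  moreover have "x \<in> U" using neg xS by (simp add: U_def)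
  moreover have "P y > 0" if "y \<in> U" for y
    using that PS[of y] Tpos[of y] h[of y] unfolding U_def by auto
  ultimately have "0 < (\<integral>y. P y \<partial>lborel)" by (rule integral_pos_if_pos_on_open[OF Pint Pnn])
  then show False using le[folded P_def] by simp
qed

section \<open>Harnack's inequality\<close>

text \<open>With this weight, the derivative of the average in its radius is the weak equation
  tested with a \<open>C\<^sup>1\<close> function; see \<open>test_on_par\<close>.\<close>

definition bump :: "'a::euclidean_space \<Rightarrow> real" where
  "bump \<eta> = max 0 (1 - (norm \<eta>)\<^sup>2)"

text \<open>Up to a constant factor, the weighted average over the ball of radius \<open>r\<close>
  about \<open>z\<close>. The rescaled variable keeps the domain independent of \<open>r\<close>, so
  that one may differentiate in \<open>r\<close> under the integral.\<close>

definition bump_mean :: "('a::euclidean_space \<Rightarrow> real) \<Rightarrow> 'a \<Rightarrow> real \<Rightarrow> real" where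
  "bump_mean y z r = (\<integral>\<eta>. y (z + r *\<^sub>R \<eta>) * bump \<eta> \<partial>lborel)"

lemma bump_nonneg: "0 \<le> bump \<eta>" by (simp add: bump_def)

lemma continuous_bump: "continuous_on A bump"
  unfolding bump_def by (intro continuous_intros)

lemma bump_eq_0: "1 \<le> norm \<eta> \<Longrightarrow> bump \<eta> = 0"
  using power_mono[of 1 "norm \<eta>" 2] by (simp add: bump_def)

lemma bump_integral_pos: "0 < (\<integral>\<eta>. bump (\<eta>::'a::euclidean_space) \<partial>lborel)"
proof -
  have i: "integrable lborel (bump :: 'a \<Rightarrow> real)"
    by (rule integrable_compact_support[OF compact_cball[of 0 1] continuous_bump]) (simp add: bump_eq_0)
  show ?thesis
  proof (rule integral_pos_if_pos_on_open[OF i bump_nonneg open_ball])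
    show "(0::'a) \<in> ball 0 1" by simp
    show "0 < bump \<eta>" if "\<eta> \<in> ball (0::'a) 1" for \<eta>
      using that abs_square_less_1[of "norm \<eta>"] by (simp add: bump_def)
  qed
qed

text \<open>The same weight in the unscaled variable, multiplied by
  \<open>r\<^sup>2\<close>.\<close>

definition par :: "'a::euclidean_space \<Rightarrow> real \<Rightarrow> 'a \<Rightarrow> real" where
  "par z r x = max 0 (r\<^sup>2 - (norm (x - z))\<^sup>2)"

lemma par_scale: "0 < r \<Longrightarrow> par z r (z + r *\<^sub>R \<eta>) = r\<^sup>2 * bump \<eta>"
proof -
  assume "0 < r"
  have *: "max 0 (c - c * n) = c * max 0 (1 - n)" if "0 \<le> c" for c n :: real
  proof (cases "n \<le> 1")
    case True
    then have "c * n \<le> c * 1" using that by (rule mult_left_mono)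
    then show ?thesis using True by (simp add: right_diff_distrib)
  next
    case False
    then have "c * 1 \<le> c * n" using that by (intro mult_left_mono) auto
    then show ?thesis using False by simp
  qed
  have "(norm (z + r *\<^sub>R \<eta> - z))\<^sup>2 = r\<^sup>2 * (norm \<eta>)\<^sup>2" by (simp add: power_mult_distrib)
  then show ?thesis unfolding par_def bump_def by (simp only: *[of "r\<^sup>2"] zero_le_power2)
qed

lemma continuous_par: "continuous_on A (par z r)"
  unfolding par_def by (intro continuous_intros)

lemma par_nonneg: "0 \<le> par z r x" by (simp add: par_def)

lemma par_eq_0: "0 \<le> r \<Longrightarrow> x \<notin> cball z r \<Longrightarrow> par z r x = 0"
  using power_mono[of r "norm (x - z)" 2] by (simp add: par_def dist_norm norm_minus_commute)

lemma par_le: "par z r x \<le> r\<^sup>2" by (simp add: par_def)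

lemma bump_mean_eq:
  fixes y :: "'a::euclidean_space \<Rightarrow> real"
  assumes "continuous_on (cball z r) y" "0 < r"
  shows "integrable lborel (\<lambda>x. y x * par z r x)"
    "bump_mean y z r = (\<integral>x. y x * par z r x \<partial>lborel) / r ^ (DIM('a) + 2)"
proof -
  show i: "integrable lborel (\<lambda>x. y x * par z r x)"
    by (rule integrable_compact_support[OF compact_cball[of z r]])
       (use assms in \<open>auto intro!: continuous_intros continuous_par simp del: mem_cball simp: par_eq_0\<close>)
  have "(\<integral>\<eta>. y (z + r *\<^sub>R \<eta>) * par z r (z + r *\<^sub>R \<eta>) \<partial>lborel) = (\<integral>x. y x * par z r x \<partial>lborel) / r ^ DIM('a)"
    using i by (intro integral_lborel_affine[OF assms(2)]) simp
  also have "(\<integral>\<eta>. y (z + r *\<^sub>R \<eta>) * par z r (z + r *\<^sub>R \<eta>) \<partial>lborel) = r\<^sup>2 * bump_mean y z r"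
    unfolding bump_mean_def par_scale[OF assms(2)] by (simp add: mult.left_commute flip: Bochner_Integration.integral_mult_right_zero)
  finally show "bump_mean y z r = (\<integral>x. y x * par z r x \<partial>lborel) / r ^ (DIM('a) + 2)"
    using assms(2) by (simp add: power_add power2_eq_square field_simps)
qed

lemma bump_mean_0:
  fixes z :: "'a::euclidean_space"
  shows "bump_mean y z 0 = y z * (\<integral>\<eta>. bump (\<eta>::'a) \<partial>lborel)"
  by (simp add: bump_mean_def)

text \<open>The gradient of this function is, up to sign, the weight times x - z: precisely the
  field that arises when \<open>bump_mean\<close> is differentiated in the radius.\<close>

lemma test_on_par:
  fixes z :: "'a::euclidean_space"
  assumes "0 < r" "cball z r \<subseteq> S"
  shows "test_on S (\<lambda>x. (par z r x)\<^sup>2 / 4) (\<lambda>x. - par z r x *\<^sub>R (x - z))"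
proof -
  have d: "((\<lambda>t. (max 0 (r\<^sup>2 - t))\<^sup>2 / 4) has_real_derivative (- max 0 (r\<^sup>2 - t) / 2)) (at t)" for t :: real
  proof -
    have "((\<lambda>t. r\<^sup>2 - t) has_real_derivative - 1) (at t)" by (auto intro!: derivative_eq_intros)
    from DERIV_cdivide[OF DERIV_chain'[OF this has_real_derivative_pos_part_square], of 4]
    show ?thesis by (rule DERIV_cong) simp
  qed
  have n: "GDERIV (\<lambda>x. (norm (x - z))\<^sup>2) x :> 2 *\<^sub>R (x - z)" for x
    unfolding power2_norm_eq_inner gderiv_def
    by (auto intro!: derivative_eq_intros simp: inner_commute inner_diff_left inner_diff_right)
  have 1: "GDERIV (\<lambda>x. (par z r x)\<^sup>2 / 4) x :> - par z r x *\<^sub>R (x - z)" for x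
    using GDERIV_DERIV_compose[OF n d, of x] by (simp add: par_def)
  have 2: "continuous_on UNIV (\<lambda>x. - par z r x *\<^sub>R (x - z))"
    by (intro continuous_intros continuous_par)
  have 3: "(par z r x)\<^sup>2 / 4 = 0" if "x \<notin> cball z r" for x
    using par_eq_0[OF _ that] assms(1) by simp
  show ?thesis
    unfolding test_on_def
    by (intro conjI allI impI exI[of _ "cball z r"] 1 2 3 compact_cball assms(2))
qed

text \<open>The cube, rather than the ball, is the domain of integration, hence the factor \<open>DIM('a)\<close>.\<close>

lemma bump_mean_derivative:
  fixes y :: "'a::euclidean_space \<Rightarrow> real"
  assumes w: "weak_lap S y dy h" and S: "cball z (R * real DIM('a)) \<subseteq> S" and r: "0 \<le> r" "r \<le> R"
  shows "(bump_mean y z has_real_derivative (\<integral>\<eta>. (\<eta> \<bullet> dy (z + r *\<^sub>R \<eta>)) * bump \<eta> \<partial>lborel)) (at r within {0..R})"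
proof -
  let ?C = "cbox (- One) (One::'a)"
  have nC: "norm \<eta> \<le> real DIM('a)" if "\<eta> \<in> ?C" for \<eta>
  proof -
    have "norm \<eta> \<le> (\<Sum>b\<in>Basis. \<bar>\<eta> \<bullet> b\<bar>)" by (rule norm_le_l1)
    also have "\<dots> \<le> (\<Sum>b\<in>(Basis::'a set). 1)"
      using that by (intro sum_mono) (auto simp: mem_box abs_le_iff)
    finally show ?thesis by simp
  qed
  have inS: "z + s *\<^sub>R \<eta> \<in> S" if "\<eta> \<in> ?C" "s \<in> {0..R}" for \<eta> s
  proof -
    have "norm (s *\<^sub>R \<eta>) \<le> R * real DIM('a)" using nC[OF that(1)] that(2) by (auto intro!: mult_mono)
    then show ?thesis using S by (auto simp: dist_norm)
  qed
  have out: "bump \<eta> = 0" if "\<eta> \<notin> ?C" for \<eta>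
    using cbox_uminus_norm_le[of \<eta> 1] that bump_eq_0[of \<eta>] by force
  have cy: "continuous_on S y" "continuous_on S dy" by (rule weak_lap_continuous[OF w], rule weak_lapD[OF w])
  have c2: "continuous_on ({0..R} \<times> ?C) (\<lambda>p. dy (z + fst p *\<^sub>R snd p))"
    by (rule continuous_on_compose2[OF cy(2)]) (use inS in \<open>auto intro!: continuous_intros\<close>)
  have c1: "continuous_on ?C (\<lambda>\<eta>. y (z + s *\<^sub>R \<eta>))" "continuous_on ?C (\<lambda>\<eta>. dy (z + s *\<^sub>R \<eta>))" if "s \<in> {0..R}" for s
    by (rule continuous_on_compose2[OF cy(1)] continuous_on_compose2[OF cy(2)];
        use inS[OF _ that] in \<open>auto intro!: continuous_intros\<close>)+
  have "((\<lambda>s. integral ?C (\<lambda>\<eta>. y (z + s *\<^sub>R \<eta>) * bump \<eta>)) has_real_derivative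
     integral ?C (\<lambda>\<eta>. (\<eta> \<bullet> dy (z + r *\<^sub>R \<eta>)) * bump \<eta>)) (at r within {0..R})"
  proof (rule leibniz_rule_field_derivative[where U = "{0..R}" and f = "\<lambda>s \<eta>. y (z + s *\<^sub>R \<eta>) * bump \<eta>" and fx = "\<lambda>s \<eta>. (\<eta> \<bullet> dy (z + s *\<^sub>R \<eta>)) * bump \<eta>"])
    fix s \<eta> assume s: "s \<in> {0..R}" "\<eta> \<in> ?C"
    have "((\<lambda>s. y (z + s *\<^sub>R \<eta>)) has_real_derivative \<eta> \<bullet> dy (z + s *\<^sub>R \<eta>)) (at s within {0..R})"
      by (rule GDERIV_along[where p = "\<lambda>s. z + s *\<^sub>R \<eta>", OF weak_lapD(1)[OF w inS[OF s(2,1)]]])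
        (auto intro!: derivative_eq_intros)
    then show "((\<lambda>s. y (z + s *\<^sub>R \<eta>) * bump \<eta>) has_real_derivative (\<eta> \<bullet> dy (z + s *\<^sub>R \<eta>)) * bump \<eta>) (at s within {0..R})"
      by (rule DERIV_cmult_right)
  next
    show "(\<lambda>\<eta>. y (z + s *\<^sub>R \<eta>) * bump \<eta>) integrable_on ?C" if "s \<in> {0..R}" for s
      by (intro integrable_continuous continuous_intros c1[OF that] continuous_bump)
    show "continuous_on ({0..R} \<times> ?C) (\<lambda>(s, \<eta>). (\<eta> \<bullet> dy (z + s *\<^sub>R \<eta>)) * bump \<eta>)"
      unfolding split_beta
      by (intro continuous_intros c2 continuous_on_compose2[OF continuous_bump[of UNIV]]) auto
  qed (use r in auto)
  moreover have "integral ?C (\<lambda>\<eta>. y (z + s *\<^sub>R \<eta>) * bump \<eta>) = bump_mean y z s" if "s \<in> {0..R}" for s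
    unfolding bump_mean_def
    by (rule integral_lborel_cbox[symmetric]) (use out in \<open>auto intro!: continuous_intros c1[OF that] continuous_bump\<close>)
  moreover have "integral ?C (\<lambda>\<eta>. (\<eta> \<bullet> dy (z + r *\<^sub>R \<eta>)) * bump \<eta>) = (\<integral>\<eta>. (\<eta> \<bullet> dy (z + r *\<^sub>R \<eta>)) * bump \<eta> \<partial>lborel)"
    by (rule integral_lborel_cbox[symmetric]) (use out r in \<open>auto intro!: continuous_intros c1 continuous_bump\<close>)
  ultimately show ?thesis
    using has_field_derivative_transform_within[of "\<lambda>s. integral ?C (\<lambda>\<eta>. y (z + s *\<^sub>R \<eta>) * bump \<eta>)" _ r "{0..R}" 1 "bump_mean y z"] r
    by simp
qed

text \<open>By the weak equation, r^3 M'(r) equals the integral of h par^2 / 4, divided by r^N. Here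
  |h| is at most K y, one factor par is at most r^2, and the other factor reproduces the
  average.\<close>

lemma bump_mean_derivative_bound:
  fixes y :: "'a::euclidean_space \<Rightarrow> real"
  assumes w: "weak_lap S y dy h" and S: "cball z r \<subseteq> S" and r: "0 < r"
    and h: "\<And>x. x \<in> cball z r \<Longrightarrow> \<bar>h x\<bar> \<le> K * y x"
  shows "\<bar>\<integral>\<eta>. (\<eta> \<bullet> dy (z + r *\<^sub>R \<eta>)) * bump \<eta> \<partial>lborel\<bar> \<le> K * r / 4 * bump_mean y z r"
proof -
  let ?d = "DIM('a)"
  note t = test_on_par[OF r S]
  have cy: "continuous_on S y" "continuous_on S dy" "continuous_on S h"
    by (rule weak_lap_continuous[OF w] weak_lapD[OF w])+
  have i: "integrable lborel (\<lambda>x. dy x \<bullet> (- par z r x *\<^sub>R (x - z)))"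
    by (rule integrable_inner_test[OF t cy(2)])
  have "(\<integral>\<eta>. dy (z + r *\<^sub>R \<eta>) \<bullet> (- par z r (z + r *\<^sub>R \<eta>) *\<^sub>R (z + r *\<^sub>R \<eta> - z)) \<partial>lborel)
     = (\<integral>x. dy x \<bullet> (- par z r x *\<^sub>R (x - z)) \<partial>lborel) / r ^ ?d"
    using i by (intro integral_lborel_affine[OF r, of "\<lambda>x. dy x \<bullet> (- par z r x *\<^sub>R (x - z))"]) simp
  also have "(\<lambda>\<eta>. dy (z + r *\<^sub>R \<eta>) \<bullet> (- par z r (z + r *\<^sub>R \<eta>) *\<^sub>R (z + r *\<^sub>R \<eta> - z))) = (\<lambda>\<eta>. - (r ^ 3) * ((\<eta> \<bullet> dy (z + r *\<^sub>R \<eta>)) * bump \<eta>))"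
    unfolding par_scale[OF r] by (simp add: fun_eq_iff inner_commute power3_eq_cube power2_eq_square)
  finally have "- (r ^ 3) * (\<integral>\<eta>. (\<eta> \<bullet> dy (z + r *\<^sub>R \<eta>)) * bump \<eta> \<partial>lborel) = (\<integral>x. dy x \<bullet> (- par z r x *\<^sub>R (x - z)) \<partial>lborel) / r ^ ?d"
    by (simp only: Bochner_Integration.integral_mult_right_zero)
  also have "(\<integral>x. dy x \<bullet> (- par z r x *\<^sub>R (x - z)) \<partial>lborel) = - (\<integral>x. h x * ((par z r x)\<^sup>2 / 4) \<partial>lborel)"
    by (rule weak_lapD(4)[OF w t])
  finally have eq: "r ^ 3 * (\<integral>\<eta>. (\<eta> \<bullet> dy (z + r *\<^sub>R \<eta>)) * bump \<eta> \<partial>lborel) = (\<integral>x. h x * ((par z r x)\<^sup>2 / 4) \<partial>lborel) / r ^ ?d"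
    by simp
  have cy': "continuous_on (cball z r) y" by (rule continuous_on_subset[OF cy(1) S])
  have "\<bar>\<integral>x. h x * ((par z r x)\<^sup>2 / 4) \<partial>lborel\<bar> \<le> (\<integral>x. K * r\<^sup>2 / 4 * (y x * par z r x) \<partial>lborel)"
  proof (rule Bochner_Integration.integral_abs_bound[THEN order_trans] , rule Bochner_Integration.integral_mono)
    show "integrable lborel (\<lambda>x. \<bar>h x * ((par z r x)\<^sup>2 / 4)\<bar>)"
      by (intro Bochner_Integration.integrable_abs integrable_mult_test[OF t cy(3)])
    show "integrable lborel (\<lambda>x. K * r\<^sup>2 / 4 * (y x * par z r x))"
      by (intro Bochner_Integration.integrable_mult_right bump_mean_eq(1)[OF cy' r])
    fix x
    show "\<bar>h x * ((par z r x)\<^sup>2 / 4)\<bar> \<le> K * r\<^sup>2 / 4 * (y x * par z r x)"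
    proof (cases "x \<in> cball z r")
      case True
      have p: "0 \<le> par z r x" "par z r x \<le> r\<^sup>2" by (rule par_nonneg par_le)+
      have "\<bar>h x * ((par z r x)\<^sup>2 / 4)\<bar> = \<bar>h x\<bar> * (par z r x * par z r x / 4)"
        by (simp add: abs_mult power2_eq_square)
      also have "\<dots> \<le> (K * y x) * (par z r x * r\<^sup>2 / 4)"
        using h[OF True] p by (intro mult_mono divide_right_mono mult_left_mono) auto
      finally show ?thesis by (simp add: mult_ac)
    next
      case False
      then show ?thesis using par_eq_0[OF _ False] r by simp
    qed
  qed
  also have "\<dots> = K * r\<^sup>2 / 4 * (r ^ (?d + 2) * bump_mean y z r)"
    unfolding bump_mean_eq(2)[OF cy' r] using r by simp
  finally have "\<bar>r ^ 3 * (\<integral>\<eta>. (\<eta> \<bullet> dy (z + r *\<^sub>R \<eta>)) * bump \<eta> \<partial>lborel)\<bar> \<le> K * r\<^sup>2 / 4 * (r ^ (?d + 2) * bump_mean y z r) / r ^ ?d"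
  proof -
    assume le: "\<bar>\<integral>x. h x * ((par z r x)\<^sup>2 / 4) \<partial>lborel\<bar> \<le> K * r\<^sup>2 / 4 * (r ^ (?d + 2) * bump_mean y z r)"
    have "\<bar>r ^ 3 * (\<integral>\<eta>. (\<eta> \<bullet> dy (z + r *\<^sub>R \<eta>)) * bump \<eta> \<partial>lborel)\<bar> = \<bar>\<integral>x. h x * ((par z r x)\<^sup>2 / 4) \<partial>lborel\<bar> / r ^ ?d"
      unfolding eq abs_divide using r by simp
    then show ?thesis using divide_right_mono[OF le, of "r ^ ?d"] r by (simp only: zero_le_power less_imp_le)
  qed
  also have "\<dots> = r ^ 3 * (K * r / 4 * bump_mean y z r)"
    using r by (simp add: power_add power3_eq_cube power2_eq_square field_simps)
  finally show ?thesis using r by (simp add: abs_mult)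
qed

text \<open>A Gronwall argument: |M'| \<le> (K r / 4) M makes exp(K r^2 / 8) M increasing and exp(-
  K r^2 / 8) M decreasing.\<close>

lemma mean_value_bounds:
  fixes y :: "'a::euclidean_space \<Rightarrow> real"
  assumes w: "weak_lap S y dy h" and S: "cball z (R * real DIM('a)) \<subseteq> S" and R: "0 < R"
    and h: "\<And>x. x \<in> cball z R \<Longrightarrow> \<bar>h x\<bar> \<le> K * y x"
  shows "bump_mean y z 0 \<le> exp (K * R\<^sup>2 / 8) * bump_mean y z R"
    "bump_mean y z R \<le> exp (K * R\<^sup>2 / 8) * bump_mean y z 0"
proof -
  let ?M = "bump_mean y z"
  define M' where "M' r = (\<integral>\<eta>. (\<eta> \<bullet> dy (z + r *\<^sub>R \<eta>)) * bump \<eta> \<partial>lborel)" for r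
  have d: "(?M has_real_derivative M' r) (at r within {0..R})" if "r \<in> {0..R}" for r
    unfolding M'_def using bump_mean_derivative[OF w S] that by auto
  have b: "\<bar>M' r\<bar> \<le> K * r / 4 * ?M r" if "r \<in> {0<..R}" for r
  proof -
    have "cball z r \<subseteq> S"
    proof -
      have "r * 1 \<le> R * real DIM('a)" using that DIM_positive[where 'a='a] by (intro mult_mono) (auto simp: Suc_le_eq)
      then show ?thesis using S subset_cball[of r "R * real DIM('a)" z] by auto
    qed
    then show ?thesis unfolding M'_def
      by (rule bump_mean_derivative_bound[OF w]) (use that h in auto)
  qed
  \<comment> \<open>The sign \<epsilon> treats both monotonicity statements at once.\<close>
  have mono: "exp (\<epsilon> * (K * 0\<^sup>2 / 8)) * (\<epsilon> * ?M 0) \<le> exp (\<epsilon> * (K * R\<^sup>2 / 8)) * (\<epsilon> * ?M R)" if \<epsilon>: "\<epsilon> = 1 \<or> \<epsilon> = -1" for \<epsilon> :: real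
  proof (rule DERIV_nonneg_imp_increasing_open[of 0 R "\<lambda>r. exp (\<epsilon> * (K * r\<^sup>2 / 8)) * (\<epsilon> * ?M r)"])
    show "0 \<le> R" using R by simp
    have "continuous_on {0..R} ?M" using d by (rule DERIV_continuous_on)
    then show "continuous_on {0..R} (\<lambda>r. exp (\<epsilon> * (K * r\<^sup>2 / 8)) * (\<epsilon> * ?M r))"
      by (intro continuous_intros) auto
    fix r assume r: "0 < r" "r < R"
    have "at r within {0..R} = at r" using r by (intro at_within_interior) auto
    then have dM: "(?M has_real_derivative M' r) (at r)" using d[of r] r by auto
    have "((\<lambda>r. exp (\<epsilon> * (K * r\<^sup>2 / 8)) * (\<epsilon> * ?M r)) has_real_derivative
        exp (\<epsilon> * (K * r\<^sup>2 / 8)) * (\<epsilon> * M' r + (\<epsilon> * \<epsilon>) * (K * r / 4 * ?M r))) (at r)"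
    proof -
      have "((\<lambda>r. exp (\<epsilon> * (K * r\<^sup>2 / 8))) has_real_derivative exp (\<epsilon> * (K * r\<^sup>2 / 8)) * (\<epsilon> * (K * r / 4))) (at r)"
        by (auto intro!: derivative_eq_intros)
      from DERIV_mult[OF this DERIV_cmult[OF dM, of \<epsilon>]] show ?thesis
        by (rule DERIV_cong) (simp add: algebra_simps)
    qed
    moreover have "0 \<le> \<epsilon> * M' r + (\<epsilon> * \<epsilon>) * (K * r / 4 * ?M r)"
      using b[of r] r \<epsilon> by (auto simp: abs_le_iff)
    ultimately show "\<exists>d. ((\<lambda>r. exp (\<epsilon> * (K * r\<^sup>2 / 8)) * (\<epsilon> * ?M r)) has_real_derivative d) (at r) \<and> 0 \<le> d"
      by (meson exp_ge_zero mult_nonneg_nonneg)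
  qed
  show "?M 0 \<le> exp (K * R\<^sup>2 / 8) * ?M R" using mono[of 1] by simp
  have "exp (- (K * R\<^sup>2 / 8)) * ?M R \<le> ?M 0" using mono[of "-1"] by simp
  then have "exp (K * R\<^sup>2 / 8) * (exp (- (K * R\<^sup>2 / 8)) * ?M R) \<le> exp (K * R\<^sup>2 / 8) * ?M 0" by simp
  then show "?M R \<le> exp (K * R\<^sup>2 / 8) * ?M 0" by (simp add: mult.assoc[symmetric] exp_minus)
qed

text \<open>The value at x is controlled by the average over the ball of radius r about x, this one
  by the average over the ball of radius 3r about x0, and the latter by the value at x0. Averages
  are normalised by r^(N+2), whence the factor 3^(N+2). On the scale of |x0| the potential K / |x|^2
  is bounded by a constant.\<close>

lemma harnack_local:
  fixes y :: "'a::euclidean_space \<Rightarrow> real"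
  assumes w: "weak_lap (- {0}) y dy h" and K: "0 \<le> K"
    and y: "\<And>x. x \<noteq> 0 \<Longrightarrow> 0 \<le> y x" and h: "\<And>x. x \<noteq> 0 \<Longrightarrow> \<bar>h x\<bar> \<le> K / (norm x)\<^sup>2 * y x"
    and x: "x0 \<noteq> 0" "norm (x - x0) \<le> norm x0 / (6 * real DIM('a))"
  shows "y x \<le> 3 ^ (DIM('a) + 2) * exp K * y x0"
proof -
  define N where "N = real DIM('a)"
  have N: "1 \<le> N" using DIM_positive[where 'a='a] by (simp add: N_def Suc_le_eq)
  \<comment> \<open>The factor N compensates the enlarged ball in \<open>mean_value_bounds\<close>:
    now 3 r N = |x0| / 2, and all balls stay at distance at least |x0| / 2 from the origin.\<close>
  define r where "r = norm x0 / (6 * N)"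
  have r: "0 < r" "r * N = norm x0 / 6" using x N by (auto simp: r_def)
  have rx: "r \<le> norm x0 / 6" using r(2) mult_left_mono[OF N, of r] r(1) by linarith
  have xr: "norm (x - x0) \<le> r" using x(2) by (simp add: r_def N_def)
  \<comment> \<open>Bound for K / |z|^2 when |z| \<ge> |x0| / 2.\<close>
  define Kc where "Kc = 4 * K / (norm x0)\<^sup>2"
  have far: "norm x0 / 2 \<le> norm z" if "norm (z - x0) \<le> norm x0 / 2" for z
    using norm_triangle_ineq2[of x0 "x0 - z"] that by (simp add: norm_minus_commute)
  have hK: "\<bar>h z\<bar> \<le> Kc * y z" if "norm (z - x0) \<le> norm x0 / 2" for z
  proof -
    have z: "norm x0 / 2 \<le> norm z" by (rule far[OF that])
    then have z0: "z \<noteq> 0" using x(1) by auto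
    have "(norm x0 / 2)\<^sup>2 \<le> (norm z)\<^sup>2" using z by (intro power_mono) auto
    then have "K / (norm z)\<^sup>2 \<le> K / (norm x0 / 2)\<^sup>2"
      using x(1) K z0 by (intro divide_left_mono) auto
    also have "\<dots> = Kc" by (simp add: Kc_def power_divide)
    finally show ?thesis using h[OF z0] y[OF z0] mult_right_mono by fastforce
  qed
  have nz: "z \<noteq> 0" if "norm (z - x0) \<le> norm x0 / 2" for z using far[OF that] x(1) by auto
  have B0: "norm (z - x0) \<le> norm x0 / 2" if "z \<in> cball x0 (3 * r * N)" for z
    using that r(2) by (simp add: dist_norm norm_minus_commute)
  have B1: "norm (z - x0) \<le> norm x0 / 2" if "z \<in> cball x (r * N)" for z
  proof -
    have "norm (z - x) \<le> norm x0 / 6" using that r(2) by (simp add: dist_norm norm_minus_commute)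
    moreover have "norm (z - x0) \<le> norm (z - x) + norm (x - x0)" using norm_triangle_ineq[of "z - x" "x - x0"] by simp
    ultimately show ?thesis using xr rx norm_ge_zero[of x0] by linarith
  qed
  have sub: "cball x0 (3 * r * N) \<subseteq> - {0}" "cball x (r * N) \<subseteq> - {0}"
    using B0 B1 nz by blast+
  have in_c: "cball x0 (3 * r) \<subseteq> cball x0 (3 * r * N)" "cball x r \<subseteq> cball x (r * N)"
    using r N mult_left_mono[of 1 N r] by (auto intro!: subset_cball)
  have rr: "r\<^sup>2 \<le> (norm x0)\<^sup>2 / 36"
    using rx r(1) power_mono[of r "norm x0 / 6" 2] by (simp add: power_divide)
  have e1: "exp (Kc * r\<^sup>2 / 8) \<le> exp (K / 2)" "exp (Kc * (3 * r)\<^sup>2 / 8) \<le> exp (K / 2)"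
  proof -
    have "Kc * r\<^sup>2 \<le> Kc * ((norm x0)\<^sup>2 / 36)" using rr K by (intro mult_left_mono) (auto simp: Kc_def)
    also have "\<dots> = K / 9" using x(1) by (simp add: Kc_def)
    finally have "Kc * r\<^sup>2 \<le> K / 9" .
    then show "exp (Kc * r\<^sup>2 / 8) \<le> exp (K / 2)" "exp (Kc * (3 * r)\<^sup>2 / 8) \<le> exp (K / 2)"
      using K by (auto simp: power_mult_distrib)
  qed
  define c where "c = (\<integral>\<eta>. bump (\<eta>::'a) \<partial>lborel)"
  have c: "c > 0" unfolding c_def by (rule bump_integral_pos)
  have m1: "bump_mean y x 0 \<le> exp (Kc * r\<^sup>2 / 8) * bump_mean y x r"
    by (rule mean_value_bounds[OF w _ r(1)]) (use sub in_c hK[OF B1] in \<open>auto simp: N_def simp del: mem_cball\<close>)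
  have m2: "bump_mean y x0 (3 * r) \<le> exp (Kc * (3 * r)\<^sup>2 / 8) * bump_mean y x0 0"
    by (rule mean_value_bounds[OF w]) (use sub in_c hK[OF B0] r in \<open>auto simp: N_def simp del: mem_cball\<close>)
  have cy: "continuous_on (- {0}) y" by (rule weak_lap_continuous[OF w])
  have cy': "continuous_on (cball x r) y" "continuous_on (cball x0 (3 * r)) y"
    by (rule continuous_on_subset[OF cy]; use sub in_c in blast)+
  note I1 = bump_mean_eq[OF cy'(1) r(1)]
  have r3: "0 < 3 * r" using r by simp
  note I2 = bump_mean_eq[OF cy'(2) r3]
  have "(\<integral>z. y z * par x r z \<partial>lborel) \<le> (\<integral>z. y z * par x0 (3 * r) z \<partial>lborel)"
  proof (rule Bochner_Integration.integral_mono[OF I1(1) I2(1)])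
    fix z
    show "y z * par x r z \<le> y z * par x0 (3 * r) z"
    proof (cases "z \<in> cball x r")
      case True
      have zx: "norm (z - x) \<le> r" using True by (simp add: dist_norm norm_minus_commute)
      \<comment> \<open>At distance at most 2r from x0 the wide parabola is at least 9r^2 - 4r^2,
        hence above the maximum r^2 of the narrow one.\<close>
      have "norm (z - x0) \<le> 2 * r" using norm_triangle_ineq[of "z - x" "x - x0"] zx xr by simp
      then have "(norm (z - x0))\<^sup>2 \<le> (2 * r)\<^sup>2" by (intro power_mono) auto
      then have "r\<^sup>2 \<le> (3 * r)\<^sup>2 - (norm (z - x0))\<^sup>2"
      proof -
        assume "(norm (z - x0))\<^sup>2 \<le> (2 * r)\<^sup>2"
        moreover have "(2 * r)\<^sup>2 = 4 * r\<^sup>2" "(3 * r)\<^sup>2 = 9 * r\<^sup>2" by (simp_all add: power_mult_distrib)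
        ultimately show ?thesis using zero_le_power2[of r] by linarith
      qed
      then have "par x r z \<le> par x0 (3 * r) z" using par_le[of x r z] unfolding par_def[of x0] by linarith
      moreover have "z \<noteq> 0" using True in_c sub by blast
      ultimately show ?thesis using y[of z] by (intro mult_left_mono) auto
    next
      case False
      have "0 \<le> y z * par x0 (3 * r) z"
      proof (cases "z \<in> cball x0 (3 * r)")
        case True
        then have "z \<noteq> 0" using in_c sub by blast
        then show ?thesis using y par_nonneg[of x0 "3 * r" z] by simp
      next
        case False
        then show ?thesis using par_eq_0[OF _ False] r by simp
      qed
      then show ?thesis using par_eq_0[OF _ False] r by simp
    qed
  qed
  then have "bump_mean y x r \<le> (\<integral>z. y z * par x0 (3 * r) z \<partial>lborel) / r ^ (DIM('a) + 2)"
    unfolding I1(2) using r(1) by (intro divide_right_mono) auto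
  also have "\<dots> = 3 ^ (DIM('a) + 2) * bump_mean y x0 (3 * r)"
    unfolding I2(2) power_mult_distrib using r(1) by simp
  finally have m3: "bump_mean y x r \<le> 3 ^ (DIM('a) + 2) * bump_mean y x0 (3 * r)" .
  have y0: "0 \<le> bump_mean y x0 0" unfolding bump_mean_0 c_def[symmetric] using y[OF x(1)] c by simp
  have "bump_mean y x 0 \<le> exp (Kc * r\<^sup>2 / 8) * (3 ^ (DIM('a) + 2) * (exp (Kc * (3 * r)\<^sup>2 / 8) * bump_mean y x0 0))"
    by (rule order_trans[OF m1], rule mult_left_mono, rule order_trans[OF m3], rule mult_left_mono[OF m2]) auto
  also have "\<dots> \<le> exp (K / 2) * (3 ^ (DIM('a) + 2) * (exp (K / 2) * bump_mean y x0 0))"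
    using e1 y0 by (intro mult_mono mult_left_mono) auto
  also have "\<dots> = 3 ^ (DIM('a) + 2) * exp K * bump_mean y x0 0"
    using exp_add[of "K / 2" "K / 2"] by (simp add: mult_ac)
  finally show ?thesis unfolding bump_mean_0 c_def[symmetric] using c by simp
qed

text \<open>A chain of local inequalities along the segment from \<open>x2\<close> to
  \<open>x1\<close>. As the angle between the two is at most a right angle, the segment keeps
  distance at least \<rho> / 2 from the origin.\<close>

lemma harnack_segment:
  fixes y :: "'a::euclidean_space \<Rightarrow> real"
  assumes w: "weak_lap (- {0}) y dy h" and K: "0 \<le> K"
    and y: "\<And>x. x \<noteq> 0 \<Longrightarrow> 0 \<le> y x" and h: "\<And>x. x \<noteq> 0 \<Longrightarrow> \<bar>h x\<bar> \<le> K / (norm x)\<^sup>2 * y x"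
    and x: "norm x1 = \<rho>" "norm x2 = \<rho>" "0 < \<rho>" "0 \<le> x1 \<bullet> x2"
  shows "y x1 \<le> (3 ^ (DIM('a) + 2) * exp K) ^ (24 * DIM('a)) * y x2"
proof -
  define C where "C = 3 ^ (DIM('a) + 2) * exp K"
  \<comment> \<open>The segment has length at most 2\<rho>, and at distance \<rho> / 2 from the
    origin a step of length \<rho> / (12 N) is allowed.\<close>
  define n where "n = 24 * DIM('a)"
  have n: "n > 0" using DIM_positive[where 'a='a] by (simp add: n_def)
  have C: "0 < C" by (simp add: C_def)
  define p where "p j = x2 + (real j / real n) *\<^sub>R (x1 - x2)" for j
  have np: "\<rho> / 2 \<le> norm (p j)" if "j \<le> n" for j
  proof -
    define t where "t = real j / real n"
    have t: "0 \<le> t" "t \<le> 1" using that n by (auto simp: t_def)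
    have "p j = (1 - t) *\<^sub>R x2 + t *\<^sub>R x1" by (simp add: p_def t_def algebra_simps)
    have "(norm (p j))\<^sup>2 = (1 - t)\<^sup>2 * \<rho>\<^sup>2 + t\<^sup>2 * \<rho>\<^sup>2 + 2 * (t * (1 - t)) * (x1 \<bullet> x2)"
    proof -
      have xx: "x1 \<bullet> x1 = \<rho>\<^sup>2" "x2 \<bullet> x2 = \<rho>\<^sup>2" using x by (simp_all add: dot_square_norm)
      have "(a *\<^sub>R x2 + t *\<^sub>R x1) \<bullet> (a *\<^sub>R x2 + t *\<^sub>R x1) = a\<^sup>2 * \<rho>\<^sup>2 + t\<^sup>2 * \<rho>\<^sup>2 + 2 * (t * a) * (x1 \<bullet> x2)" for a
        by (simp add: inner_add_left inner_add_right inner_commute[of x2 x1] xx power2_eq_square[of a] power2_eq_square[of t]) algebra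
      then show ?thesis unfolding power2_norm_eq_inner \<open>p j = (1 - t) *\<^sub>R x2 + t *\<^sub>R x1\<close> by blast
    qed
    also have "\<dots> \<ge> (1 - t)\<^sup>2 * \<rho>\<^sup>2 + t\<^sup>2 * \<rho>\<^sup>2" using t x(4) by simp
    also have "(1 - t)\<^sup>2 * \<rho>\<^sup>2 + t\<^sup>2 * \<rho>\<^sup>2 \<ge> (1/4) * \<rho>\<^sup>2"
    proof -
      have "(1 - t)\<^sup>2 + t\<^sup>2 = 1/2 + 2 * (t - 1/2)\<^sup>2" by (simp add: power2_eq_square algebra_simps)
      then have "1/4 \<le> (1 - t)\<^sup>2 + t\<^sup>2" by (simp add: add_increasing2)
      then have "(1/4) * \<rho>\<^sup>2 \<le> ((1 - t)\<^sup>2 + t\<^sup>2) * \<rho>\<^sup>2" by (intro mult_right_mono) auto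
      then show ?thesis by (simp add: distrib_right)
    qed
    finally have "(\<rho> / 2)\<^sup>2 \<le> (norm (p j))\<^sup>2" by (simp add: power_divide)
    then show ?thesis by (rule power2_le_imp_le) simp
  qed
  have step: "y b \<le> C * y a" if "a \<noteq> 0" "norm (b - a) \<le> norm a / (6 * real DIM('a))" for a b
    unfolding C_def by (rule harnack_local[OF w K _ _ that]) (fact y h)+
  have "y (p j) \<le> C ^ j * y (p 0)" if "j \<le> n" for j
    using that
  proof (induction j)
    case (Suc j)
    have nz: "p j \<noteq> 0" using np[of j] Suc.prems x(3) by auto
    have "p (Suc j) - p j = (1 / real n) *\<^sub>R (x1 - x2)"
      by (simp add: p_def add_divide_distrib scaleR_left_distrib)
    then have "norm (p (Suc j) - p j) = norm (x1 - x2) / real n" by simp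
    also have "\<dots> \<le> (2 * \<rho>) / real n" using norm_triangle_ineq4[of x1 x2] x by (intro divide_right_mono) auto
    also have "\<dots> = (\<rho> / 2) / (6 * real DIM('a))" by (simp add: n_def)
    also have "\<dots> \<le> norm (p j) / (6 * real DIM('a))" using np[of j] Suc.prems by (intro divide_right_mono) auto
    finally have "y (p (Suc j)) \<le> C * y (p j)"
      by (rule step[OF nz])
    also have "\<dots> \<le> C * (C ^ j * y (p 0))" using Suc C by (intro mult_left_mono) auto
    finally show ?case by simp
  qed simp
  from this[of n] show ?thesis using n by (simp add: p_def C_def n_def)
qed

text \<open>For an obtuse angle the segment may come close to the origin. A detour over a vector
  orthogonal to \<open>x1\<close>, with its sign adapted to \<open>x2\<close>, yields two admissible
  segments; such a vector exists in dimension at least 2.\<close>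

lemma harnack_sphere:
  fixes y :: "'a::euclidean_space \<Rightarrow> real"
  assumes N: "2 \<le> DIM('a)" and w: "weak_lap (- {0}) y dy h" and K: "0 \<le> K"
    and y: "\<And>x. x \<noteq> 0 \<Longrightarrow> 0 \<le> y x" and h: "\<And>x. x \<noteq> 0 \<Longrightarrow> \<bar>h x\<bar> \<le> K / (norm x)\<^sup>2 * y x"
    and x: "norm x1 = norm x2" "x2 \<noteq> 0"
  shows "y x1 \<le> (3 ^ (DIM('a) + 2) * exp K) ^ (48 * DIM('a)) * y x2"
proof -
  define \<rho> where "\<rho> = norm x2"
  have \<rho>: "0 < \<rho>" "norm x1 = \<rho>" "norm x2 = \<rho>" using x by (auto simp: \<rho>_def)
  define C where "C = (3 ^ (DIM('a) + 2) * exp K) ^ (24 * DIM('a))"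
  have C: "0 < C" by (simp add: C_def)
  obtain e where e: "norm e = \<rho>" "0 \<le> x1 \<bullet> e" "0 \<le> e \<bullet> x2"
  proof -
    obtain f where f: "f \<noteq> 0" "orthogonal x1 f" using orthogonal_to_vector_exists[OF N] by blast
    define g where "g = (if 0 \<le> f \<bullet> x2 then f else - f)"
    have g: "g \<noteq> 0" "x1 \<bullet> g = 0" "0 \<le> g \<bullet> x2" using f by (auto simp: g_def orthogonal_def)
    show ?thesis
      by (rule that[of "(\<rho> / norm g) *\<^sub>R g"]) (use g \<rho>(1) in auto)
  qed
  have seg: "y a \<le> C * y b" if "norm a = \<rho>" "norm b = \<rho>" "0 \<le> a \<bullet> b" for a b
    unfolding C_def by (rule harnack_segment[OF w K _ _ that(1,2) \<rho>(1) that(3)]) (fact y h)+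
  have "y x1 \<le> C * y e" by (rule seg) (use \<rho> e in auto)
  also have "y e \<le> C * y x2" by (rule seg) (use \<rho> e in auto)
  finally have "y x1 \<le> C * (C * y x2)" using C by simp
  also have "\<dots> = (3 ^ (DIM('a) + 2) * exp K) ^ (48 * DIM('a)) * y x2"
    by (simp add: C_def mult.assoc[symmetric] flip: power_add)
  finally show ?thesis .
qed

section \<open>The wave\<close>

lemma powr_diff_le:
  fixes x y q :: real
  assumes "0 \<le> x" "x \<le> y" "1 < q"
  shows "y powr q - x powr q \<le> q * y powr (q - 1) * (y - x)"
proof (cases "x = y")
  case False
  then have xy: "x < y" using assms by simp
  have d: "((\<lambda>z. z powr q) has_real_derivative q * z powr (q - 1)) (at z)" if "x < z" for z
    using that assms(1) by (intro has_real_derivative_powr) simp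
  have "continuous_on {x..y} (\<lambda>z. z powr q)"
    using assms by (intro continuous_on_powr' continuous_intros) auto
  then obtain D \<xi> where D: "x < \<xi>" "\<xi> < y" "((\<lambda>z. z powr q) has_real_derivative D) (at \<xi>)"
      "y powr q - x powr q = (y - x) * D"
    using MVT[OF xy, of "\<lambda>z. z powr q"] d real_differentiable_def by metis
  then have \<xi>: "x < \<xi>" "\<xi> < y" "y powr q - x powr q = (y - x) * (q * \<xi> powr (q - 1))"
    using DERIV_unique[OF D(3) d[OF D(1)]] by auto
  have "\<xi> powr (q - 1) \<le> y powr (q - 1)" using \<xi> assms by (intro powr_mono2) auto
  then show ?thesis unfolding \<xi>(3) using xy assms by (simp add: mult.commute mult_left_mono)
qed simp

section \<open>Maximum principle on the line\<close>

lemma not_local_min: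
  fixes E :: "real \<Rightarrow> real"
  assumes "open S" "s \<in> S" "\<And>t. t \<in> S \<Longrightarrow> (E has_real_derivative E1 t) (at t)"
    "(E1 has_real_derivative E2) (at s)" "E2 < 0" "\<And>t. t \<in> S \<Longrightarrow> E s \<le> E t"
  shows False
proof -
  obtain r where r: "0 < r" "ball s r \<subseteq> S" using assms(1,2) openE by blast
  have E1s: "E1 s = 0"
  proof (rule DERIV_local_min[OF assms(3)[OF assms(2)] r(1)])
    show "\<forall>y. \<bar>s - y\<bar> < r \<longrightarrow> E s \<le> E y" using r(2) assms(6) by (auto simp: dist_real_def)
  qed
  obtain d where d: "0 < d" "\<And>h. 0 < h \<Longrightarrow> h < d \<Longrightarrow> E1 (s + h) < E1 s"
    using DERIV_neg_dec_right[OF assms(4,5)] by blast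
  define h where "h = min (r / 2) (d / 2)"
  have h: "0 < h" "h < r" "h < d" using r d by (auto simp: h_def)
  have inS: "t \<in> S" if "s \<le> t" "t \<le> s + h" for t using that h r(2) by (auto simp: dist_real_def)
  have "\<exists>z. s < z \<and> z < s + h \<and> E (s + h) - E s = (s + h - s) * E1 z"
    using h inS by (intro MVT2 assms(3)) auto
  then obtain z where z: "s < z" "z < s + h" "E (s + h) - E s = h * E1 z" by auto
  have "E1 z < 0" using d(2)[of "z - s"] z h E1s by simp
  then have "E (s + h) < E s" using z(3) h(1) mult_pos_neg[of h "E1 z"] by simp
  then show False using assms(6)[OF inS[of "s + h"]] h by simp
qed

text \<open>The infimum of D need not be attained, so a small multiple of two growing exponentials
  is added; at the resulting minimum the second derivative would be negative. The differential
  inequality is asked only where D < 0, with local derivatives, because the barriers are minima and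
  maxima of smooth functions and have corners.\<close>

lemma max_principle:
  fixes D :: "real \<Rightarrow> real"
  assumes K: "0 < K" and \<kappa>: "0 < \<kappa>" and bd: "\<And>t. - M \<le> D t" and c: "continuous_on UNIV D"
    and ineq: "\<And>t. D t < 0 \<Longrightarrow> \<exists>S D1 D2. open S \<and> t \<in> S \<and> (\<forall>s\<in>S. (D has_real_derivative D1 s) (at s)) \<and>
        (D1 has_real_derivative D2) (at t) \<and> D2 - 2 * \<kappa> * D1 t - K * D t \<le> 0"
  shows "0 \<le> D t0"
proof (rule ccontr)
  assume "\<not> 0 \<le> D t0"
  then have neg: "D t0 < 0" by simp
  \<comment> \<open>Then \<alpha>^2 + 2\<kappa>\<alpha> \<le> K, which makes both exponentials
    supersolutions of the linear operator.\<close>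
  define \<alpha> where "\<alpha> = min 1 (K / (1 + 2 * \<kappa>))"
  have \<alpha>: "0 < \<alpha>" "\<alpha>\<^sup>2 + 2 * \<kappa> * \<alpha> \<le> K"
  proof -
    show p: "0 < \<alpha>" using K \<kappa> by (simp add: \<alpha>_def)
    have "\<alpha> \<le> K / (1 + 2 * \<kappa>)" by (simp add: \<alpha>_def)
    then have "\<alpha> * (1 + 2 * \<kappa>) \<le> K" using \<kappa> by (simp add: pos_le_divide_eq)
    moreover have "\<alpha> \<le> 1" by (simp add: \<alpha>_def)
    then have "\<alpha>\<^sup>2 \<le> \<alpha>" using p by (simp add: power2_eq_square mult_left_le)
    ultimately show "\<alpha>\<^sup>2 + 2 * \<kappa> * \<alpha> \<le> K" by (simp add: algebra_simps)
  qed
  define A where "A s = exp (\<alpha> * (s - t0))" for s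
  define B where "B s = exp (- \<alpha> * (s - t0))" for s
  have dAB: "(A has_real_derivative \<alpha> * A s) (at s)" "(B has_real_derivative - \<alpha> * B s) (at s)" for s
    unfolding A_def B_def by (auto intro!: derivative_eq_intros)
  have AB: "0 < A s" "0 < B s" for s by (auto simp: A_def B_def)
  \<comment> \<open>With this choice E t0 = D t0 / 2, still negative.\<close>
  define \<epsilon> where "\<epsilon> = - D t0 / 4"
  have eps: "0 < \<epsilon>" using neg by (simp add: \<epsilon>_def)
  define E where "E s = D s + \<epsilon> * (A s + B s)" for s
  have E0: "E t0 < 0" using neg by (simp add: E_def \<epsilon>_def A_def B_def)
  \<comment> \<open>Beyond this distance from t0 the added term exceeds |M|, so a negative minimum
    of E lies inside.\<close>
  define R where "R = \<bar>M\<bar> / (\<epsilon> * \<alpha>) + 1"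
  have R: "0 < R" using eps \<alpha> by (simp add: R_def add_nonneg_pos)
  have far: "0 < E s" if "R \<le> \<bar>s - t0\<bar>" for s
  proof -
    have "\<alpha> * \<bar>s - t0\<bar> \<le> A s + B s"
    proof -
      have "1 + \<alpha> * (s - t0) \<le> A s" "1 + - \<alpha> * (s - t0) \<le> B s"
        unfolding A_def B_def by (rule exp_ge_add_one_self)+
      then show ?thesis using AB[of s] by (cases "s \<ge> t0") (simp_all add: algebra_simps)
    qed
    moreover have "\<alpha> * R \<le> \<alpha> * \<bar>s - t0\<bar>" using that \<alpha> by (intro mult_left_mono) auto
    ultimately have "\<epsilon> * (\<alpha> * R) \<le> \<epsilon> * (A s + B s)" using eps by (intro mult_left_mono) auto
    moreover have "\<bar>M\<bar> < \<epsilon> * (\<alpha> * R)" using eps \<alpha> by (simp add: R_def field_simps)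
    ultimately show ?thesis using bd[of s] by (simp add: E_def)
  qed
  have cE: "continuous_on {t0 - R..t0 + R} E"
    unfolding E_def A_def B_def by (intro continuous_intros continuous_on_subset[OF c]) auto
  obtain s where s: "s \<in> {t0 - R..t0 + R}" "\<And>t. t \<in> {t0 - R..t0 + R} \<Longrightarrow> E s \<le> E t"
  proof -
    have "{t0 - R..t0 + R} \<noteq> {}" using R by auto
    from continuous_attains_inf[OF compact_Icc this cE] show ?thesis using that by blast
  qed
  have Es: "E s < 0" using s(2)[of t0] E0 R by simp
  then have sR: "\<bar>s - t0\<bar> < R" using far[of s] by force
  have min: "E s \<le> E t" for t
    using s(2)[of t] far[of t] Es by (cases "\<bar>t - t0\<bar> \<le> R") (auto simp: abs_le_iff)
  have "D s < 0" using Es mult_pos_pos[OF eps, of "A s + B s"] AB[of s] by (simp add: E_def)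
  from ineq[OF this] obtain S D1 D2 where S: "open S" "s \<in> S" "\<And>t. t \<in> S \<Longrightarrow> (D has_real_derivative D1 t) (at t)"
    "(D1 has_real_derivative D2) (at s)" "D2 - 2 * \<kappa> * D1 s - K * D s \<le> 0" by blast
  define E1 where "E1 t = D1 t + \<epsilon> * (\<alpha> * A t - \<alpha> * B t)" for t
  define E2 where "E2 = D2 + \<epsilon> * (\<alpha>\<^sup>2 * A s + \<alpha>\<^sup>2 * B s)"
  have d1: "(E has_real_derivative E1 t) (at t)" if "t \<in> S" for t
    unfolding E_def E1_def by (rule derivative_eq_intros S(3)[OF that] dAB refl)+ simp
  have d2: "(E1 has_real_derivative E2) (at s)"
    unfolding E1_def E2_def by (rule derivative_eq_intros S(4) dAB refl)+ (simp add: power2_eq_square algebra_simps)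
  have "E1 s = 0"
    by (rule DERIV_local_min[OF d1[OF S(2)] zero_less_one]) (use min in auto)
  have "E2 - 2 * \<kappa> * E1 s - K * E s = (D2 - 2 * \<kappa> * D1 s - K * D s)
      + \<epsilon> * ((\<alpha>\<^sup>2 - 2 * \<kappa> * \<alpha> - K) * A s + (\<alpha>\<^sup>2 + 2 * \<kappa> * \<alpha> - K) * B s)"
    by (simp add: E1_def E2_def E_def algebra_simps)
  moreover have "\<epsilon> * ((\<alpha>\<^sup>2 - 2 * \<kappa> * \<alpha> - K) * A s + (\<alpha>\<^sup>2 + 2 * \<kappa> * \<alpha> - K) * B s) \<le> 0"
  proof -
    have "0 < 2 * \<kappa> * \<alpha>" using \<alpha> \<kappa> by simp
    then have "\<alpha>\<^sup>2 - 2 * \<kappa> * \<alpha> - K \<le> 0" "\<alpha>\<^sup>2 + 2 * \<kappa> * \<alpha> - K \<le> 0" using \<alpha>(2) by linarith+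
    then have "(\<alpha>\<^sup>2 - 2 * \<kappa> * \<alpha> - K) * A s \<le> 0" "(\<alpha>\<^sup>2 + 2 * \<kappa> * \<alpha> - K) * B s \<le> 0"
      using AB[of s] by (simp_all add: mult_nonpos_nonneg)
    then show ?thesis using eps by (simp add: mult_nonneg_nonpos)
  qed
  ultimately have "E2 \<le> K * E s" using S(5) \<open>E1 s = 0\<close> by simp
  then have "E2 < 0" using Es K mult_pos_neg[of K "E s"] by linarith
  from not_local_min[OF S(1,2) d1 d2 this min] show False .
qed

text \<open>An exponential average over the past: the bounded solution L of L' + a L = f for bounded
  continuous f.\<close>

definition lag :: "real \<Rightarrow> (real \<Rightarrow> real) \<Rightarrow> real \<Rightarrow> real" where
  "lag a f t = (\<integral>\<tau>. indicator {0<..} \<tau> * exp (- a * \<tau>) * f (t - \<tau>) \<partial>lborel)"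

lemma kernel_integral:
  assumes "0 < a"
  shows "integrable lborel (\<lambda>\<tau>::real. indicator {0<..} \<tau> * exp (- a * \<tau>))"
    "(\<integral>\<tau>. indicator {0<..} \<tau> * exp (- a * \<tau>) \<partial>lborel) = 1 / a"
proof -
  have h: "((\<lambda>\<tau>. exp (- a * \<tau>)) has_integral 1 / a) {0..}"
    using has_integral_exp_minus_to_infinity[OF assms, of 0] by simp
  have h': "((\<lambda>\<tau>. indicator {0<..} \<tau> * exp (- a * \<tau>)) has_integral 1 / a) UNIV"
  proof -
    have "((\<lambda>\<tau>. if \<tau> \<in> {0..} then exp (- a * \<tau>) else 0) has_integral 1 / a) UNIV"
      using h by (simp only: has_integral_restrict_UNIV)
    then show ?thesis
      by (rule has_integral_spike[OF negligible_sing[of 0], rotated]) (auto simp: indicator_def)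
  qed
  have "has_bochner_integral lborel (\<lambda>\<tau>. indicator {0<..} \<tau> * exp (- a * \<tau>)) (1 / a)"
    by (rule has_bochner_integral_nn_integral[OF _ _ _ nn_integral_has_integral_lborel[OF _ _ h']])
       (use assms in auto)
  then show "integrable lborel (\<lambda>\<tau>::real. indicator {0<..} \<tau> * exp (- a * \<tau>))"
    "(\<integral>\<tau>. indicator {0<..} \<tau> * exp (- a * \<tau>) \<partial>lborel) = 1 / a"
    by (auto simp: has_bochner_integral_iff)
qed

lemma lag_integrable:
  fixes a C :: real and f :: "real \<Rightarrow> real"
  assumes "0 < a" "f \<in> borel_measurable borel" "\<And>t. \<bar>f t\<bar> \<le> C"
  shows "integrable lborel (\<lambda>\<tau>. indicator {0<..} \<tau> * exp (- a * \<tau>) * f (t - \<tau>))"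
proof (rule Bochner_Integration.integrable_bound)
  show "integrable lborel (\<lambda>\<tau>. C * (indicator {0<..} \<tau> * exp (- a * \<tau>)))"
    by (rule Bochner_Integration.integrable_mult_right) (rule kernel_integral(1)[OF assms(1)])
  show "(\<lambda>\<tau>. indicator {0<..} \<tau> * exp (- a * \<tau>) * f (t - \<tau>)) \<in> borel_measurable lborel"
    using assms(2) by measurable
  show "AE \<tau> in lborel. norm (indicator {0<..} \<tau> * exp (- a * \<tau>) * f (t - \<tau>)) \<le> norm (C * (indicator {0<..} \<tau> * exp (- a * \<tau>)))"
    using assms(3) order_trans[OF abs_ge_zero assms(3)]
    by (auto simp: indicator_def abs_mult mult.commute[of C])
qed

lemma lag_mono:
  assumes "0 < a" "f \<in> borel_measurable borel" "\<And>t. \<bar>f t\<bar> \<le> C" "g \<in> borel_measurable borel" "\<And>t. \<bar>g t\<bar> \<le> C"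
    "\<And>t. f t \<le> g t"
  shows "lag a f t \<le> lag a g t"
  unfolding lag_def
  by (intro Bochner_Integration.integral_mono lag_integrable[OF assms(1-3)] lag_integrable[OF assms(1,4,5)])
     (auto simp: indicator_def assms(6))

lemma lag_const: "0 < a \<Longrightarrow> lag a (\<lambda>_. c) t = c / a"
  unfolding lag_def using kernel_integral(2)[of a] by simp

lemma lag_bound:
  assumes "0 < a" "f \<in> borel_measurable borel" "\<And>t. \<bar>f t\<bar> \<le> C"
  shows "\<bar>lag a f t\<bar> \<le> C / a"
proof -
  have C: "0 \<le> C" using assms(3)[of 0] by simp
  have "lag a f t \<le> lag a (\<lambda>_. C) t"
    by (rule lag_mono[where C = C]) (use assms C in \<open>auto simp: abs_le_iff\<close>)
  moreover have "lag a (\<lambda>_. - C) t \<le> lag a f t"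
  proof (rule lag_mono[where C = C])
    show "- C \<le> f t" for t using assms(3)[of t] by linarith
  qed (use assms C in auto)
  ultimately show ?thesis using lag_const[OF assms(1)] by (simp add: abs_le_iff)
qed

text \<open>Multiplied by exp(a t), the average becomes the integral of exp(a s) f(s) over s < t, to
  which the fundamental theorem of calculus applies.\<close>

lemma lag_derivative:
  assumes a: "0 < a" and c: "continuous_on UNIV f" and b: "\<And>t. \<bar>f t\<bar> \<le> C"
  shows "(lag a f has_real_derivative f t - a * lag a f t) (at t)"
proof -
  have m: "f \<in> borel_measurable borel" by (rule borel_measurable_continuous_onI[OF c])
  define G where "G t = exp (a * t) * lag a f t" for t
  have L: "G t = (\<integral>s. indicator {..<t} s * (exp (a * s) * f s) \<partial>lborel)"
      and Li: "integrable lborel (\<lambda>s. indicator {..<t} s * (exp (a * s) * f s))" for t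
  proof -
    have eq: "exp (a * t) * (indicator {0<..} (t + -1 * s) * exp (- a * (t + -1 * s)) * f (t - (t + -1 * s))) = indicator {..<t} s * (exp (a * s) * f s)" for s
    proof -
      have "exp (a * t) * exp (- a * (t + -1 * s)) = exp (a * s)" by (simp add: exp_add[symmetric] algebra_simps)
      then show ?thesis by (simp add: indicator_def)
    qed
    have neg1: "(-1::real) \<noteq> 0" by simp
    have i: "integrable lborel (\<lambda>\<tau>. exp (a * t) * (indicator {0<..} \<tau> * exp (- a * \<tau>) * f (t - \<tau>)))"
      by (intro Bochner_Integration.integrable_mult_right lag_integrable[OF a m b])
    show "G t = (\<integral>s. indicator {..<t} s * (exp (a * s) * f s) \<partial>lborel)"
      unfolding G_def lag_def Bochner_Integration.integral_mult_right_zero[symmetric]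
      by (subst lborel_integral_real_affine[where c = "-1" and t = t, OF neg1]) (simp only: eq, simp)
    show "integrable lborel (\<lambda>s. indicator {..<t} s * (exp (a * s) * f s))"
      using lborel_integrable_real_affine[OF i neg1, of t] by (simp only: eq)
  qed
  have G: "G x = G t0 + integral {t0..x} (\<lambda>s. exp (a * s) * f s)" if "t0 \<le> x" for x t0
  proof -
    have i: "integrable lborel (\<lambda>s. indicator {t0..x} s *\<^sub>R (exp (a * s) * f s))"
      by (intro borel_integrable_compact compact_Icc continuous_intros continuous_on_subset[OF c]) auto
    have "G x - G t0 = (\<integral>s. indicator {..<x} s * (exp (a * s) * f s) - indicator {..<t0} s * (exp (a * s) * f s) \<partial>lborel)"
      unfolding L by (rule Bochner_Integration.integral_diff[symmetric, OF Li Li])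
    also have "\<dots> = (\<integral>s. indicator {t0..x} s *\<^sub>R (exp (a * s) * f s) \<partial>lborel)"
    proof (rule integral_cong_AE)
      show "AE s in lborel. indicator {..<x} s * (exp (a * s) * f s) - indicator {..<t0} s * (exp (a * s) * f s) = indicator {t0..x} s *\<^sub>R (exp (a * s) * f s)"
        by (rule eventually_mono[OF AE_lborel_singleton[of x]]) (use that in \<open>auto simp: indicator_def\<close>)
    qed (use Li i in auto)
    also have "\<dots> = integral {t0..x} (\<lambda>s. exp (a * s) * f s)"
      using set_borel_integral_eq_integral(2)[of "{t0..x}" "\<lambda>s. exp (a * s) * f s"] i
      by (simp add: set_integrable_def set_lebesgue_integral_def)
    finally show ?thesis by simp
  qed
  have "(G has_real_derivative exp (a * t) * f t) (at t)"
  proof -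
    have "((\<lambda>x. G (t - 1) + integral {t - 1..x} (\<lambda>s. exp (a * s) * f s)) has_real_derivative exp (a * t) * f t) (at t within {t - 1..t + 1})"
      by (rule DERIV_cong[OF DERIV_add[OF DERIV_const integral_has_real_derivative]])
         (auto intro!: continuous_intros continuous_on_subset[OF c])
    then have "(G has_real_derivative exp (a * t) * f t) (at t within {t - 1..t + 1})"
    proof (rule has_field_derivative_transform_within[where d = 1])
      show "G (t - 1) + integral {t - 1..x} (\<lambda>s. exp (a * s) * f s) = G x" if "x \<in> {t - 1..t + 1}" for x
        by (rule G[symmetric]) (use that in simp)
    qed auto
    moreover have "at t within {t - 1..t + 1} = at t" by (rule at_within_interior) auto
    ultimately show ?thesis by simp
  qed
  then have "((\<lambda>t. exp (- a * t) * G t) has_real_derivative (- a * exp (- a * t)) * G t + (exp (a * t) * f t) * exp (- a * t)) (at t)"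
    by (intro DERIV_mult) (auto intro!: derivative_eq_intros)
  moreover have "(\<lambda>t. exp (- a * t) * G t) = lag a f"
    by (simp add: G_def fun_eq_iff mult.assoc[symmetric] exp_add[symmetric])
  moreover have "(- a * exp (- a * t)) * G t + (exp (a * t) * f t) * exp (- a * t) = f t - a * lag a f t"
  proof -
    have e: "exp (a * t) * exp (- a * t) = 1" by (simp add: exp_add[symmetric])
    have "(- a * exp (- a * t)) * G t + (exp (a * t) * f t) * exp (- a * t)
      = (exp (a * t) * exp (- a * t)) * (f t - a * lag a f t)" unfolding G_def by algebra
    then show ?thesis using e by simp
  qed
  ultimately show ?thesis by simp
qed

lemma lag_tendsto:
  assumes a: "0 < a" and m: "\<And>n. f n \<in> borel_measurable borel" "g \<in> borel_measurable borel"
    and b: "\<And>n t. \<bar>f n t\<bar> \<le> C" and lim: "\<And>t. (\<lambda>n. f n t) \<longlonglongrightarrow> g t"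
  shows "(\<lambda>n. lag a (f n) t) \<longlonglongrightarrow> lag a g t"
  unfolding lag_def
proof (rule integral_dominated_convergence[where w = "\<lambda>\<tau>. C * (indicator {0<..} \<tau> * exp (- a * \<tau>))"])
  show "integrable lborel (\<lambda>\<tau>. C * (indicator {0<..} \<tau> * exp (- a * \<tau>)))"
    by (rule Bochner_Integration.integrable_mult_right) (rule kernel_integral(1)[OF a])
  show "(\<lambda>\<tau>. indicator {0<..} \<tau> * exp (- a * \<tau>) * g (t - \<tau>)) \<in> borel_measurable lborel"
    "(\<lambda>\<tau>. indicator {0<..} \<tau> * exp (- a * \<tau>) * f n (t - \<tau>)) \<in> borel_measurable lborel" for n
    using m by measurable
  show "AE \<tau> in lborel. (\<lambda>n. indicator {0<..} \<tau> * exp (- a * \<tau>) * f n (t - \<tau>)) \<longlonglongrightarrow> indicator {0<..} \<tau> * exp (- a * \<tau>) * g (t - \<tau>)"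
    by (intro AE_I2 tendsto_intros lim)
  show "AE \<tau> in lborel. norm (indicator {0<..} \<tau> * exp (- a * \<tau>) * f n (t - \<tau>)) \<le> C * (indicator {0<..} \<tau> * exp (- a * \<tau>))" for n
    using b by (intro AE_I2) (auto simp: indicator_def abs_mult mult.commute[of C])
qed

section \<open>Monotone iteration for the wave equation w'' - 2\<kappa>w' + l w = w^q\<close>

locale wave =
  fixes \<kappa> l q :: real
  assumes kap: "0 < \<kappa>" and l: "0 < l" "l \<le> \<kappa>\<^sup>2" and q: "1 < q"
begin

definition w0 where "w0 = l powr (1 / (q - 1))"
text \<open>Moving K w to the other side makes the nonlinearity \<open>F\<close> increasing on
  [0, w0]: its slope there is at least K + l - q l = l.\<close>

definition K where "K = q * l"
definition F where "F z = (K + l) * z - z powr q"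
text \<open>The roots of s^2 - 2\<kappa>s - K are -\<mu> and \<nu>; they are the rates of decay of
  the Green function on its two sides.\<close>

definition \<mu> where "\<mu> = sqrt (\<kappa>\<^sup>2 + K) - \<kappa>"
definition \<nu> where "\<nu> = sqrt (\<kappa>\<^sup>2 + K) + \<kappa>"

lemma w0_pos: "0 < w0" using l by (simp add: w0_def)

lemma w0_powr: "w0 powr (q - 1) = l" "w0 powr q = l * w0"
proof -
  show "w0 powr (q - 1) = l" using q l by (simp add: w0_def powr_powr)
  then show "w0 powr q = l * w0" using powr_add[of w0 "q - 1" 1] w0_pos by simp
qed

lemma K_pos: "0 < K" using q l by (simp add: K_def)

lemma roots: "0 < \<mu>" "0 < \<nu>" "\<mu> * \<nu> = K" "\<nu> - \<mu> = 2 * \<kappa>"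
proof -
  have "\<kappa> < sqrt (\<kappa>\<^sup>2 + K)" using kap K_pos by (intro real_less_rsqrt) auto
  then show "0 < \<mu>" "0 < \<nu>" using kap by (auto simp: \<mu>_def \<nu>_def)
  have "(sqrt (\<kappa>\<^sup>2 + K))\<^sup>2 = \<kappa>\<^sup>2 + K" using K_pos by simp
  then show "\<mu> * \<nu> = K" by (simp add: \<mu>_def \<nu>_def algebra_simps power2_eq_square)
  show "\<nu> - \<mu> = 2 * \<kappa>" by (simp add: \<mu>_def \<nu>_def)
qed

lemma F_mono: "0 \<le> x \<Longrightarrow> x \<le> y \<Longrightarrow> y \<le> w0 \<Longrightarrow> F x \<le> F y"
proof -
  assume x: "0 \<le> x" "x \<le> y" "y \<le> w0"
  have "y powr q - x powr q \<le> q * y powr (q - 1) * (y - x)" by (rule powr_diff_le[OF x(1,2) q])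
  also have "\<dots> \<le> q * l * (y - x)"
    using x q w0_powr(1) powr_mono2[of "q - 1" y w0] by (intro mult_right_mono mult_left_mono) auto
  also have "\<dots> \<le> (K + l) * (y - x)" using x l by (intro mult_right_mono) (auto simp: K_def)
  finally show ?thesis by (simp add: F_def algebra_simps)
qed

lemma F_0: "F 0 = 0" by (simp add: F_def)

lemma F_w0: "F w0 = K * w0" by (simp add: F_def w0_powr algebra_simps)

lemma F_bounds: "0 \<le> x \<Longrightarrow> x \<le> w0 \<Longrightarrow> 0 \<le> F x \<and> F x \<le> K * w0"
  using F_mono[of 0 x] F_mono[of x w0] F_0 F_w0 by auto

lemma F_continuous: "continuous_on A g \<Longrightarrow> (\<And>t. 0 \<le> g t) \<Longrightarrow> continuous_on A (\<lambda>t. F (g t))"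
  unfolding F_def using q by (intro continuous_intros continuous_on_powr') auto

text \<open>\<open>T f\<close> is the bounded solution \<open>u\<close> of \<open>u'' - 2 \<kappa> u' - K u = - f\<close>.\<close>

definition T :: "(real \<Rightarrow> real) \<Rightarrow> real \<Rightarrow> real" where
  "T f t = (lag \<mu> f t + lag \<nu> (\<lambda>s. f (- s)) (- t)) / (\<mu> + \<nu>)"

definition T' :: "(real \<Rightarrow> real) \<Rightarrow> real \<Rightarrow> real" where
  "T' f t = (\<nu> * lag \<nu> (\<lambda>s. f (- s)) (- t) - \<mu> * lag \<mu> f t) / (\<mu> + \<nu>)"

lemma T_derivative:
  assumes c: "continuous_on UNIV f" and b: "\<And>t. \<bar>f t\<bar> \<le> C"
  shows "(T f has_real_derivative T' f t) (at t)"
    "(T' f has_real_derivative (2 * \<kappa> * T' f t + K * T f t - f t)) (at t)"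
proof -
  have c': "continuous_on UNIV (\<lambda>s. f (- s))"
    by (rule continuous_on_compose2[OF c]) (auto intro!: continuous_intros)
  have d1: "(lag \<mu> f has_real_derivative f t - \<mu> * lag \<mu> f t) (at t)"
    by (rule lag_derivative[OF roots(1) c b])
  have "(lag \<nu> (\<lambda>s. f (- s)) has_real_derivative f (- (- t)) - \<nu> * lag \<nu> (\<lambda>s. f (- s)) (- t)) (at (- t))"
    by (rule lag_derivative[OF roots(2) c' b])
  then have d2: "((\<lambda>t. lag \<nu> (\<lambda>s. f (- s)) (- t)) has_real_derivative - (f t - \<nu> * lag \<nu> (\<lambda>s. f (- s)) (- t))) (at t)"
    using DERIV_chain'[OF DERIV_minus[OF DERIV_ident, of t UNIV], of "lag \<nu> (\<lambda>s. f (- s))"] by fastforce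
  have p: "\<mu> + \<nu> \<noteq> 0" using roots by simp
  show "(T f has_real_derivative T' f t) (at t)"
    unfolding T_def[abs_def] T'_def
    by (rule DERIV_cong[OF DERIV_cdivide[OF DERIV_add[OF d1 d2]]]) simp
  show "(T' f has_real_derivative (2 * \<kappa> * T' f t + K * T f t - f t)) (at t)"
    unfolding T'_def[abs_def]
  proof (rule DERIV_cong[OF DERIV_cdivide[OF DERIV_diff[OF DERIV_cmult[OF d2] DERIV_cmult[OF d1]]]])
    define A where "A = lag \<mu> f t"
    define B where "B = lag \<nu> (\<lambda>s. f (- s)) (- t)"
    have "\<nu> * - (f t - \<nu> * B) - \<mu> * (f t - \<mu> * A) = (\<nu> - \<mu>) * (\<nu> * B - \<mu> * A) + \<mu> * \<nu> * (A + B) - f t * (\<mu> + \<nu>)"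
      by (simp add: algebra_simps)
    moreover have "(2 * \<kappa> * P + K * Q - f t * m) / m = 2 * \<kappa> * (P / m) + K * (Q / m) - f t" if "m \<noteq> 0" for P Q m
      using that by (simp add: field_simps)
    ultimately have "(\<nu> * - (f t - \<nu> * B) - \<mu> * (f t - \<mu> * A)) / (\<mu> + \<nu>) = 2 * \<kappa> * ((\<nu> * B - \<mu> * A) / (\<mu> + \<nu>)) + K * ((A + B) / (\<mu> + \<nu>)) - f t"
      using p unfolding roots(3,4) by metis
    then show "(\<nu> * - (f t - \<nu> * lag \<nu> (\<lambda>s. f (- s)) (- t)) - \<mu> * (f t - \<mu> * lag \<mu> f t)) / (\<mu> + \<nu>) =
      2 * \<kappa> * ((\<nu> * lag \<nu> (\<lambda>s. f (- s)) (- t) - \<mu> * lag \<mu> f t) / (\<mu> + \<nu>)) + K * T f t - f t"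
      unfolding T_def A_def B_def .
  qed
qed

lemma T_mono:
  assumes "f \<in> borel_measurable borel" "\<And>t. \<bar>f t\<bar> \<le> C" "g \<in> borel_measurable borel" "\<And>t. \<bar>g t\<bar> \<le> C"
    "\<And>t. f t \<le> g t"
  shows "T f t \<le> T g t"
  unfolding T_def using roots assms
  by (intro divide_right_mono add_mono lag_mono[where C = C]) auto

lemma T_const: "T (\<lambda>_. c) t = c / K"
proof -
  have "c / \<mu> + c / \<nu> = c * (\<mu> + \<nu>) / K" using roots by (simp add: roots(3)[symmetric] field_simps)
  then show ?thesis using roots lag_const by (simp add: T_def)
qed

lemma T_tendsto:
  assumes m: "\<And>n. f n \<in> borel_measurable borel" "g \<in> borel_measurable borel"
    and b: "\<And>n t. \<bar>f n t\<bar> \<le> C" and lim: "\<And>t. (\<lambda>n. f n t) \<longlonglongrightarrow> g t"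
  shows "(\<lambda>n. T (f n) t) \<longlonglongrightarrow> T g t"
  unfolding T_def
  by (intro tendsto_intros lag_tendsto[where C = C]) (use roots m b lim in auto)

definition adm :: "(real \<Rightarrow> real) \<Rightarrow> bool" where
  "adm f \<longleftrightarrow> continuous_on UNIV f \<and> (\<forall>t. 0 \<le> f t \<and> f t \<le> w0)"

text \<open>A fixed point f satisfies f'' - 2\<kappa>f' - K f = - F(f), which is the wave
  equation.\<close>

abbreviation N where "N f \<equiv> T (\<lambda>t. F (f t))"

lemma adm_F:
  assumes "adm f"
  shows "continuous_on UNIV (\<lambda>t. F (f t))" "(\<lambda>t. F (f t)) \<in> borel_measurable borel" "\<bar>F (f t)\<bar> \<le> K * w0"
proof -
  show c: "continuous_on UNIV (\<lambda>t. F (f t))" using assms unfolding adm_def by (intro F_continuous) auto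
  then show "(\<lambda>t. F (f t)) \<in> borel_measurable borel" by (rule borel_measurable_continuous_onI)
  show "\<bar>F (f t)\<bar> \<le> K * w0" using F_bounds[of "f t"] assms by (auto simp: adm_def)
qed

lemma N_mono: "adm f \<Longrightarrow> adm g \<Longrightarrow> (\<And>t. f t \<le> g t) \<Longrightarrow> N f t \<le> N g t"
  by (rule T_mono[where C = "K * w0"]) (use adm_F in \<open>auto simp: adm_def intro: F_mono\<close>)

lemma N_derivative:
  assumes "adm f"
  shows "(N f has_real_derivative T' (\<lambda>t. F (f t)) t) (at t)"
    "(T' (\<lambda>t. F (f t)) has_real_derivative (2 * \<kappa> * T' (\<lambda>t. F (f t)) t + K * N f t - F (f t))) (at t)"
  using T_derivative[OF adm_F(1,3)[OF assms]] by auto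

lemma N_adm:
  assumes "adm f" shows "adm (N f)"
  unfolding adm_def
proof (intro conjI allI)
  show "continuous_on UNIV (N f)"
    using N_derivative(1)[OF assms] by (meson DERIV_isCont continuous_at_imp_continuous_on)
  have z: "adm (\<lambda>_. 0)" "adm (\<lambda>_. w0)" using w0_pos by (auto simp: adm_def)
  show "0 \<le> N f t" for t
    using N_mono[OF z(1) assms, of t] assms T_const[of 0 t] by (simp add: adm_def F_0)
  show "N f t \<le> w0" for t
    using N_mono[OF assms z(2), of t] assms T_const[of "K * w0" t] K_pos by (simp add: adm_def F_w0)
qed

text \<open>The maximum principle applies to W - N W. Where W = w0 this is nonnegative anyway,
  because N W \<le> w0; so the inequality is asked only below w0, and a cut-off at w0 is
  admissible.\<close>

lemma N_supersolution:
  assumes W: "adm W"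
    and super: "\<And>t. W t < w0 \<Longrightarrow> \<exists>S W1 W2. open S \<and> t \<in> S \<and> (\<forall>s\<in>S. (W has_real_derivative W1 s) (at s)) \<and>
       (W1 has_real_derivative W2) (at t) \<and> W2 - 2 * \<kappa> * W1 t + l * W t - W t powr q \<le> 0"
  shows "N W t \<le> W t"
proof -
  note A = N_adm[OF W]
  have "0 \<le> W t - N W t"
  proof (rule max_principle[where D = "\<lambda>t. W t - N W t", OF K_pos kap])
    show "- w0 \<le> W t - N W t" for t using W A unfolding adm_def by (smt (verit))
    show "continuous_on UNIV (\<lambda>t. W t - N W t)" using W A by (auto simp: adm_def intro!: continuous_intros)
    fix t assume "W t - N W t < 0"
    then have "W t < w0" using A unfolding adm_def by (smt (verit))
    from super[OF this] obtain S W1 W2 where S: "open S" "t \<in> S" "\<And>s. s \<in> S \<Longrightarrow> (W has_real_derivative W1 s) (at s)"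
      "(W1 has_real_derivative W2) (at t)" "W2 - 2 * \<kappa> * W1 t + l * W t - W t powr q \<le> 0" by blast
    let ?P = "T' (\<lambda>t. F (W t))"
    show "\<exists>S D1 D2. open S \<and> t \<in> S \<and> (\<forall>s\<in>S. ((\<lambda>t. W t - N W t) has_real_derivative D1 s) (at s)) \<and>
        (D1 has_real_derivative D2) (at t) \<and> D2 - 2 * \<kappa> * D1 t - K * (W t - N W t) \<le> 0"
      by (rule exI[of _ S], rule exI[of _ "\<lambda>s. W1 s - ?P s"], rule exI[of _ "W2 - (2 * \<kappa> * ?P t + K * N W t - F (W t))"])
        (intro conjI ballI S DERIV_diff N_derivative[OF W], assumption, use S(5) in \<open>simp add: F_def algebra_simps\<close>)
  qed
  then show ?thesis by simp
qed

text \<open>Where V = 0 there is nothing to prove, as N V is nonnegative; so positive parts are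
  admissible.\<close>

lemma N_subsolution:
  assumes V: "adm V"
    and sub: "\<And>t. 0 < V t \<Longrightarrow> \<exists>S V1 V2. open S \<and> t \<in> S \<and> (\<forall>s\<in>S. (V has_real_derivative V1 s) (at s)) \<and>
       (V1 has_real_derivative V2) (at t) \<and> 0 \<le> V2 - 2 * \<kappa> * V1 t + l * V t - V t powr q"
  shows "V t \<le> N V t"
proof -
  note A = N_adm[OF V]
  have "0 \<le> N V t - V t"
  proof (rule max_principle[where D = "\<lambda>t. N V t - V t", OF K_pos kap])
    show "- w0 \<le> N V t - V t" for t using V A unfolding adm_def by (smt (verit))
    show "continuous_on UNIV (\<lambda>t. N V t - V t)" using V A by (auto simp: adm_def intro!: continuous_intros)
    fix t assume "N V t - V t < 0"
    then have "0 < V t" using A unfolding adm_def by (smt (verit))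
    from sub[OF this] obtain S V1 V2 where S: "open S" "t \<in> S" "\<And>s. s \<in> S \<Longrightarrow> (V has_real_derivative V1 s) (at s)"
      "(V1 has_real_derivative V2) (at t)" "0 \<le> V2 - 2 * \<kappa> * V1 t + l * V t - V t powr q" by blast
    let ?P = "T' (\<lambda>t. F (V t))"
    show "\<exists>S D1 D2. open S \<and> t \<in> S \<and> (\<forall>s\<in>S. ((\<lambda>t. N V t - V t) has_real_derivative D1 s) (at s)) \<and>
        (D1 has_real_derivative D2) (at t) \<and> D2 - 2 * \<kappa> * D1 t - K * (N V t - V t) \<le> 0"
      by (rule exI[of _ S], rule exI[of _ "\<lambda>s. ?P s - V1 s"], rule exI[of _ "(2 * \<kappa> * ?P t + K * N V t - F (V t)) - V2"])
        (intro conjI ballI S DERIV_diff N_derivative[OF V], assumption, use S(5) in \<open>simp add: F_def algebra_simps\<close>)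
  qed
  then show ?thesis by simp
qed

text \<open>The iterates that start at W decrease and stay above V, and dominated convergence passes
  to the limit under the kernel. A decreasing limit of continuous functions need not be continuous;
  here all iterates after the first function share a Lipschitz constant.\<close>

lemma fixed_point:
  assumes W: "adm W" "\<And>t. N W t \<le> W t" and V: "adm V" "\<And>t. V t \<le> N V t" and VW: "\<And>t. V t \<le> W t"
  obtains Z where "adm Z" "N Z = Z" "\<And>t. V t \<le> Z t" "\<And>t. Z t \<le> W t"
proof -
  define S where "S n = (N ^^ n) W" for n
  have S0: "S 0 = W" and SS: "S (Suc n) = N (S n)" for n by (auto simp: S_def)
  have ad: "adm (S n)" for n by (induction n) (auto simp: S0 SS W intro: N_adm)
  have dec: "S (Suc n) t \<le> S n t" for n t
  proof (induction n arbitrary: t)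
    case 0 then show ?case using W by (simp add: S0 SS)
  next
    case (Suc n)
    show ?case unfolding SS[of "Suc n"] SS[of n] by (rule N_mono) (use ad Suc in \<open>auto simp: SS[symmetric]\<close>)
  qed
  have ge: "V t \<le> S n t" for n t
  proof (induction n arbitrary: t)
    case 0 then show ?case using VW by (simp add: S0)
  next
    case (Suc n)
    have "V t \<le> N V t" by (rule V(2))
    also have "\<dots> \<le> N (S n) t" by (rule N_mono[OF V(1) ad Suc])
    finally show ?case by (simp add: SS)
  qed
  define Z where "Z t = lim (\<lambda>n. S n t)" for t
  have lim: "(\<lambda>n. S n t) \<longlonglongrightarrow> Z t" for t
  proof -
    have "decseq (\<lambda>n. S n t)" by (rule decseq_SucI) (rule dec)
    moreover have "\<And>n. 0 \<le> S n t" using ad by (auto simp: adm_def)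
    ultimately have "convergent (\<lambda>n. S n t)" by (metis convergentI decseq_convergent)
    then show ?thesis by (simp add: Z_def convergent_LIMSEQ_iff)
  qed
  have Zb: "0 \<le> Z t" "Z t \<le> w0" "V t \<le> Z t" "Z t \<le> W t" for t
  proof -
    show "0 \<le> Z t" "V t \<le> Z t" by (rule LIMSEQ_le_const[OF lim]; use ad ge in \<open>auto simp: adm_def\<close>)+
    show "Z t \<le> w0" by (rule LIMSEQ_le_const2[OF lim]; use ad in \<open>auto simp: adm_def\<close>)
    have "S n t \<le> W t" for n by (induction n) (auto simp: S0 intro: order_trans dec)
    then show "Z t \<le> W t" by (intro LIMSEQ_le_const2[OF lim]) auto
  qed
  have Sm: "S n \<in> borel_measurable borel" for n
    using ad[of n] by (auto simp: adm_def intro: borel_measurable_continuous_onI)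
  have Zm: "Z \<in> borel_measurable borel" by (rule borel_measurable_LIMSEQ_real[OF lim Sm])
  have FZm: "(\<lambda>t. F (Z t)) \<in> borel_measurable borel" unfolding F_def using Zm by measurable
  have "(\<lambda>n. F (S n t)) \<longlonglongrightarrow> F (Z t)" for t
    unfolding F_def using q ad Zb
    by (intro tendsto_intros tendsto_powr' lim) (auto simp: adm_def)
  then have "(\<lambda>n. N (S n) t) \<longlonglongrightarrow> N Z t" for t
    by (rule T_tendsto[OF adm_F(2)[OF ad] FZm adm_F(3)[OF ad]])
  moreover have "(\<lambda>n. N (S n) t) \<longlonglongrightarrow> Z t" for t
    using LIMSEQ_Suc[OF lim] by (simp add: SS)
  ultimately have NZ: "N Z t = Z t" for t using LIMSEQ_unique by blast
  \<comment> \<open>For functions with values in [0, K w0], each of the two terms of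
    \<open>T'\<close> has a numerator of size at most K w0.\<close>
  define L where "L = 2 * (K * w0) / (\<mu> + \<nu>)"
  have lip: "\<bar>S (Suc n) t - S (Suc n) s\<bar> \<le> L * \<bar>t - s\<bar>" for n s t
  proof -
    have d: "(S (Suc n) has_real_derivative T' (\<lambda>t. F (S n t)) x) (at x)" for x
      unfolding SS by (rule N_derivative[OF ad])
    have b: "\<bar>T' (\<lambda>t. F (S n t)) x\<bar> \<le> L" for x
    proof -
      let ?A = "lag \<mu> (\<lambda>t. F (S n t)) x" and ?B = "lag \<nu> (\<lambda>s. F (S n (- s))) (- x)"
      have "\<bar>?A\<bar> \<le> K * w0 / \<mu>" by (rule lag_bound[OF roots(1) adm_F(2,3)[OF ad]])
      then have a: "\<bar>\<mu> * ?A\<bar> \<le> K * w0" using roots(1) by (simp add: abs_mult pos_le_divide_eq mult.commute)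
      have "continuous_on UNIV (\<lambda>s. F (S n (- s)))"
        by (rule continuous_on_compose2[OF adm_F(1)[OF ad]]) (auto intro!: continuous_intros)
      then have "\<bar>?B\<bar> \<le> K * w0 / \<nu>"
        by (intro lag_bound[OF roots(2)] borel_measurable_continuous_onI adm_F(3)[OF ad])
      then have b: "\<bar>\<nu> * ?B\<bar> \<le> K * w0" using roots(2) by (simp add: abs_mult pos_le_divide_eq mult.commute)
      have "\<bar>\<nu> * ?B - \<mu> * ?A\<bar> \<le> 2 * (K * w0)" using a b by linarith
      then have "\<bar>\<nu> * ?B - \<mu> * ?A\<bar> / (\<mu> + \<nu>) \<le> L"
        unfolding L_def using roots(1,2) by (intro divide_right_mono) auto
      moreover have "\<bar>T' (\<lambda>t. F (S n t)) x\<bar> = \<bar>\<nu> * ?B - \<mu> * ?A\<bar> / (\<mu> + \<nu>)"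
        unfolding T'_def abs_divide using roots(1,2) by simp
      ultimately show ?thesis by simp
    qed
    have "\<bar>S (Suc n) y - S (Suc n) x\<bar> \<le> L * \<bar>y - x\<bar>" if xy: "x < y" for x y
    proof -
      obtain z where "S (Suc n) y - S (Suc n) x = (y - x) * T' (\<lambda>t. F (S n t)) z"
        using MVT2[OF xy, of "S (Suc n)" "T' (\<lambda>t. F (S n t))"] d by blast
      then show ?thesis using b[of z] xy by (simp add: abs_mult mult.commute mult_right_mono)
    qed
    from this[of s t] this[of t s] show ?thesis
      by (cases s t rule: linorder_cases) (auto simp: abs_minus_commute)
  qed
  have "\<bar>Z t - Z s\<bar> \<le> L * \<bar>t - s\<bar>" for s t
  proof (rule LIMSEQ_le_const2)
    show "(\<lambda>n. \<bar>S (Suc n) t - S (Suc n) s\<bar>) \<longlonglongrightarrow> \<bar>Z t - Z s\<bar>"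
      by (intro tendsto_intros LIMSEQ_Suc lim)
  qed (use lip in blast)
  then have "L-lipschitz_on UNIV Z"
    using K_pos w0_pos roots(1,2) by (intro lipschitz_onI) (auto simp: dist_real_def L_def)
  then have "continuous_on UNIV Z" by (rule lipschitz_on_continuous_on)
  then have "adm Z" using Zb by (auto simp: adm_def)
  then show ?thesis using that[of Z] NZ Zb by blast
qed

end

text \<open>The product exp(a t) lag is nonnegative and nondecreasing. If it vanished at t, it would
  vanish at all earlier times, and so would its derivative exp(a s) f(s).\<close>

lemma lag_pos:
  assumes a: "0 < a" and c: "continuous_on UNIV f" and b: "\<And>t. \<bar>f t\<bar> \<le> C" and nn: "\<And>t. 0 \<le> f t"
    and s: "s < t" "0 < f s"
  shows "0 < lag a f t"
proof (rule ccontr)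
  assume "\<not> 0 < lag a f t"
  have lnn: "0 \<le> lag a f t" for t
    unfolding lag_def by (rule Bochner_Integration.integral_nonneg) (auto simp: nn)
  define G where "G t = exp (a * t) * lag a f t" for t
  have dG: "(G has_real_derivative exp (a * t) * f t) (at t)" for t
  proof -
    have "((\<lambda>t. exp (a * t)) has_real_derivative a * exp (a * t)) (at t)" by (auto intro!: derivative_eq_intros)
    from DERIV_mult[OF this lag_derivative[OF a c b]] show ?thesis
      unfolding G_def[abs_def] by (rule DERIV_cong) (simp add: algebra_simps)
  qed
  have G0: "G r = 0" if "r < t" for r
  proof -
    have "G r \<le> G t"
      by (rule DERIV_nonneg_imp_nondecreasing) (use that dG nn in \<open>auto intro!: exI mult_nonneg_nonneg\<close>)
    moreover have "G t = 0" using \<open>\<not> 0 < lag a f t\<close> lnn[of t] by (simp add: G_def)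
    moreover have "0 \<le> G r" using lnn by (simp add: G_def)
    ultimately show ?thesis by simp
  qed
  have "((\<lambda>_. 0) has_real_derivative exp (a * s) * f s) (at s)"
    by (rule has_field_derivative_transform_within_open[OF dG, of "{..<t}"]) (use s G0 in auto)
  then have "exp (a * s) * f s = 0" using DERIV_unique[OF _ DERIV_const] by blast
  then show False using s by simp
qed

lemma local_C2I:
  fixes f g :: "real \<Rightarrow> real"
  assumes "open S" "t \<in> S" "\<forall>s\<in>S. (f has_real_derivative g s) (at s)" "(g has_real_derivative h) (at t)" "P g h"
  shows "\<exists>S g h. open S \<and> t \<in> S \<and> (\<forall>s\<in>S. (f has_real_derivative g s) (at s)) \<and>
    (g has_real_derivative h) (at t) \<and> P g h"
  using assms by (intro exI conjI)

section \<open>Asymptotics at minus infinity and existence of the wave\<close>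

context wave
begin

text \<open>The smaller root of s^2 - 2\<kappa>s + l, hence the slower decay at minus
  infinity.\<close>

definition \<theta> where "\<theta> = \<kappa> - sqrt (\<kappa>\<^sup>2 - l)"

text \<open>The slowly decaying solution of the equation linearised at 0; if the root is double, it
  carries the factor -t.\<close>

definition lin :: "real \<Rightarrow> real" where
  "lin t = (if l < \<kappa>\<^sup>2 then exp (\<theta> * t) else - t * exp (\<kappa> * t))"

lemma lam: "0 < \<theta>" "\<theta>\<^sup>2 - 2 * \<kappa> * \<theta> + l = 0"
proof -
  have "sqrt (\<kappa>\<^sup>2 - l) < \<kappa>" using kap l by (intro real_less_lsqrt) auto
  then show "0 < \<theta>" by (simp add: \<theta>_def)
  have "(sqrt (\<kappa>\<^sup>2 - l))\<^sup>2 = \<kappa>\<^sup>2 - l" using l by simp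
  then show "\<theta>\<^sup>2 - 2 * \<kappa> * \<theta> + l = 0" by (simp add: \<theta>_def power2_eq_square algebra_simps)
qed

lemma tendsto_div_at_bot: "((\<lambda>t::real. c / t) \<longlongrightarrow> 0) at_bot"
  by (rule tendsto_divide_0[OF tendsto_const]) (simp add: filterlim_at_bot_imp_at_infinity filterlim_ident)

text \<open>Near minus infinity a translation acts as multiplication by a constant; for a double
  root this is so because (t + c) / t tends to 1.\<close>

lemma lin_shift: "((\<lambda>t. lin (t + c) / lin t) \<longlongrightarrow> exp (\<theta> * c)) at_bot"
proof (cases "l < \<kappa>\<^sup>2")
  case True
  then show ?thesis by (simp add: lin_def exp_add distrib_left)
next
  case False
  then have lk: "\<theta> = \<kappa>" unfolding \<theta>_def using l by simp
  have "((\<lambda>t. (1 + c / t) * exp (\<kappa> * c)) \<longlongrightarrow> (1 + 0) * exp (\<kappa> * c)) at_bot"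
    by (intro tendsto_intros tendsto_div_at_bot)
  moreover have "eventually (\<lambda>t. (1 + c / t) * exp (\<kappa> * c) = lin (t + c) / lin t) at_bot"
    using eventually_gt_at_bot[of 0]
  proof eventually_elim
    case (elim t)
    then show ?case using False by (simp add: lin_def exp_add distrib_left field_simps)
  qed
  ultimately show ?thesis unfolding lk by (simp add: tendsto_cong)
qed

lemma lin_pos: "eventually (\<lambda>t. 0 < lin t) at_bot"
  using eventually_gt_at_bot[of 0] by eventually_elim (auto simp: lin_def mult_neg_pos)

text \<open>A solution of the linearised equation is a supersolution, because w^q has the favourable
  sign; it is cut off at w0. The subsolution carries a correction of lower order at minus infinity
  that pays for w^q. Both are asymptotic to \<open>lin\<close>, hence so is every function between
  them.\<close>

lemma barriers_exist:
  obtains W V where "adm W" "\<And>t. N W t \<le> W t" "adm V" "\<And>t. V t \<le> N V t" "\<And>t. V t \<le> W t"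
    "((\<lambda>t. W t / lin t) \<longlongrightarrow> 1) at_bot" "((\<lambda>t. V t / lin t) \<longlongrightarrow> 1) at_bot"
proof (cases "l < \<kappa>\<^sup>2")
  case True
  define r where "r = sqrt (\<kappa>\<^sup>2 - l)"
  have r: "0 < r" using True by (simp add: r_def)
  have lr: "\<theta> = \<kappa> - r" by (simp add: \<theta>_def r_def)
  \<comment> \<open>The first bound gives exp(\<theta>t)^q \<le> exp((\<theta> + \<delta>)t) for t <
    0. The second one places \<theta> + \<delta> between the roots \<theta> and \<theta> + 2r, where
    the characteristic polynomial equals -\<delta>(2r - \<delta>) \<le> -\<delta>r.\<close>
  define \<delta> where "\<delta> = min ((q - 1) * \<theta>) r"
  have \<delta>: "0 < \<delta>" "\<delta> \<le> (q - 1) * \<theta>" "\<delta> \<le> r" using q lam r by (auto simp: \<delta>_def)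
  \<comment> \<open>In this order, the bounds ensure that V is positive only for t < 0, that the
    gain B \<delta> r H covers H, and that exp(\<theta>t) < w0 wherever V is positive.\<close>
  define B where "B = max 1 (max (1 / (\<delta> * r)) (w0 powr (- \<delta> / \<theta>)))"
  have B: "1 \<le> B" "1 / (\<delta> * r) \<le> B" "w0 powr (- \<delta> / \<theta>) \<le> B" by (auto simp: B_def)
  define E where "E t = exp (\<theta> * t)" for t
  define H where "H t = exp ((\<theta> + \<delta>) * t)" for t
  have dE: "(E has_real_derivative \<theta> * E t) (at t)" "(H has_real_derivative (\<theta> + \<delta>) * H t) (at t)" for t
    unfolding E_def H_def by (auto intro!: derivative_eq_intros)
  have cE: "continuous_on A E" "continuous_on A H" for A unfolding E_def H_def by (intro continuous_intros)+
  have HE: "H t = exp (\<delta> * t) * E t" for t by (simp add: H_def E_def exp_add[symmetric] algebra_simps)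
  define W where "W t = min w0 (E t)" for t
  define V where "V t = max 0 (E t - B * H t)" for t
  have W: "adm W" unfolding adm_def W_def using w0_pos by (auto intro!: continuous_intros cE simp: E_def less_imp_le)
  have NW: "N W t \<le> W t" for t
  proof (rule N_supersolution[OF W])
    fix t assume "W t < w0"
    then have Et: "E t < w0" by (simp add: W_def min_def split: if_splits)
    let ?S = "{s. E s < w0}"
    have oS: "open ?S" by (intro open_Collect_less cE continuous_on_const)
    have "\<forall>s\<in>?S. (W has_real_derivative \<theta> * E s) (at s)"
    proof
      fix s assume s: "s \<in> ?S"
      show "(W has_real_derivative \<theta> * E s) (at s)"
        by (rule has_field_derivative_transform_within_open[OF dE(1) oS s]) (simp add: W_def)
    qed
    moreover have "((\<lambda>s. \<theta> * E s) has_real_derivative \<theta> * (\<theta> * E t)) (at t)" by (rule DERIV_cmult[OF dE(1)])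
    moreover have "\<theta> * (\<theta> * E t) - 2 * \<kappa> * (\<theta> * E t) + l * W t - W t powr q \<le> 0"
    proof -
      have "\<theta> * (\<theta> * E t) - 2 * \<kappa> * (\<theta> * E t) + l * W t = (\<theta>\<^sup>2 - 2 * \<kappa> * \<theta> + l) * E t"
        using Et by (simp add: W_def power2_eq_square algebra_simps)
      then show ?thesis using lam by simp
    qed
    moreover have "t \<in> ?S" using Et by simp
    ultimately show "\<exists>S W1 W2. open S \<and> t \<in> S \<and> (\<forall>s\<in>S. (W has_real_derivative W1 s) (at s)) \<and>
       (W1 has_real_derivative W2) (at t) \<and> W2 - 2 * \<kappa> * W1 t + l * W t - W t powr q \<le> 0"
      by - (rule local_C2I[where S = "?S" and g = "\<lambda>s. \<theta> * E s" and h = "\<theta> * (\<theta> * E t)", OF oS]; assumption)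
  qed
  have Vpos: "E t < w0 \<and> t < 0 \<and> 0 < E t - B * H t" if "0 < V t" for t
  proof -
    have p: "0 < E t - B * H t" using that by (simp add: V_def max_def split: if_splits)
    then have "B * exp (\<delta> * t) * E t < 1 * E t" by (simp add: HE mult_ac)
    then have b: "B * exp (\<delta> * t) < 1" using E_def by (simp only: mult_less_cancel_right) auto
    have "1 * exp (\<delta> * t) \<le> B * exp (\<delta> * t)" "w0 powr (- \<delta> / \<theta>) * exp (\<delta> * t) \<le> B * exp (\<delta> * t)"
      using B(1,3) by (intro mult_right_mono; simp)+
    then have e: "exp (\<delta> * t) < 1" "w0 powr (- \<delta> / \<theta>) * exp (\<delta> * t) < 1" using b by linarith+
    have t: "t < 0" using e(1) \<delta>(1) by (simp add: mult_less_0_iff)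
    have "exp (\<delta> * t) < w0 powr (\<delta> / \<theta>)" using e(2) w0_pos by (simp add: powr_minus field_simps)
    then have "ln (exp (\<delta> * t)) < ln (w0 powr (\<delta> / \<theta>))" using w0_pos by (subst ln_less_cancel_iff) auto
    then have "\<delta> * t < \<delta> / \<theta> * ln w0" using w0_pos by (simp add: ln_powr)
    then have "\<theta> * t < ln w0" using \<delta>(1) lam(1) by (simp add: field_simps)
    then have "exp (\<theta> * t) < exp (ln w0)" by (simp only: exp_less_cancel_iff)
    then have "E t < w0" using w0_pos by (simp add: E_def)
    then show ?thesis using t p by blast
  qed
  have H0: "0 < H t" "0 < E t" for t by (auto simp: H_def E_def)
  have VW: "V t \<le> W t" for t
  proof (cases "0 < V t")
    case True
    have "0 < B * H t" using B H0[of t] by simp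
    then have "V t \<le> E t" using Vpos[OF True] by (simp add: V_def)
    then show ?thesis using Vpos[OF True] by (simp add: W_def)
  next
    case False
    then have "V t \<le> 0" by simp
    then show ?thesis using W by (auto simp: adm_def intro: order_trans)
  qed
  have V: "adm V" unfolding adm_def
  proof (intro conjI allI)
    show "continuous_on UNIV V" unfolding V_def by (intro continuous_intros cE)
    show "0 \<le> V t" for t by (simp add: V_def)
    show "V t \<le> w0" for t using VW[of t] W by (auto simp: adm_def intro: order_trans)
  qed
  have NV: "V t \<le> N V t" for t
  proof (rule N_subsolution[OF V])
    fix t assume Vt: "0 < V t"
    let ?S = "{s. 0 < E s - B * H s}"
    have oS: "open ?S" by (intro open_Collect_less continuous_intros cE)
    let ?V1 = "\<lambda>s. \<theta> * E s - B * ((\<theta> + \<delta>) * H s)"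
    let ?V2 = "\<theta> * (\<theta> * E t) - B * ((\<theta> + \<delta>) * ((\<theta> + \<delta>) * H t))"
    have "\<forall>s\<in>?S. (V has_real_derivative ?V1 s) (at s)"
    proof
      fix s assume s: "s \<in> ?S"
      show "(V has_real_derivative ?V1 s) (at s)"
        by (rule has_field_derivative_transform_within_open[OF DERIV_diff[OF dE(1) DERIV_cmult[OF dE(2)]] oS s]) (simp add: V_def)
    qed
    moreover have "(?V1 has_real_derivative ?V2) (at t)"
      by (intro DERIV_diff DERIV_cmult dE)
    moreover have "0 \<le> ?V2 - 2 * \<kappa> * ?V1 t + l * V t - V t powr q"
    proof -
      have Vt': "V t = E t - B * H t" "t < 0" using Vpos[OF Vt] by (auto simp: V_def)
      have "V t \<le> E t" using Vt'(1) B H0[of t] by simp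
      then have "V t powr q \<le> E t powr q" using Vt q by (intro powr_mono2) auto
      also have "E t powr q = exp (q * (\<theta> * t))" by (simp add: E_def exp_powr_real mult.commute)
      also have "\<dots> \<le> H t" unfolding H_def
      proof -
        have "\<theta> + \<delta> \<le> q * \<theta>" using \<delta>(2) by (simp add: algebra_simps)
        then have "q * \<theta> * t \<le> (\<theta> + \<delta>) * t" using Vt'(2) by (intro mult_right_mono_neg) auto
        then show "exp (q * (\<theta> * t)) \<le> exp ((\<theta> + \<delta>) * t)" by (simp add: mult.assoc)
      qed
      also have "H t = 1 * H t" by simp
      also have "\<dots> \<le> B * (\<delta> * r) * H t"
        using B(2) \<delta>(1) r H0[of t] by (intro mult_right_mono) (auto simp: field_simps)
      also have "\<dots> \<le> B * (\<delta> * (2 * r - \<delta>)) * H t"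
        using B(1) \<delta> H0[of t] by (intro mult_right_mono mult_left_mono) auto
      finally have "V t powr q \<le> B * (\<delta> * (2 * r - \<delta>)) * H t" .
      moreover have "?V2 - 2 * \<kappa> * ?V1 t + l * V t = (\<theta>\<^sup>2 - 2 * \<kappa> * \<theta> + l) * (E t - B * H t) + B * (\<delta> * (2 * r - \<delta>)) * H t"
        unfolding Vt'(1) lr by (simp add: power2_eq_square algebra_simps)
      ultimately show ?thesis using lam(2) by simp
    qed
    moreover have "t \<in> ?S" using Vpos[OF Vt] by simp
    ultimately show "\<exists>S V1 V2. open S \<and> t \<in> S \<and> (\<forall>s\<in>S. (V has_real_derivative V1 s) (at s)) \<and>
       (V1 has_real_derivative V2) (at t) \<and> 0 \<le> V2 - 2 * \<kappa> * V1 t + l * V t - V t powr q"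
      by - (rule local_C2I[where S = "?S" and g = "?V1" and h = "?V2", OF oS]; assumption)
  qed
  have linE: "lin = E" using True by (simp add: lin_def E_def fun_eq_iff)
  have ed: "((\<lambda>t. exp (\<delta> * t)) \<longlongrightarrow> 0) at_bot"
    using \<delta>(1) by (intro filterlim_compose[OF exp_at_bot] filterlim_tendsto_pos_mult_at_bot[OF tendsto_const _ filterlim_ident])
  have lim1: "((\<lambda>t. 1 - B * exp (\<delta> * t)) \<longlongrightarrow> 1 - B * 0) at_bot" by (intro tendsto_intros ed)
  have low: "1 - B * exp (\<delta> * t) \<le> V t / lin t" for t
    using H0[of t] by (simp add: V_def linE HE le_divide_eq algebra_simps)
  have up: "W t / lin t \<le> 1" for t using H0[of t] by (simp add: W_def linE divide_le_eq)
  have mid: "V t / lin t \<le> W t / lin t" for t using VW[of t] H0(2)[of t] by (simp add: linE divide_right_mono)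
  have "((\<lambda>t. W t / lin t) \<longlongrightarrow> 1) at_bot"
    by (rule tendsto_sandwich[OF _ _ _ tendsto_const[of 1]])
       (use lim1 in \<open>auto intro!: always_eventually order_trans[OF low mid] up\<close>)
  moreover have "((\<lambda>t. V t / lin t) \<longlongrightarrow> 1) at_bot"
    by (rule tendsto_sandwich[OF _ _ _ tendsto_const[of 1]])
       (use lim1 in \<open>auto intro!: always_eventually order_trans[OF mid up] low\<close>)
  ultimately show ?thesis using that[OF W NW V NV VW] by blast
next
  case False
  then have lk: "l = \<kappa>\<^sup>2" using l by simp
  \<comment> \<open>For the double root, L(t) = (A - t) exp(\<kappa>t) solves the linearised
    equation. The constants put its maximum at t1 with the value w0, so that W can be continued by
    w0 beyond t1.\<close>
  define t1 where "t1 = ln (\<kappa> * w0) / \<kappa>"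
  define A where "A = t1 + 1 / \<kappa>"
  define E where "E t = exp (\<kappa> * t)" for t
  define L where "L t = (A - t) * E t" for t
  have E0: "0 < E t" for t by (simp add: E_def)
  have dE: "(E has_real_derivative \<kappa> * E t) (at t)" for t
    unfolding E_def by (auto intro!: derivative_eq_intros)
  have cE: "continuous_on B E" for B unfolding E_def by (intro continuous_intros)
  have cL: "continuous_on B L" for B unfolding L_def by (intro continuous_intros cE)
  have E1: "E t1 = \<kappa> * w0" using kap w0_pos by (simp add: E_def t1_def)
  have L1: "L t1 = w0" using kap by (simp add: L_def A_def E1)
  have Lw: "L t \<le> w0" for t
  proof -
    have "1 - \<kappa> * (t - t1) \<le> exp (- \<kappa> * (t - t1))" using exp_ge_add_one_self[of "- \<kappa> * (t - t1)"] by simp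
    then have "(1 - \<kappa> * (t - t1)) * exp (\<kappa> * (t - t1)) \<le> exp (- \<kappa> * (t - t1)) * exp (\<kappa> * (t - t1))"
      by (intro mult_right_mono) auto
    then have le: "(1 - \<kappa> * (t - t1)) * exp (\<kappa> * (t - t1)) \<le> 1" by (simp add: exp_add[symmetric])
    have "E t = E t1 * exp (\<kappa> * (t - t1))" by (simp add: E_def exp_add[symmetric] algebra_simps)
    then have "L t = w0 * ((1 - \<kappa> * (t - t1)) * exp (\<kappa> * (t - t1)))"
      unfolding L_def E1 A_def using kap by (simp add: field_simps)
    also have "\<dots> \<le> w0 * 1" using le w0_pos by (intro mult_left_mono) auto
    finally show ?thesis by simp
  qed
  define W where "W t = L (min t t1)" for t
  have W: "adm W" unfolding adm_def
  proof (intro conjI allI)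
    show "continuous_on UNIV W" unfolding W_def
      by (rule continuous_on_compose2[OF cL[of UNIV]]) (auto intro!: continuous_intros)
    show "W t \<le> w0" for t by (simp add: W_def Lw)
    show "0 \<le> W t" for t
    proof -
      have "0 < 1 / \<kappa>" using kap by simp
      moreover have "min t t1 \<le> t1" by simp
      ultimately have "0 \<le> A - min t t1" unfolding A_def by linarith
      then show ?thesis using E0 by (simp add: W_def L_def less_imp_le)
    qed
  qed
  have NW: "N W t \<le> W t" for t
  proof (rule N_supersolution[OF W])
    fix t assume "W t < w0"
    then have t: "t < t1" using L1 by (simp add: W_def min_def split: if_splits) (metis order_less_le less_irrefl)
    let ?S = "{..<t1}"
    have oS: "open ?S" by simp
    let ?W1 = "\<lambda>s. (\<kappa> * (A - s) - 1) * E s"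
    let ?W2 = "(\<kappa>\<^sup>2 * (A - t) - 2 * \<kappa>) * E t"
    have dL: "(L has_real_derivative ?W1 s) (at s)" for s
      unfolding L_def by (rule derivative_eq_intros dE refl)+ (simp add: algebra_simps)
    have "\<forall>s\<in>?S. (W has_real_derivative ?W1 s) (at s)"
    proof
      fix s assume s: "s \<in> ?S"
      show "(W has_real_derivative ?W1 s) (at s)"
        by (rule has_field_derivative_transform_within_open[OF dL open_lessThan s]) (simp add: W_def min_def)
    qed
    moreover have "(?W1 has_real_derivative ?W2) (at t)"
      by (rule derivative_eq_intros dE refl)+ (simp add: power2_eq_square algebra_simps)
    moreover have "?W2 - 2 * \<kappa> * ?W1 t + l * W t - W t powr q \<le> 0"
      using t by (simp add: lk W_def L_def power2_eq_square algebra_simps)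
    moreover have "t \<in> ?S" using t by simp
    ultimately show "\<exists>S W1 W2. open S \<and> t \<in> S \<and> (\<forall>s\<in>S. (W has_real_derivative W1 s) (at s)) \<and>
       (W1 has_real_derivative W2) (at t) \<and> W2 - 2 * \<kappa> * W1 t + l * W t - W t powr q \<le> 0"
      by - (rule local_C2I[where S = "?S" and g = "?W1" and h = "?W2", OF oS]; assumption)
  qed
  \<comment> \<open>Half of the additional decay rate (q - 1)\<kappa> of w^q; the other half absorbs
    the factor (-t)^q.\<close>
  define \<delta> where "\<delta> = (q - 1) * \<kappa> / 2"
  have \<delta>: "0 < \<delta>" using q kap by (simp add: \<delta>_def)
  \<comment> \<open>On exp(\<kappa>t) y the linear operator acts as exp(\<kappa>t) y'', here B
    \<delta>^2 exp((\<kappa> + \<delta>)t), and (-t)^q exp(\<delta>t) \<le> (q / \<delta>)^q for t <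
    0.\<close>
  define B where "B = (q / \<delta>) powr q / \<delta>\<^sup>2"
  have B: "0 \<le> B" by (simp add: B_def)
  \<comment> \<open>This makes y(0) negative, so that V vanishes for t \<ge> 0, and gives y(t) \<le>
    A - t for t < 0, so that V stays below L.\<close>
  define C where "C = \<bar>A\<bar> + 1"
  define y where "y t = - t - C - B * (1 - exp (\<delta> * t))" for t
  have cy: "continuous_on U y" for U unfolding y_def by (intro continuous_intros)
  define V where "V t = E t * max 0 (y (min t 0))" for t
  have Vpos: "t < 0 \<and> 0 < y t \<and> V t = E t * y t \<and> y t \<le> - t - C" if "0 < V t" for t
  proof -
    have p: "0 < y (min t 0)" using that E0[of t] by (auto simp: V_def zero_less_mult_iff max_def split: if_splits)
    have "y 0 < 0" by (simp add: y_def C_def)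
    then have t: "t < 0" using p by (cases "t < 0") auto
    moreover have "0 \<le> B * (1 - exp (\<delta> * t))" using B t \<delta> by (intro mult_nonneg_nonneg) (auto simp: mult_le_0_iff)
    ultimately show ?thesis using p by (auto simp: V_def y_def)
  qed
  have VW: "V t \<le> W t" for t
  proof (cases "0 < V t")
    case True
    have "V t = E t * y t" "y t \<le> A - t" using Vpos[OF True] by (auto simp: C_def)
    then have "V t \<le> L t" using E0[of t] by (simp add: L_def mult.commute mult_left_mono)
    moreover have "L t \<le> W t" using Lw[of t] L1 by (simp add: W_def min_def)
    ultimately show ?thesis by simp
  next
    case False
    then have "V t \<le> 0" by simp
    then show ?thesis using W by (auto simp: adm_def intro: order_trans)
  qed
  have V: "adm V" unfolding adm_def
  proof (intro conjI allI)
    have "continuous_on UNIV (\<lambda>t. y (min t 0))"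
      by (rule continuous_on_compose2[OF cy[of UNIV]]) (auto intro!: continuous_intros)
    then show "continuous_on UNIV V" unfolding V_def by (intro continuous_intros cE)
    show "0 \<le> V t" for t using E0[of t] by (simp add: V_def)
    show "V t \<le> w0" for t using VW[of t] W by (auto simp: adm_def intro: order_trans)
  qed
  have NV: "V t \<le> N V t" for t
  proof (rule N_subsolution[OF V])
    fix t assume Vt: "0 < V t"
    note P = Vpos[OF Vt]
    let ?S = "{s. 0 < y s} \<inter> {..<0}"
    have oS: "open ?S" by (intro open_Int open_Collect_less cy continuous_on_const open_lessThan)
    let ?y1 = "\<lambda>s. - 1 + B * (\<delta> * exp (\<delta> * s))"
    let ?V1 = "\<lambda>s. (\<kappa> * y s + ?y1 s) * E s"
    let ?V2 = "(\<kappa>\<^sup>2 * y t + 2 * \<kappa> * ?y1 t + B * \<delta>\<^sup>2 * exp (\<delta> * t)) * E t"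
    have dy: "(y has_real_derivative ?y1 s) (at s)" for s
      unfolding y_def by (auto intro!: derivative_eq_intros)
    have dy1: "(?y1 has_real_derivative B * \<delta>\<^sup>2 * exp (\<delta> * s)) (at s)" for s
      by (auto intro!: derivative_eq_intros simp: power2_eq_square)
    have d: "((\<lambda>s. E s * y s) has_real_derivative ?V1 s) (at s)" for s
      by (rule DERIV_cong[OF DERIV_mult[OF dE dy]]) (simp add: algebra_simps)
    have "\<forall>s\<in>?S. (V has_real_derivative ?V1 s) (at s)"
    proof
      fix s assume s: "s \<in> ?S"
      show "(V has_real_derivative ?V1 s) (at s)"
        by (rule has_field_derivative_transform_within_open[OF d oS s]) (simp add: V_def min_def max_def)
    qed
    moreover have "(?V1 has_real_derivative ?V2) (at t)"
      by (rule DERIV_cong[OF DERIV_mult[OF DERIV_add[OF DERIV_cmult[OF dy] dy1] dE]])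
         (simp add: algebra_simps power2_eq_square)
    moreover have "0 \<le> ?V2 - 2 * \<kappa> * ?V1 t + l * V t - V t powr q"
    proof -
      \<comment> \<open>The bound on (-t)^q exp(\<delta>t) comes from s \<le> exp(s) at s =
        -\<delta>t / q, raised to the power q.\<close>
      have "\<delta> * (- t) / q \<le> exp (\<delta> * (- t) / q)" using exp_ge_add_one_self[of "\<delta> * (- t) / q"] by linarith
      then have "(\<delta> * (- t) / q) powr q \<le> exp (\<delta> * (- t) / q) powr q"
      proof (rule powr_mono2[rotated 2])
        show "0 \<le> \<delta> * (- t) / q" using \<delta> q P by (intro divide_nonneg_pos mult_nonneg_nonneg) auto
      qed (use q in simp)
      also have "\<dots> = exp (- (\<delta> * t))" using q by (simp add: exp_powr_real)
      finally have "(- t) powr q * (\<delta> / q) powr q \<le> exp (- (\<delta> * t))"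
        using \<delta> q P by (simp add: powr_mult[symmetric] mult.commute)
      then have "(- t) powr q * (\<delta> / q) powr q * (q / \<delta>) powr q * exp (\<delta> * t) \<le> exp (- (\<delta> * t)) * (q / \<delta>) powr q * exp (\<delta> * t)"
        by (intro mult_right_mono) auto
      moreover have "(\<delta> / q) powr q * (q / \<delta>) powr q = 1" using \<delta> q by (simp add: powr_mult[symmetric])
      moreover have "exp (- (\<delta> * t)) * exp (\<delta> * t) = 1" by (simp add: exp_add[symmetric])
      ultimately have "(- t) powr q * exp (\<delta> * t) \<le> (q / \<delta>) powr q"
        by (metis (no_types, opaque_lifting) mult.assoc mult.commute mult.right_neutral)
      then have key: "(- t) powr q * exp (\<delta> * t) \<le> B * \<delta>\<^sup>2" using \<delta> by (simp add: B_def)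
      have "y t powr q \<le> (- t) powr q" using P q by (intro powr_mono2) (auto simp: C_def)
      moreover have "V t powr q = E t powr q * y t powr q" using P E0[of t] by (simp add: powr_mult)
      moreover have "E t powr q = E t * (exp (\<delta> * t) * exp (\<delta> * t))"
        by (simp add: E_def exp_powr_real exp_add[symmetric] \<delta>_def field_simps)
      ultimately have "V t powr q \<le> E t * (exp (\<delta> * t) * exp (\<delta> * t)) * (- t) powr q"
        using E0[of t] by (simp add: mult_left_mono)
      also have "\<dots> = E t * exp (\<delta> * t) * ((- t) powr q * exp (\<delta> * t))" by (simp add: mult_ac)
      also have "\<dots> \<le> E t * exp (\<delta> * t) * (B * \<delta>\<^sup>2)" using key E0[of t] by (intro mult_left_mono) auto
      also have "\<dots> = ?V2 - 2 * \<kappa> * ?V1 t + l * V t"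
      proof -
        have "V t = E t * y t" using P by blast
        then show ?thesis unfolding lk by (simp add: power2_eq_square algebra_simps)
      qed
      finally show ?thesis by simp
    qed
    moreover have "t \<in> ?S" using P by simp
    ultimately show "\<exists>S V1 V2. open S \<and> t \<in> S \<and> (\<forall>s\<in>S. (V has_real_derivative V1 s) (at s)) \<and>
       (V1 has_real_derivative V2) (at t) \<and> 0 \<le> V2 - 2 * \<kappa> * V1 t + l * V t - V t powr q"
      by - (rule local_C2I[where S = "?S" and g = "?V1" and h = "?V2", OF oS]; assumption)
  qed
  have lim1: "((\<lambda>t. 1 + (C + B) / t) \<longlongrightarrow> 1 + 0) at_bot" "((\<lambda>t. 1 - A / t) \<longlongrightarrow> 1 - 0) at_bot"
    by (intro tendsto_intros tendsto_div_at_bot)+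
  have lin: "lin t = - t * E t" for t using False by (simp add: lin_def E_def)
  have low: "eventually (\<lambda>t. 1 + (C + B) / t \<le> V t / lin t) at_bot"
    using eventually_gt_at_bot[of 0]
  proof eventually_elim
    case (elim t)
    have "0 \<le> B * exp (\<delta> * t)" using B by simp
    then have "- t - C - B \<le> max 0 (y t)" by (simp add: y_def algebra_simps)
    then have "(- t - C - B) / (- t) \<le> max 0 (y t) / (- t)" using elim by (intro divide_right_mono) auto
    moreover have "V t / lin t = max 0 (y t) / (- t)" using elim E0[of t] by (simp add: V_def lin)
    moreover have "(- t - C - B) / (- t) = 1 + (C + B) / t" using elim by (simp add: field_simps)
    ultimately show ?case by simp
  qed
  have up: "eventually (\<lambda>t. W t / lin t \<le> 1 - A / t) at_bot"
    using eventually_gt_at_bot[of 0] eventually_gt_at_bot[of t1]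
  proof eventually_elim
    case (elim t)
    then show ?case using E0[of t] by (simp add: W_def L_def lin field_simps)
  qed
  have mid: "eventually (\<lambda>t. V t / lin t \<le> W t / lin t) at_bot"
    using lin_pos by eventually_elim (simp add: VW divide_right_mono)
  have "((\<lambda>t. W t / lin t) \<longlongrightarrow> 1) at_bot"
    by (rule tendsto_sandwich[OF _ up lim1(1)[simplified] lim1(2)[simplified]])
       (use low mid in eventually_elim, simp)
  moreover have "((\<lambda>t. V t / lin t) \<longlongrightarrow> 1) at_bot"
    by (rule tendsto_sandwich[OF low _ lim1(1)[simplified] lim1(2)[simplified]])
       (use mid up in eventually_elim, simp)
  ultimately show ?thesis using that[OF W NW V NV VW] by blast
qed

text \<open>The asymptotics are inherited from the barriers. Since V may vanish far to the right,
  positivity needs an argument: Z is positive near minus infinity because \<open>lin\<close> is, and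
  the kernel, which averages over the past, carries the positivity of F(Z) forward.\<close>

theorem wave_exists:
  obtains Z Z' where "\<And>t. (Z has_real_derivative Z' t) (at t)"
    "\<And>t. (Z' has_real_derivative 2 * \<kappa> * Z' t - l * Z t + Z t powr q) (at t)"
    "\<And>t. 0 < Z t" "((\<lambda>t. Z t / lin t) \<longlongrightarrow> 1) at_bot"
    "\<And>c. ((\<lambda>t. Z (t + c) / Z t) \<longlongrightarrow> exp (\<theta> * c)) at_bot"
proof -
  obtain W V where WV: "adm W" "\<And>t. N W t \<le> W t" "adm V" "\<And>t. V t \<le> N V t" "\<And>t. V t \<le> W t"
    and lim: "((\<lambda>t. W t / lin t) \<longlongrightarrow> 1) at_bot" "((\<lambda>t. V t / lin t) \<longlongrightarrow> 1) at_bot"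
    by (rule barriers_exist) blast
  obtain Z where Z: "adm Z" "N Z = Z" "\<And>t. V t \<le> Z t" "\<And>t. Z t \<le> W t"
    by (rule fixed_point[OF WV]) blast
  define Z' where "Z' = T' (\<lambda>t. F (Z t))"
  have d1: "(Z has_real_derivative Z' t) (at t)" for t
    using N_derivative(1)[OF Z(1), of t] unfolding Z(2) Z'_def .
  have d2: "(Z' has_real_derivative 2 * \<kappa> * Z' t - l * Z t + Z t powr q) (at t)" for t
    using N_derivative(2)[OF Z(1), of t] unfolding Z(2) Z'_def[symmetric] by (simp add: F_def algebra_simps)
  have Zlin: "((\<lambda>t. Z t / lin t) \<longlongrightarrow> 1) at_bot"
    by (rule tendsto_sandwich[OF _ _ lim(2,1)]; use lin_pos in eventually_elim, simp add: divide_right_mono Z)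
  have pos: "0 < Z t" for t
  proof -
    have "eventually (\<lambda>s. 0 < Z s / lin s) at_bot" by (rule order_tendstoD(1)[OF Zlin]) simp
    then have "eventually (\<lambda>s. 0 < Z s / lin s \<and> 0 < lin s \<and> s < t) at_bot"
      using lin_pos eventually_gt_at_bot[of t] by eventually_elim simp
    then obtain s where "0 < Z s / lin s" "0 < lin s" and s: "s < t"
      using eventually_happens'[OF trivial_limit_at_bot_linorder] by blast
    then have Zs: "0 < Z s" by (simp add: zero_less_divide_iff)
    have Fs: "0 < F (Z s)"
    proof -
      have "Z s powr (q - 1) \<le> l" using Z(1) Zs q w0_powr(1) powr_mono2[of "q - 1" "Z s" w0] by (auto simp: adm_def)
      then have "Z s * Z s powr (q - 1) \<le> Z s * l" using Zs by (intro mult_left_mono) auto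
      moreover have "Z s powr q = Z s * Z s powr (q - 1)" using powr_add[of "Z s" 1 "q - 1"] Zs by simp
      moreover have "0 < K * Z s" using K_pos Zs by simp
      ultimately show ?thesis by (simp add: F_def algebra_simps)
    qed
    have nn: "0 \<le> F (Z r)" for r using F_bounds[of "Z r"] Z(1) by (auto simp: adm_def)
    have "0 < lag \<mu> (\<lambda>t. F (Z t)) t"
      by (rule lag_pos[OF roots(1) adm_F(1,3)[OF Z(1)] nn s Fs])
    moreover have "0 \<le> lag \<nu> (\<lambda>s. F (Z (- s))) (- t)"
      unfolding lag_def by (rule Bochner_Integration.integral_nonneg) (simp add: nn)
    ultimately have "0 < N Z t" unfolding T_def using roots(1,2) by (intro divide_pos_pos add_pos_nonneg) auto
    then show ?thesis unfolding Z(2) .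
  qed
  have shift: "((\<lambda>t. Z (t + c) / Z t) \<longlongrightarrow> exp (\<theta> * c)) at_bot" for c
  proof -
    have "filterlim (\<lambda>t::real. t + c) at_bot at_bot"
      unfolding filterlim_at_bot
    proof
      fix r show "eventually (\<lambda>t. t + c \<le> r) at_bot"
        using eventually_le_at_bot[of "r - c"] by eventually_elim simp
    qed
    then have "((\<lambda>t. Z (t + c) / lin (t + c)) \<longlongrightarrow> 1) at_bot"
      and ev: "eventually (\<lambda>t. 0 < lin (t + c)) at_bot"
      using filterlim_compose[OF Zlin] eventually_compose_filterlim[OF lin_pos] by blast+
    then have lim': "((\<lambda>t. (Z (t + c) / lin (t + c)) * (lin (t + c) / lin t) / (Z t / lin t)) \<longlongrightarrow> 1 * exp (\<theta> * c) / 1) at_bot"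
      by (intro tendsto_intros lin_shift Zlin) auto
    have "eventually (\<lambda>t. (Z (t + c) / lin (t + c)) * (lin (t + c) / lin t) / (Z t / lin t) = Z (t + c) / Z t) at_bot"
      using lin_pos ev by eventually_elim simp
    from Lim_transform_eventually[OF lim' this] show ?thesis by simp
  qed
  show ?thesis by (rule that[OF d1 d2 pos Zlin shift])
qed

end

section \<open>The equation on the cylinder\<close>

lemma sign_cases: "(e::real) * e = 1 \<Longrightarrow> e = 1 \<or> e = -1"
  by (metis mult_cancel_left1 square_eq_1_iff)

lemma compact_annulus:
  assumes "(e::real) * e = 1"
  shows "compact {x::'a::euclidean_space. x \<noteq> 0 \<and> \<alpha> \<le> e * ln (norm x) \<and> e * ln (norm x) \<le> \<beta>}"
proof -
  have *: "compact {x::'a. a \<le> norm x \<and> norm x \<le> b}" for a b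
  proof -
    have "closed ({x::'a. a \<le> norm x} \<inter> {x. norm x \<le> b})"
      by (intro closed_Int closed_Collect_le continuous_intros)
    moreover have "bounded ({x::'a. a \<le> norm x} \<inter> {x. norm x \<le> b})"
      by (auto simp: bounded_iff)
    ultimately show ?thesis by (simp add: compact_eq_bounded_closed Collect_conj_eq)
  qed
  have ln: "t \<le> ln (norm x) \<longleftrightarrow> exp t \<le> norm x" "ln (norm x) \<le> t \<longleftrightarrow> norm x \<le> exp t"
    if "x \<noteq> 0" for x :: 'a and t
    using that ln_ge_iff[of "norm x" t] ln_le_cancel_iff[of "norm x" "exp t"] by auto
  have nz: "x \<noteq> 0" if "exp t \<le> norm x" for x :: 'a and t
    using that exp_gt_zero[of t] by (auto simp del: exp_gt_zero)
  from sign_cases[OF assms] show ?thesis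
  proof
    assume e: "e = 1"
    have "{x::'a. x \<noteq> 0 \<and> \<alpha> \<le> e * ln (norm x) \<and> e * ln (norm x) \<le> \<beta>} = {x. exp \<alpha> \<le> norm x \<and> norm x \<le> exp \<beta>}"
      using ln nz[of \<alpha>] by (intro Collect_cong) (auto simp: e)
    then show ?thesis using * by simp
  next
    assume e: "e = -1"
    have "{x::'a. x \<noteq> 0 \<and> \<alpha> \<le> e * ln (norm x) \<and> e * ln (norm x) \<le> \<beta>} = {x. exp (-\<beta>) \<le> norm x \<and> norm x \<le> exp (-\<alpha>)}"
    proof (rule Collect_cong)
      fix x :: 'a
      have "e * ln (norm x) = - ln (norm x)" by (simp add: e)
      then show "(x \<noteq> 0 \<and> \<alpha> \<le> e * ln (norm x) \<and> e * ln (norm x) \<le> \<beta>) \<longleftrightarrow> exp (-\<beta>) \<le> norm x \<and> norm x \<le> exp (-\<alpha>)"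
        using nz[of "-\<beta>" x] ln(1)[of x "-\<beta>"] ln(2)[of x "-\<alpha>"] by (smt (verit))
    qed
    then show ?thesis using * by simp
  qed
qed

text \<open>This is the monotonicity of g^(q-1), the form in which the nonlinearity enters the
  comparison principle.\<close>

lemma powr_superlinear:
  fixes g w q :: real
  assumes "0 < w" "w < g" "1 < q"
  shows "w powr q * g < g powr q * w"
proof -
  have "w powr (q - 1) < g powr (q - 1)" using assms by (intro powr_less_mono2) auto
  then have "w powr (q - 1) * (w * g) < g powr (q - 1) * (w * g)" using assms by simp
  moreover have "w powr q = w powr (q - 1) * w" "g powr q = g powr (q - 1) * g"
    using assms powr_add[of w "q - 1" 1] powr_add[of g "q - 1" 1] by auto
  ultimately show ?thesis by (simp add: mult_ac)
qed

text \<open>The hypothesis of \<open>weak_comparison\<close> in terms of amplitudes: the linear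
  terms with D cancel in the cross products, and n and m stand for powers of |x|.\<close>

lemma rhs_less:
  fixes a c q :: real
  assumes "0 < a" "a < c" "1 < q" "0 < n" "0 < m" and "c powr q - D * c \<le> P" "Q \<le> a powr q - D * a"
  shows "n * Q * (m * c) < n * P * (m * a)"
proof -
  have "Q * c \<le> (a powr q - D * a) * c" using assms by (intro mult_right_mono) auto
  also have "\<dots> < (c powr q - D * c) * a" using powr_superlinear[OF assms(1-3)] by (simp add: algebra_simps)
  also have "\<dots> \<le> P * a" using assms by (intro mult_right_mono) auto
  finally have "n * m * (Q * c) < n * m * (P * a)" using assms(4,5) by simp
  then show ?thesis by (simp add: mult_ac)
qed

lemma powr_eq_mult: "0 < g \<Longrightarrow> g powr q = g * g powr (q - 1)" for g :: real
  using powr_add[of g 1 "q - 1"] by simp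

text \<open>The unweighted problem \<Delta>u + D |x|^(-2) u = |x|^B u^q. By scaling, |x|^(-\<sigma>)
  is its homogeneous profile; k and l are the coefficients of the equation for the amplitude w =
  |x|^\<sigma> u. The type argument fixes the dimension.\<close>

locale emden =
  fixes B D q \<sigma> k l :: real and space :: "'a::euclidean_space itself"
  assumes q: "1 < q" and sigma: "\<sigma> * (q - 1) = B + 2"
    and k: "k = \<sigma> - (real DIM('a) - 2) / 2"
    and l: "l = \<sigma>\<^sup>2 - (real DIM('a) - 2) * \<sigma> + D"
begin

definition solution :: "('a \<Rightarrow> real) \<Rightarrow> ('a \<Rightarrow> 'a) \<Rightarrow> bool" where
  "solution v dv \<longleftrightarrow> weak_lap (- {0}) v dv (\<lambda>x. norm x powr B * v x powr q - D * v x / (norm x)\<^sup>2) \<and>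
     (\<forall>x. x \<noteq> 0 \<longrightarrow> 0 < v x)"

definition amp :: "('a \<Rightarrow> real) \<Rightarrow> 'a \<Rightarrow> real" where
  "amp v x = norm x powr \<sigma> * v x"

text \<open>The radial function with amplitude g in the variable t = e ln |x|; for e = -1 this
  variable grows towards the origin.\<close>

definition cyl :: "real \<Rightarrow> (real \<Rightarrow> real) \<Rightarrow> 'a \<Rightarrow> real" where
  "cyl e g x = norm x powr (- \<sigma>) * g (e * ln (norm x))"

lemma amp_cyl: "x \<noteq> 0 \<Longrightarrow> amp (cyl e g) x = g (e * ln (norm x))"
  by (simp add: amp_def cyl_def powr_minus)

lemma of_amp: "x \<noteq> 0 \<Longrightarrow> v x = norm x powr (- \<sigma>) * amp v x"
  by (simp add: amp_def powr_minus)

text \<open>In the variable t the factor |x|^(-\<sigma>) is exp(-e \<sigma> t), so this is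
  \<open>weak_lap_radial\<close> for exp(-e \<sigma> t) g(t). The coefficient of g' becomes e (N - 2
  - 2\<sigma>) = -2 e k.\<close>

lemma weak_lap_cyl:
  assumes "open I" and e: "e * e = 1"
    and g': "\<And>t. t \<in> I \<Longrightarrow> (g has_real_derivative g' t) (at t)"
    and g'': "\<And>t. t \<in> I \<Longrightarrow> (g' has_real_derivative g'' t) (at t)"
    and cont: "continuous_on I g''"
  shows "\<exists>du. weak_lap {x. x \<noteq> 0 \<and> e * ln (norm x) \<in> I} (cyl e g) du
    (\<lambda>x. norm x powr (- \<sigma> - 2) * (g'' (e * ln (norm x)) - 2 * e * k * g' (e * ln (norm x)) + (l - D) * g (e * ln (norm x))))"
proof -
  define E where "E t = exp (- e * \<sigma> * t)" for t
  define f where "f t = E t * g t" for t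
  define f' where "f' t = E t * (g' t - e * \<sigma> * g t)" for t
  define f'' where "f'' t = E t * (g'' t - 2 * e * \<sigma> * g' t + \<sigma>\<^sup>2 * g t)" for t
  let ?S = "{x::'a. x \<noteq> 0 \<and> e * ln (norm x) \<in> I}"
  have E: "(E has_real_derivative (- e * \<sigma> * E t)) (at t)" for t
    unfolding E_def by (auto intro!: derivative_eq_intros)
  have f1: "(f has_real_derivative f' t) (at t)" if "t \<in> I" for t
    unfolding f_def f'_def
    by (rule derivative_eq_intros E g'[OF that] refl)+ (simp add: algebra_simps)
  have f2: "(f' has_real_derivative f'' t) (at t)" if "t \<in> I" for t
  proof -
    have "(f' has_real_derivative (- e * \<sigma> * E t * (g' t - e * \<sigma> * g t) + (g'' t - e * \<sigma> * g' t) * E t)) (at t)"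
      unfolding f'_def by (rule derivative_eq_intros E g'[OF that] g''[OF that] refl)+ simp
    moreover have "- e * \<sigma> * E t * (g' t - e * \<sigma> * g t) + (g'' t - e * \<sigma> * g' t) * E t = f'' t"
    proof -
      have "- e * \<sigma> * E t * (g' t - e * \<sigma> * g t) + (g'' t - e * \<sigma> * g' t) * E t
        = E t * (g'' t - 2 * e * \<sigma> * g' t + (e * e) * \<sigma>\<^sup>2 * g t)" by algebra
      then show ?thesis unfolding f''_def by (simp add: e)
    qed
    ultimately show ?thesis by simp
  qed
  have cg: "continuous_on I g" "continuous_on I g'"
    using g' g'' by (meson DERIV_isCont continuous_at_imp_continuous_on)+
  have cf: "continuous_on I f''"
    unfolding f''_def E_def by (intro continuous_intros cg cont)
  have *: "weak_lap ?S (\<lambda>x. f (e * ln (norm x))) (\<lambda>x. (e * f' (e * ln (norm x)) / (norm x)\<^sup>2) *\<^sub>R x)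
     (\<lambda>x. (f'' (e * ln (norm x)) + e * (real DIM('a) - 2) * f' (e * ln (norm x))) / (norm x)\<^sup>2)"
    by (rule weak_lap_radial[OF assms(1) e f1 f2 cf])
  have Ex: "E (e * ln (norm x)) = norm x powr (- \<sigma>)" if "x \<noteq> 0" for x :: 'a
  proof -
    have "- e * \<sigma> * (e * ln (norm x)) = - \<sigma> * ln (norm x) * (e * e)" by algebra
    then show ?thesis using that by (simp add: E_def powr_def e)
  qed
  have rhs: "(f'' s + e * (real DIM('a) - 2) * f' s) / (norm x)\<^sup>2 =
      norm x powr (- \<sigma> - 2) * (g'' s - 2 * e * k * g' s + (l - D) * g s)"
    if "x \<in> ?S" "s = e * ln (norm x)" for x s
  proof -
    have "f'' s + e * (real DIM('a) - 2) * f' s =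
       norm x powr (- \<sigma>) * (g'' s - 2 * e * \<sigma> * g' s + \<sigma>\<^sup>2 * g s + e * (real DIM('a) - 2) * (g' s - e * \<sigma> * g s))"
      using Ex[of x] that unfolding f''_def f'_def by (simp add: algebra_simps)
    also have "g'' s - 2 * e * \<sigma> * g' s + \<sigma>\<^sup>2 * g s + e * (real DIM('a) - 2) * (g' s - e * \<sigma> * g s)
      = g'' s - 2 * e * k * g' s + (\<sigma>\<^sup>2 - (e * e) * (real DIM('a) - 2) * \<sigma>) * g s"
      unfolding k by (simp add: field_simps)
    also have "\<dots> = g'' s - 2 * e * k * g' s + (l - D) * g s" unfolding e l by simp
    moreover have "norm x powr (- \<sigma> - 2) = norm x powr (- \<sigma>) / (norm x)\<^sup>2"
      using that by (simp add: powr_diff)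
    ultimately show ?thesis by simp
  qed
  have "weak_lap ?S (cyl e g) (\<lambda>x. (e * f' (e * ln (norm x)) / (norm x)\<^sup>2) *\<^sub>R x)
    (\<lambda>x. norm x powr (- \<sigma> - 2) * (g'' (e * ln (norm x)) - 2 * e * k * g' (e * ln (norm x)) + (l - D) * g (e * ln (norm x))))"
    by (rule weak_lap_cong[OF weak_lap_cong_fun[OF * open_radial[OF assms(1)]] rhs])
       (auto simp: cyl_def f_def Ex)
  then show ?thesis by blast
qed

lemma solution_rhs:
  assumes "x \<noteq> 0" "0 < v x"
  shows "norm x powr B * v x powr q - D * v x / (norm x)\<^sup>2 =
    norm x powr (- \<sigma> - 2) * (amp v x powr q - D * amp v x)"
proof -
  let ?n = "norm x"
  have n: "?n > 0" using assms by simp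
  have "?n powr (- \<sigma> - 2) * amp v x powr q = ?n powr (- \<sigma> - 2) * (?n powr (\<sigma> * q) * v x powr q)"
    using assms by (simp add: amp_def powr_mult powr_powr)
  also have "\<dots> = ?n powr (- \<sigma> - 2 + \<sigma> * q) * v x powr q" by (simp add: powr_add)
  also have "- \<sigma> - 2 + \<sigma> * q = B" using sigma by (simp add: algebra_simps)
  finally have 1: "?n powr (- \<sigma> - 2) * amp v x powr q = ?n powr B * v x powr q" .
  have "?n powr (- \<sigma> - 2) * (D * amp v x) = D * (?n powr (- \<sigma> - 2) * ?n powr \<sigma>) * v x" by (simp add: amp_def)
  also have "?n powr (- \<sigma> - 2) * ?n powr \<sigma> = ?n powr (-2)" by (simp add: powr_add[symmetric])
  also have "?n powr (-2) = 1 / ?n\<^sup>2" using n by (simp add: powr_minus inverse_eq_divide)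
  finally have 2: "?n powr (- \<sigma> - 2) * (D * amp v x) = D * v x / ?n\<^sup>2" by simp
  show ?thesis using 1 2 by (simp add: right_diff_distrib)
qed

lemma solutionD:
  assumes "solution v dv"
  shows "weak_lap (- {0}) v dv (\<lambda>x. norm x powr (- \<sigma> - 2) * (amp v x powr q - D * amp v x))"
    "\<And>x. x \<noteq> 0 \<Longrightarrow> 0 < v x" "\<And>x. x \<noteq> 0 \<Longrightarrow> 0 < amp v x" "continuous_on (- {0}) v" "continuous_on (- {0}) (amp v)"
proof -
  have w: "weak_lap (- {0}) v dv (\<lambda>x. norm x powr B * v x powr q - D * v x / (norm x)\<^sup>2)"
    using assms unfolding solution_def by blast
  show p: "\<And>x. x \<noteq> 0 \<Longrightarrow> 0 < v x" using assms unfolding solution_def by blast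
  then show "\<And>x. x \<noteq> 0 \<Longrightarrow> 0 < amp v x" by (simp add: amp_def)
  show "weak_lap (- {0}) v dv (\<lambda>x. norm x powr (- \<sigma> - 2) * (amp v x powr q - D * amp v x))"
    by (rule weak_lap_cong[OF w]) (simp add: solution_rhs p)
  show c: "continuous_on (- {0}) v" by (rule weak_lap_continuous[OF w])
  show "continuous_on (- {0}) (amp v)" unfolding amp_def by (intro continuous_intros c) auto
qed

lemma solution_cyl:
  assumes e: "e * e = 1"
    and g': "\<And>t. (g has_real_derivative g' t) (at t)"
    and g'': "\<And>t. (g' has_real_derivative g'' t) (at t)"
    and ode: "\<And>t. g'' t - 2 * e * k * g' t + l * g t - g t powr q = 0"
    and pos: "\<And>t. 0 < g t"
  shows "\<exists>dv. solution (cyl e g) dv"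
proof -
  have cg: "continuous_on UNIV g" "continuous_on UNIV g'"
    using g' g'' by (meson DERIV_isCont continuous_at_imp_continuous_on)+
  have g''eq: "g'' = (\<lambda>t. 2 * e * k * g' t - l * g t + g t powr q)" using ode by (simp add: fun_eq_iff algebra_simps)
  have c: "continuous_on UNIV g''" unfolding g''eq using pos by (intro continuous_intros cg) (auto simp: less_imp_neq[symmetric])
  have cp: "0 < cyl e g x" if "x \<noteq> 0" for x using that pos by (simp add: cyl_def)
  obtain du where du: "weak_lap {x. x \<noteq> 0 \<and> e * ln (norm x) \<in> UNIV} (cyl e g) du
    (\<lambda>x. norm x powr (- \<sigma> - 2) * (g'' (e * ln (norm x)) - 2 * e * k * g' (e * ln (norm x)) + (l - D) * g (e * ln (norm x))))"
    using weak_lap_cyl[OF open_UNIV e g' g'' c] by blast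
  have "norm x powr (- \<sigma> - 2) * (g'' s - 2 * e * k * g' s + (l - D) * g s) = norm x powr B * cyl e g x powr q - D * cyl e g x / (norm x)\<^sup>2"
    if "x \<noteq> 0" "s = e * ln (norm x)" for x :: 'a and s
  proof -
    have "g'' s - 2 * e * k * g' s + (l - D) * g s = g s powr q - D * g s" using ode[of s] by (simp add: algebra_simps)
    then show ?thesis using solution_rhs[of x "cyl e g", OF that(1) cp[OF that(1)]] amp_cyl[OF that(1)] that(2) by simp
  qed
  then have "weak_lap {x. x \<noteq> 0 \<and> e * ln (norm x) \<in> UNIV} (cyl e g) du (\<lambda>x. norm x powr B * cyl e g x powr q - D * cyl e g x / (norm x)\<^sup>2)"
    by (intro weak_lap_cong[OF du]) auto
  moreover have "{x::'a. x \<noteq> 0 \<and> e * ln (norm x) \<in> UNIV} = - {0}" by auto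
  ultimately show ?thesis using cp unfolding solution_def by auto
qed

lemma compact_annulus_subset:
  assumes e: "e * e = 1" and "continuous_on (- {0::'a}) (f :: 'a \<Rightarrow> real)" and g: "continuous_on {\<alpha>..\<beta>} g"
  shows "compact {x. x \<noteq> 0 \<and> \<alpha> \<le> e * ln (norm x) \<and> e * ln (norm x) \<le> \<beta> \<and> f x \<le> g (e * ln (norm x))}" (is "compact ?K")
    and "compact {x. x \<noteq> 0 \<and> \<alpha> \<le> e * ln (norm x) \<and> e * ln (norm x) \<le> \<beta> \<and> g (e * ln (norm x)) \<le> f x}" (is "compact ?K'")
proof -
  let ?A = "{x::'a. x \<noteq> 0 \<and> \<alpha> \<le> e * ln (norm x) \<and> e * ln (norm x) \<le> \<beta>}"
  have A: "compact ?A" by (rule compact_annulus[OF e])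
  have "continuous_on ?A (\<lambda>x. g (e * ln (norm x)))" by (rule continuous_on_radial[OF g]) auto
  moreover have "continuous_on ?A f" by (rule continuous_on_subset[OF assms(2)]) auto
  ultimately have c: "continuous_on ?A (\<lambda>x. g (e * ln (norm x)) - f x)" by (intro continuous_intros)
  have sub: "compact {x \<in> ?A. F x \<ge> 0}" if "continuous_on ?A F" for F :: "'a \<Rightarrow> real"
  proof -
    have "closed (?A \<inter> F -` {0..})"
      by (intro continuous_closed_preimage that compact_imp_closed A closed_atLeast)
    moreover have "bounded (?A \<inter> F -` {0..})" using compact_imp_bounded[OF A] by (rule bounded_subset) auto
    moreover have "?A \<inter> F -` {0..} = {x \<in> ?A. F x \<ge> 0}" by auto
    ultimately show ?thesis by (simp add: compact_eq_bounded_closed)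
  qed
  have "compact {x \<in> ?A. g (e * ln (norm x)) - f x \<ge> 0}" by (rule sub[OF c])
  moreover have "{x \<in> ?A. g (e * ln (norm x)) - f x \<ge> 0} = ?K" by auto
  ultimately show "compact ?K" by simp
  have "compact {x \<in> ?A. - (g (e * ln (norm x)) - f x) \<ge> 0}" by (rule sub) (intro continuous_intros c)
  moreover have "{x \<in> ?A. - (g (e * ln (norm x)) - f x) \<ge> 0} = ?K'" by auto
  ultimately show "compact ?K'" by simp
qed

section \<open>Comparison with radial barriers\<close>

text \<open>Strict inequality on the two bounding spheres makes the contact set a compact subset of
  the open annulus. The barrier may change sign, and its differential inequality is asked only where
  it exceeds the amplitude, so that lower bounds already known for v can be used there.\<close>

lemma barrier_sub:
  assumes v: "solution v dv" and e: "e * e = 1"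
    and cg: "continuous_on {\<alpha>..\<beta>} g"
    and g': "\<And>t. \<alpha> < t \<Longrightarrow> t < \<beta> \<Longrightarrow> (g has_real_derivative g' t) (at t)"
    and g'': "\<And>t. \<alpha> < t \<Longrightarrow> t < \<beta> \<Longrightarrow> (g' has_real_derivative g'' t) (at t)"
    and cont: "continuous_on {\<alpha><..<\<beta>} g''"
    and sub: "\<And>x t. x \<noteq> 0 \<Longrightarrow> t = e * ln (norm x) \<Longrightarrow> \<alpha> < t \<Longrightarrow> t < \<beta> \<Longrightarrow> amp v x < g t \<Longrightarrow>
        0 \<le> g'' t - 2 * e * k * g' t + l * g t - g t powr q"
    and bd: "\<And>x. x \<noteq> 0 \<Longrightarrow> e * ln (norm x) = \<alpha> \<Longrightarrow> g \<alpha> < amp v x"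
      "\<And>x. x \<noteq> 0 \<Longrightarrow> e * ln (norm x) = \<beta> \<Longrightarrow> g \<beta> < amp v x"
    and x: "x \<noteq> 0" "\<alpha> \<le> e * ln (norm x)" "e * ln (norm x) \<le> \<beta>"
  shows "g (e * ln (norm x)) \<le> amp v x"
proof -
  let ?I = "{\<alpha><..<\<beta>}"
  let ?S = "{x::'a. x \<noteq> 0 \<and> e * ln (norm x) \<in> ?I}"
  let ?K = "{x::'a. x \<noteq> 0 \<and> \<alpha> \<le> e * ln (norm x) \<and> e * ln (norm x) \<le> \<beta> \<and> amp v x \<le> g (e * ln (norm x))}"
  note V = solutionD[OF v]
  obtain du where du: "weak_lap ?S (cyl e g) du
    (\<lambda>x. norm x powr (- \<sigma> - 2) * (g'' (e * ln (norm x)) - 2 * e * k * g' (e * ln (norm x)) + (l - D) * g (e * ln (norm x))))"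
    using weak_lap_cyl[OF open_greaterThanLessThan e, of \<alpha> \<beta> g g' g''] g' g'' cont by force
  have dv: "weak_lap ?S v dv (\<lambda>x. norm x powr (- \<sigma> - 2) * (amp v x powr q - D * amp v x))"
    by (rule weak_lap_subset[OF V(1)]) auto
  have K: "compact ?K" by (rule compact_annulus_subset[OF e V(5) cg])
  have KS: "?K \<subseteq> ?S"
  proof
    fix x assume "x \<in> ?K"
    then show "x \<in> ?S" using bd[of x] by (auto simp: order.strict_iff_order)
  qed
  have iff: "cyl e g y \<le> v y \<longleftrightarrow> g (e * ln (norm y)) \<le> amp v y" if "y \<noteq> 0" for y
    using that of_amp[of y v] by (simp add: cyl_def)
  show ?thesis
  proof (cases "x \<in> ?S")
    case True
    have "cyl e g x \<le> v x"
    proof (rule weak_comparison[OF open_radial[OF open_greaterThanLessThan] du dv K KS _ _ _ True])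
      show "cyl e g y \<le> v y" if "y \<in> ?S - ?K" for y using that iff[of y] by auto
      show "0 < v y" if "y \<in> ?S" for y using that V(2)[of y] by auto
      fix y assume y: "y \<in> ?S" and lt: "v y < cyl e g y"
      define t where "t = e * ln (norm y)"
      have y0: "y \<noteq> 0" using y by auto
      have w: "0 < amp v y" "amp v y < g t" using lt iff[OF y0] V(3)[OF y0] by (auto simp: t_def)
      have c: "cyl e g y = norm y powr (- \<sigma>) * g t" by (simp add: cyl_def t_def)
      show "norm y powr (- \<sigma> - 2) * (amp v y powr q - D * amp v y) * cyl e g y
         < norm y powr (- \<sigma> - 2) * (g'' (e * ln (norm y)) - 2 * e * k * g' (e * ln (norm y)) + (l - D) * g (e * ln (norm y))) * v y"
        unfolding of_amp[OF y0, of v] c t_def[symmetric]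
        by (rule rhs_less[OF w q]) (use sub[OF y0 t_def] y y0 w(2) in \<open>auto simp: t_def algebra_simps\<close>)
    qed
    then show ?thesis using iff[OF x(1)] by simp
  next
    case False
    then have "e * ln (norm x) = \<alpha> \<or> e * ln (norm x) = \<beta>" using x by auto
    then show ?thesis using bd[of x] x by (auto intro: less_imp_le)
  qed
qed

text \<open>Now the barrier is the denominator of Picone's quotient, hence it must be
  positive.\<close>

lemma barrier_super:
  assumes v: "solution v dv" and e: "e * e = 1"
    and cg: "continuous_on {\<alpha>..\<beta>} g"
    and g': "\<And>t. \<alpha> < t \<Longrightarrow> t < \<beta> \<Longrightarrow> (g has_real_derivative g' t) (at t)"
    and g'': "\<And>t. \<alpha> < t \<Longrightarrow> t < \<beta> \<Longrightarrow> (g' has_real_derivative g'' t) (at t)"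
    and cont: "continuous_on {\<alpha><..<\<beta>} g''"
    and pos: "\<And>t. \<alpha> < t \<Longrightarrow> t < \<beta> \<Longrightarrow> 0 < g t"
    and super: "\<And>t. \<alpha> < t \<Longrightarrow> t < \<beta> \<Longrightarrow> g'' t - 2 * e * k * g' t + l * g t - g t powr q \<le> 0"
    and bd: "\<And>x. x \<noteq> 0 \<Longrightarrow> e * ln (norm x) = \<alpha> \<Longrightarrow> amp v x < g \<alpha>"
      "\<And>x. x \<noteq> 0 \<Longrightarrow> e * ln (norm x) = \<beta> \<Longrightarrow> amp v x < g \<beta>"
    and x: "x \<noteq> 0" "\<alpha> \<le> e * ln (norm x)" "e * ln (norm x) \<le> \<beta>"
  shows "amp v x \<le> g (e * ln (norm x))"
proof -
  let ?I = "{\<alpha><..<\<beta>}"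
  let ?S = "{x::'a. x \<noteq> 0 \<and> e * ln (norm x) \<in> ?I}"
  let ?K = "{x::'a. x \<noteq> 0 \<and> \<alpha> \<le> e * ln (norm x) \<and> e * ln (norm x) \<le> \<beta> \<and> g (e * ln (norm x)) \<le> amp v x}"
  note V = solutionD[OF v]
  obtain du where du: "weak_lap ?S (cyl e g) du
    (\<lambda>x. norm x powr (- \<sigma> - 2) * (g'' (e * ln (norm x)) - 2 * e * k * g' (e * ln (norm x)) + (l - D) * g (e * ln (norm x))))"
    using weak_lap_cyl[OF open_greaterThanLessThan e, of \<alpha> \<beta> g g' g''] g' g'' cont by force
  have dv: "weak_lap ?S v dv (\<lambda>x. norm x powr (- \<sigma> - 2) * (amp v x powr q - D * amp v x))"
    by (rule weak_lap_subset[OF V(1)]) auto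
  have K: "compact ?K" by (rule compact_annulus_subset[OF e V(5) cg])
  have KS: "?K \<subseteq> ?S"
  proof
    fix x assume "x \<in> ?K"
    then show "x \<in> ?S" using bd[of x] by (auto simp: order.strict_iff_order)
  qed
  have iff: "v y \<le> cyl e g y \<longleftrightarrow> amp v y \<le> g (e * ln (norm y))" if "y \<noteq> 0" for y
    using that of_amp[of y v] by (simp add: cyl_def)
  show ?thesis
  proof (cases "x \<in> ?S")
    case True
    have "v x \<le> cyl e g x"
    proof (rule weak_comparison[OF open_radial[OF open_greaterThanLessThan] dv du K KS _ _ _ True])
      show "v y \<le> cyl e g y" if "y \<in> ?S - ?K" for y using that iff[of y] by auto
      show "0 < cyl e g y" if "y \<in> ?S" for y using that pos by (auto simp: cyl_def)
      fix y assume y: "y \<in> ?S" and lt: "cyl e g y < v y"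
      define t where "t = e * ln (norm y)"
      have y0: "y \<noteq> 0" using y by auto
      have w: "0 < g t" "g t < amp v y" using lt iff[OF y0] pos y by (auto simp: t_def)
      have c: "cyl e g y = norm y powr (- \<sigma>) * g t" by (simp add: cyl_def t_def)
      show "norm y powr (- \<sigma> - 2) * (g'' (e * ln (norm y)) - 2 * e * k * g' (e * ln (norm y)) + (l - D) * g (e * ln (norm y))) * v y
         < norm y powr (- \<sigma> - 2) * (amp v y powr q - D * amp v y) * cyl e g y"
        unfolding of_amp[OF y0, of v] c t_def[symmetric]
        by (rule rhs_less[OF w q]) (use super[of t] y y0 in \<open>auto simp: t_def algebra_simps\<close>)
    qed
    then show ?thesis using iff[OF x(1)] by simp
  next
    case False
    then have "e * ln (norm x) = \<alpha> \<or> e * ln (norm x) = \<beta>" using x by auto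
    then show ?thesis using bd[of x] x by (auto intro: less_imp_le)
  qed
qed

section \<open>A priori bounds\<close>

lemma l_rhs_pos: "0 < g \<Longrightarrow> l * g - g powr q = g * (l - g powr (q - 1))" for g
  using powr_eq_mult[of g q] by (simp add: algebra_simps)

lemma amp_bounded:
  assumes "solution v dv" "e * e = 1"
  obtains M where "0 < M" "\<And>x. x \<noteq> 0 \<Longrightarrow> \<alpha> \<le> e * ln (norm x) \<Longrightarrow> e * ln (norm x) \<le> \<beta> \<Longrightarrow> amp v x < M"
proof -
  let ?A = "{x::'a. x \<noteq> 0 \<and> \<alpha> \<le> e * ln (norm x) \<and> e * ln (norm x) \<le> \<beta>}"
  have "continuous_on ?A (amp v)" by (rule continuous_on_subset[OF solutionD(5)[OF assms(1)]]) auto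
  then have "compact (amp v ` ?A)"
    by (rule compact_continuous_image[OF _ compact_annulus[OF assms(2)]])
  then have "bounded (amp v ` ?A)" by (rule compact_imp_bounded)
  then obtain M where "\<forall>y\<in>amp v ` ?A. norm y \<le> M" unfolding bounded_iff ..
  then have M: "norm (amp v x) \<le> M" if "x \<in> ?A" for x using that by blast
  show ?thesis
  proof (rule that[of "\<bar>M\<bar> + 1"])
    show "amp v x < \<bar>M\<bar> + 1" if "x \<noteq> 0" "\<alpha> \<le> e * ln (norm x)" "e * ln (norm x) \<le> \<beta>" for x
      using M[of x] that by simp
  qed simp
qed

lemma amp_lower_bound:
  assumes "solution v dv" "e * e = 1"
  obtains m where "0 < m" "\<And>x. x \<noteq> 0 \<Longrightarrow> e * ln (norm x) = T \<Longrightarrow> m \<le> amp v x"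
proof -
  let ?A = "{x::'a. x \<noteq> 0 \<and> T \<le> e * ln (norm x) \<and> e * ln (norm x) \<le> T}"
  have c: "compact ?A" by (rule compact_annulus[OF assms(2)])
  have "continuous_on ?A (amp v)" by (rule continuous_on_subset[OF solutionD(5)[OF assms(1)]]) auto
  then show ?thesis
  proof (cases "?A = {}")
    case True
    show ?thesis
    proof (rule that[of 1])
      show "1 \<le> amp v x" if "x \<noteq> 0" "e * ln (norm x) = T" for x
      proof -
        have "x \<in> ?A" using that by simp
        then show ?thesis using True by blast
      qed
    qed simp
  next
    case False
    then obtain y where y: "y \<in> ?A" "\<And>x. x \<in> ?A \<Longrightarrow> amp v y \<le> amp v x"
      using continuous_attains_inf[OF c False] \<open>continuous_on ?A (amp v)\<close> by blast
    show ?thesis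
      by (rule that[of "amp v y"]) (use y solutionD(3)[OF assms(1)] in auto)
  qed
qed

text \<open>Keller--Osserman bound: \<open>K cos(\<mu>(t - t\<^sub>0))\<^bsup>-p\<^esup>\<close> with \<open>p = 2/(q - 1)\<close> blows up at the ends of
  its interval and is a supersolution for small \<open>\<mu>\<close>.\<close>

lemma amp_le:
  assumes v: "solution v dv" and K: "0 < K" "l < K powr (q - 1)" and x0: "x0 \<noteq> 0"
  shows "amp v x0 \<le> K"
proof -
  \<comment> \<open>Then p q = p + 2, so that g'' and g^q blow up at the same rate.\<close>
  define p where "p = 2 / (q - 1)"
  define \<delta> where "\<delta> = K powr (q - 1) - max l 0"
  define c where "c = p * (p + 1) + 2 * \<bar>k\<bar> * p"
  \<comment> \<open>After division by K cos^(-p-2), the derivative terms are at most \<mu> c, and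
    \<delta> is the margin of K^(q-1) over max l 0.\<close>
  define \<mu> where "\<mu> = min 1 (\<delta> / c)"
  have p: "p > 0" using q by (simp add: p_def)
  have d: "\<delta> > 0" using K by (auto simp: \<delta>_def)
  have c: "c > 0" unfolding c_def using p by (intro add_pos_nonneg) auto
  have mu: "0 < \<mu>" "\<mu> \<le> 1" "\<mu> * c \<le> \<delta>"
    using d c by (auto simp: \<mu>_def min_def field_simps)
  define t0 where "t0 = ln (norm x0)"
  define C where "C t = cos (\<mu> * (t - t0))" for t
  define Sn where "Sn t = sin (\<mu> * (t - t0))" for t
  obtain M where M: "0 < M" "\<And>x. x \<noteq> 0 \<Longrightarrow> t0 - pi / (2 * \<mu>) \<le> 1 * ln (norm x) \<Longrightarrow> 1 * ln (norm x) \<le> t0 + pi / (2 * \<mu>) \<Longrightarrow> amp v x < M"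
    using amp_bounded[OF v, of 1 "t0 - pi / (2 * \<mu>)" "t0 + pi / (2 * \<mu>)"] by auto
  \<comment> \<open>The barrier is used only up to the points where its cosine equals b: its value K
    b^(-p) = M + K exceeds the bound M for the amplitude there, which gives the strict inequality at
    the ends.\<close>
  define b where "b = (M / K + 1) powr (- 1 / p)"
  have b: "0 < b" "b < 1"
  proof -
    have "M / K > 0" using M(1) K(1) by simp
    then show "0 < b" "b < 1" using p by (auto simp: b_def powr_less_one)
  qed
  have Kb: "K * b powr (- p) > M"
  proof -
    have "M / K > 0" using M(1) K(1) by simp
    then have "b powr (- p) = M / K + 1" using p by (simp add: b_def powr_powr)
    then show ?thesis using K(1) by (simp add: distrib_left)
  qed
  define T where "T = arccos b / \<mu>"
  have T: "0 < T" "T < pi / (2 * \<mu>)" "cos (\<mu> * T) = b" "\<mu> * T < pi / 2"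
  proof -
    have "0 < arccos b" "arccos b < pi / 2"
      using arccos_less_mono[of 1 b] arccos_less_mono[of b 0] b by auto
    then show "0 < T" "T < pi / (2 * \<mu>)" "cos (\<mu> * T) = b" "\<mu> * T < pi / 2"
      using mu b by (auto simp: T_def field_simps)
  qed
  have Cpos: "C t > 0" if "t0 - T \<le> t" "t \<le> t0 + T" for t
  proof -
    have "\<bar>\<mu> * (t - t0)\<bar> \<le> \<mu> * T" using that mu by (auto simp: abs_mult intro!: mult_left_mono)
    then show ?thesis unfolding C_def using T(4) by (intro cos_gt_zero_pi) auto
  qed
  have Cnz: "C t \<noteq> 0" if "t0 - T \<le> t" "t \<le> t0 + T" for t using Cpos[OF that] by simp
  have dC: "(C has_real_derivative (- \<mu> * Sn t)) (at t)" "(Sn has_real_derivative (\<mu> * C t)) (at t)" for t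
    unfolding C_def Sn_def by (auto intro!: derivative_eq_intros)
  define g where "g t = K * C t powr (- p)" for t
  define g' where "g' t = K * p * \<mu> * Sn t * C t powr (- p - 1)" for t
  define g'' where "g'' t = K * p * \<mu>\<^sup>2 * ((p + 1) - p * (C t)\<^sup>2) * C t powr (- p - 2)" for t
  have Cc: "continuous_on A C" for A unfolding C_def by (intro continuous_intros)
  have sc: "(Sn t)\<^sup>2 = 1 - (C t)\<^sup>2" for t unfolding Sn_def C_def by (simp add: sin_squared_eq)
  have pw: "C t powr (- p - 1) = C t powr (- p - 2) * C t" "C t powr (- p) = C t powr (- p - 2) * (C t)\<^sup>2"
    if "C t > 0" for t
  proof -
    have "- p - 1 = - p - 2 + 1" "- p = - p - 2 + 2" by auto
    then have "C t powr (- p - 1) = C t powr (- p - 2) * C t powr 1" "C t powr (- p) = C t powr (- p - 2) * C t powr 2"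
      by (metis powr_add)+
    then show "C t powr (- p - 1) = C t powr (- p - 2) * C t" "C t powr (- p) = C t powr (- p - 2) * (C t)\<^sup>2"
      using that by simp_all
  qed
  have "amp v x0 \<le> g (1 * ln (norm x0))"
  proof (rule barrier_super[OF v, of 1 "t0 - T" "t0 + T" g g' g''])
    show "continuous_on {t0 - T..t0 + T} g"
      unfolding g_def by (intro continuous_intros Cc) (use Cnz in auto)
    show "continuous_on {t0 - T<..<t0 + T} g''"
      unfolding g''_def by (intro continuous_intros Cc) (use Cnz in auto)
    fix t assume t: "t0 - T < t" "t < t0 + T"
    then have C: "C t > 0" using Cpos by auto
    show "(g has_real_derivative g' t) (at t)"
      unfolding g_def g'_def
      by (rule derivative_eq_intros has_real_derivative_powr' DERIV_fun_powr[OF dC(1) C] refl)+ (simp add: mult_ac)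
    have "(g' has_real_derivative (K * p * \<mu> * (\<mu> * C t * C t powr (- p - 1) + ((- p - 1) * C t powr (- p - 1 - 1) * (- \<mu> * Sn t)) * Sn t))) (at t)"
      unfolding g'_def
      by (rule derivative_eq_intros dC(2) DERIV_fun_powr[OF dC(1) C] refl)+ (simp add: algebra_simps)
    moreover have "K * p * \<mu> * (\<mu> * C t * C t powr (- p - 1) + ((- p - 1) * C t powr (- p - 1 - 1) * (- \<mu> * Sn t)) * Sn t) = g'' t"
    proof -
      have "K * p * \<mu> * (\<mu> * C t * C t powr (- p - 1) + ((- p - 1) * C t powr (- p - 1 - 1) * (- \<mu> * Sn t)) * Sn t)
        = K * p * \<mu>\<^sup>2 * C t powr (- p - 2) * ((C t)\<^sup>2 + (p + 1) * (Sn t)\<^sup>2)"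
        unfolding pw(1)[OF C] by (simp add: power2_eq_square algebra_simps)
      then show ?thesis unfolding sc g''_def by (simp add: algebra_simps)
    qed
    ultimately show "(g' has_real_derivative g'' t) (at t)" by simp
    show gpos: "0 < g t" using K C by (simp add: g_def)
    define P where "P = C t powr (- p - 2)"
    have P: "P > 0" using C by (simp add: P_def)
    have "g t powr q = K powr q * C t powr (- p * q)" using K C by (simp add: g_def powr_mult powr_powr)
    also have "- p * q = - p - 2" using q by (simp add: p_def field_simps)
    also have "K powr q = K * K powr (q - 1)" using powr_eq_mult K by blast
    finally have gq: "g t powr q = K * P * K powr (q - 1)" by (simp add: P_def)
    have C1: "(C t)\<^sup>2 \<le> 1" "C t \<le> 1" "\<bar>Sn t\<bar> \<le> 1" unfolding C_def Sn_def by (auto simp: power_le_one_iff abs_square_le_1)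
    have m2: "\<mu>\<^sup>2 \<le> \<mu>" using mu by (simp add: power2_eq_square mult_left_le)
    have "g'' t - 2 * 1 * k * g' t + l * g t - g t powr q
       = K * P * (p * \<mu>\<^sup>2 * ((p + 1) - p * (C t)\<^sup>2) - 2 * k * p * \<mu> * (Sn t * C t) + l * (C t)\<^sup>2 - K powr (q - 1))"
      unfolding gq unfolding g_def g'_def g''_def pw[OF C] P_def[symmetric] by (simp add: algebra_simps)
    also have "\<dots> \<le> 0"
    proof -
      have "p * \<mu>\<^sup>2 * ((p + 1) - p * (C t)\<^sup>2) \<le> p * \<mu> * (p + 1)"
      proof (rule mult_mono)
        have "0 \<le> p * (C t)\<^sup>2" "p * (C t)\<^sup>2 \<le> p * 1" using p by (auto intro!: mult_left_mono C1)
        then show "(p + 1) - p * (C t)\<^sup>2 \<le> p + 1" "0 \<le> (p + 1) - p * (C t)\<^sup>2" by linarith+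
      qed (use p m2 mu in auto)
      moreover have "\<bar>Sn t * C t\<bar> \<le> 1" using C1 C by (simp add: abs_mult mult_le_one)
      then have "\<bar>2 * k * p * \<mu> * (Sn t * C t)\<bar> \<le> 2 * \<bar>k\<bar> * p * \<mu> * 1"
        unfolding abs_mult using p mu by (intro mult_mono) auto
      moreover have "l * (C t)\<^sup>2 \<le> max l 0"
        using mult_right_mono[of l "max l 0" "(C t)\<^sup>2"] mult_left_mono[OF C1(1), of "max l 0"] by auto
      moreover have "p * \<mu> * (p + 1) + 2 * \<bar>k\<bar> * p * \<mu> = \<mu> * c" by (simp add: c_def algebra_simps)
      ultimately have "p * \<mu>\<^sup>2 * ((p + 1) - p * (C t)\<^sup>2) - 2 * k * p * \<mu> * (Sn t * C t) + l * (C t)\<^sup>2 - K powr (q - 1) \<le> 0"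
        using mu(3) unfolding \<delta>_def by linarith
      then show ?thesis using K(1) P by (simp add: mult_nonneg_nonpos)
    qed
    finally show "g'' t - 2 * 1 * k * g' t + l * g t - g t powr q \<le> 0" .
  next
    have "C (t0 - T) = b" "C (t0 + T) = b" using T(3) by (auto simp: C_def)
    then have "g (t0 - T) > M" "g (t0 + T) > M" using Kb by (auto simp: g_def)
    moreover have "amp v x < M" if "x \<noteq> 0" "1 * ln (norm x) = t0 - T \<or> 1 * ln (norm x) = t0 + T" for x
      using M(2)[OF that(1)] that(2) T by auto
    ultimately have *: "amp v x < g (t0 - T) \<and> amp v x < g (t0 + T)" if "x \<noteq> 0" "1 * ln (norm x) = t0 - T \<or> 1 * ln (norm x) = t0 + T" for x
      using that by (meson less_trans)
    show "amp v x < g (t0 - T)" if "x \<noteq> 0" "1 * ln (norm x) = t0 - T" for x using *[of x] that by blast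
    show "amp v x < g (t0 + T)" if "x \<noteq> 0" "1 * ln (norm x) = t0 + T" for x using *[of x] that by blast
  qed (use x0 T in \<open>auto simp: t0_def\<close>)
  moreover have "g (1 * ln (norm x0)) = K" by (simp add: g_def C_def t0_def)
  ultimately show ?thesis by simp
qed

text \<open>For l \<le> 0 the bound of \<open>amp_le\<close> holds with every K > 0, in particular
  with half of the amplitude at a point.\<close>

lemma solution_imp_l_pos:
  assumes v: "solution v dv" shows "0 < l"
proof (rule ccontr)
  assume "\<not> 0 < l"
  obtain x0 :: 'a where x0: "x0 \<noteq> 0" using nonzero_Basis nonempty_Basis by blast
  have "0 < (amp v x0 / 2) powr (q - 1)" using solutionD(3)[OF v x0] by simp
  then have "amp v x0 \<le> amp v x0 / 2"
    by (intro amp_le[OF v _ _ x0]) (use solutionD(3)[OF v x0] \<open>\<not> 0 < l\<close> in linarith)+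
  then show False using solutionD(3)[OF v x0] by simp
qed

definition w0 :: real where "w0 = l powr (1 / (q - 1))"

lemma w0_powr: "0 < l \<Longrightarrow> w0 powr (q - 1) = l" using q by (simp add: w0_def powr_powr)

lemma powr_le_l_iff:
  assumes "0 < l" "0 < g" shows "g powr (q - 1) \<le> l \<longleftrightarrow> g \<le> w0" "g powr (q - 1) < l \<longleftrightarrow> g < w0"
proof -
  have "w0 > 0" using assms by (simp add: w0_def)
  then show "g powr (q - 1) \<le> l \<longleftrightarrow> g \<le> w0" "g powr (q - 1) < l \<longleftrightarrow> g < w0"
    using w0_powr[OF assms(1)] powr_less_mono2[of "q - 1" g w0] powr_less_mono2[of "q - 1" w0 g] q assms
    by (smt (verit) less_imp_le)+
qed

lemma amp_le_w0:
  assumes v: "solution v dv" and x: "x \<noteq> 0"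
  shows "amp v x \<le> w0"
proof (rule field_le_epsilon)
  fix \<epsilon> :: real assume "0 < \<epsilon>"
  have l: "0 < l" by (rule solution_imp_l_pos[OF v])
  have "0 \<le> w0" by (simp add: w0_def)
  show "amp v x \<le> w0 + \<epsilon>"
    by (rule amp_le[OF v _ _ x])
       (use powr_le_l_iff[OF l, of "w0 + \<epsilon>"] \<open>0 < \<epsilon>\<close> \<open>0 \<le> w0\<close> in auto)
qed

text \<open>Where the barrier exceeds the amplitude it lies between m and w1, and there the reaction
  l g - g^q is at least m (l - w1^(q-1)); this beats the derivative terms, which are small with
  \<delta>. A small multiple of a growing exponential is subtracted to make the barrier negative at
  the far end.\<close>

lemma amp_lift:
  assumes v: "solution v dv" and e: "e * e = 1" and m: "0 < m" and w1: "0 < w1" "w1 powr (q - 1) < l"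
    and \<delta>: "0 < \<delta>" "(\<delta>\<^sup>2 + 2 * \<bar>k\<bar> * \<delta>) * w1 \<le> m * (l - w1 powr (q - 1))"
    and T: "\<And>x. x \<noteq> 0 \<Longrightarrow> T \<le> e * ln (norm x) \<Longrightarrow> m \<le> amp v x"
    and x: "x \<noteq> 0" "T \<le> e * ln (norm x)"
  shows "w1 * (1 - exp (- \<delta> * (e * ln (norm x) - T))) \<le> amp v x"
proof (rule field_le_epsilon)
  fix \<eta> :: real assume \<eta>: "0 < \<eta>"
  let ?s = "e * ln (norm x)"
  \<comment> \<open>The subtracted term then equals \<eta> at the point x.\<close>
  define \<epsilon> where "\<epsilon> = \<eta> / exp (\<delta> * (?s - T))"
  have eps: "0 < \<epsilon>" using \<eta> by (simp add: \<epsilon>_def)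
  define P where "P t = exp (\<delta> * (t - T))" for t
  define N where "N t = exp (- \<delta> * (t - T))" for t
  define g where "g t = w1 * (1 - N t) - \<epsilon> * P t" for t
  define g' where "g' t = \<delta> * (w1 * N t - \<epsilon> * P t)" for t
  define g'' where "g'' t = - \<delta>\<^sup>2 * (w1 * N t + \<epsilon> * P t)" for t
  have dP: "(P has_real_derivative \<delta> * P t) (at t)" "(N has_real_derivative - \<delta> * N t) (at t)" for t
    unfolding P_def N_def by (auto intro!: derivative_eq_intros)
  have PN: "P t > 0" "N t > 0" for t by (auto simp: P_def N_def)
  have N1: "N t \<le> 1" if "T \<le> t" for t using that \<delta> by (simp add: N_def)
  \<comment> \<open>Far enough that the subtracted exponential has reached w1, so that the barrier
    is negative.\<close>
  define \<beta> where "\<beta> = max ?s (T + \<bar>ln (w1 / \<epsilon>)\<bar> / \<delta>)"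
  have "w1 \<le> \<epsilon> * P \<beta>"
  proof -
    have "\<beta> - T \<ge> \<bar>ln (w1 / \<epsilon>)\<bar> / \<delta>" by (simp add: \<beta>_def)
    then have "\<delta> * (\<beta> - T) \<ge> ln (w1 / \<epsilon>)" using \<delta>(1) by (simp add: divide_le_eq mult.commute)
    then have "exp (ln (w1 / \<epsilon>)) \<le> P \<beta>" unfolding P_def by (subst exp_le_cancel_iff)
    then show ?thesis using w1 eps by (simp add: divide_le_eq mult.commute)
  qed
  have "g ?s \<le> amp v x"
  proof (rule barrier_sub[OF v e, of T \<beta> g g' g''])
    show "continuous_on {T..\<beta>} g" "continuous_on {T<..<\<beta>} g''"
      unfolding g_def g''_def P_def N_def by (intro continuous_intros)+
    show "(g has_real_derivative g' t) (at t)" for t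
      unfolding g_def g'_def by (rule derivative_eq_intros dP refl)+ (simp add: algebra_simps)
    show "(g' has_real_derivative g'' t) (at t)" for t
      unfolding g'_def g''_def by (rule derivative_eq_intros dP refl)+ (simp add: algebra_simps power2_eq_square)
    show "g T < amp v y" if "y \<noteq> 0" for y
      using solutionD(3)[OF v that] eps by (simp add: g_def P_def N_def)
    show "g \<beta> < amp v y" if "y \<noteq> 0" for y
    proof -
      have "w1 * (1 - N \<beta>) < w1" using w1 PN(2)[of \<beta>] by (simp add: algebra_simps)
      then have "g \<beta> < 0" using \<open>w1 \<le> \<epsilon> * P \<beta>\<close> by (simp add: g_def)
      then show ?thesis using solutionD(3)[OF v that] by simp
    qed
    fix y t assume y: "y \<noteq> 0" and t: "t = e * ln (norm y)" "T < t" "t < \<beta>" and lt: "amp v y < g t"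
    have gm: "m < g t" using T[of y] y t lt by fastforce
    have sm: "w1 * N t + \<epsilon> * P t \<le> w1"
      using gm m by (simp add: g_def algebra_simps)
    have "0 < w1 * N t" "0 < \<epsilon> * P t" using PN eps w1 by simp_all
    then have gw: "g t \<le> w1" unfolding g_def right_diff_distrib by simp
    have "g t powr (q - 1) \<le> w1 powr (q - 1)" using gw gm m q by (intro powr_mono2) auto
    then have "m * (l - w1 powr (q - 1)) \<le> g t * (l - g t powr (q - 1))"
      using gm m w1 by (intro mult_mono) auto
    then have A: "m * (l - w1 powr (q - 1)) \<le> l * g t - g t powr q" using l_rhs_pos[of "g t"] gm m by simp
    have "\<bar>w1 * N t - \<epsilon> * P t\<bar> \<le> w1" using sm PN[of t] eps w1 mult_pos_pos[of w1 "N t"] mult_pos_pos[of \<epsilon> "P t"] by linarith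
    then have "\<bar>2 * e * k * g' t\<bar> \<le> 2 * 1 * \<bar>k\<bar> * (\<delta> * w1)"
      unfolding g'_def abs_mult using \<delta> sign_cases[OF e] by (intro mult_mono) auto
    then have B: "- (2 * e * k * g' t) \<ge> - (2 * \<bar>k\<bar> * \<delta> * w1)" by (simp add: mult_ac)
    have C: "g'' t \<ge> - (\<delta>\<^sup>2 * w1)" using sm by (simp add: g''_def mult_left_mono)
    have "(\<delta>\<^sup>2 + 2 * \<bar>k\<bar> * \<delta>) * w1 = \<delta>\<^sup>2 * w1 + 2 * \<bar>k\<bar> * \<delta> * w1" by (simp add: algebra_simps)
    then show "0 \<le> g'' t - 2 * e * k * g' t + l * g t - g t powr q"
      using A B C \<delta>(2) by linarith
  qed (use x in \<open>auto simp: \<beta>_def\<close>)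
  moreover have "\<epsilon> * P ?s = \<eta>" by (simp add: \<epsilon>_def P_def)
  ultimately show "w1 * (1 - exp (- \<delta> * (?s - T))) \<le> amp v x + \<eta>"
    by (simp add: g_def N_def)
qed

lemma lift_rate_exists:
  assumes "0 < m" "0 < w1" "w1 powr (q - 1) < l"
  obtains \<delta> where "0 < \<delta>" "(\<delta>\<^sup>2 + 2 * \<bar>k\<bar> * \<delta>) * w1 \<le> m * (l - w1 powr (q - 1))"
proof -
  define c where "c = m * (l - w1 powr (q - 1))"
  have c: "c > 0" using assms by (simp add: c_def)
  have d: "(1 + 2 * \<bar>k\<bar>) * w1 > 0" using assms by (intro mult_pos_pos) auto
  define \<delta> where "\<delta> = min 1 (c / ((1 + 2 * \<bar>k\<bar>) * w1))"
  have \<delta>: "0 < \<delta>" "\<delta> \<le> 1" using c d by (auto simp: \<delta>_def)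
  have "\<delta> \<le> c / ((1 + 2 * \<bar>k\<bar>) * w1)" by (simp add: \<delta>_def)
  then have "\<delta> * ((1 + 2 * \<bar>k\<bar>) * w1) \<le> c" using d by (simp only: pos_le_divide_eq)
  moreover have "\<delta>\<^sup>2 \<le> \<delta>" using \<delta> by (simp add: power2_eq_square mult_left_le)
  then have "(\<delta>\<^sup>2 + 2 * \<bar>k\<bar> * \<delta>) * w1 \<le> (\<delta> + 2 * \<bar>k\<bar> * \<delta>) * w1" using assms by simp
  ultimately show ?thesis using that[of \<delta>] \<delta> unfolding c_def by (simp add: algebra_simps)
qed

text \<open>With a global lower bound, \<open>amp_lift\<close> may start at any sphere. Moving the
  start to t = - \<infinity> yields amp v x \<ge> w1 for every w1 < w0.\<close>

lemma amp_ge_w0: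
  assumes v: "solution v dv" and m: "0 < m" "\<And>x. x \<noteq> 0 \<Longrightarrow> m \<le> amp v x" and x: "x \<noteq> 0"
  shows "w0 \<le> amp v x"
proof (rule dense_le_bounded[of 0])
  have l: "0 < l" by (rule solution_imp_l_pos[OF v])
  then show "0 < w0" by (simp add: w0_def)
  fix w1 assume w1: "0 < w1" "w1 < w0"
  have w1l: "w1 powr (q - 1) < l" using powr_le_l_iff(2)[OF l w1(1)] w1 by simp
  obtain \<delta> where \<delta>: "0 < \<delta>" "(\<delta>\<^sup>2 + 2 * \<bar>k\<bar> * \<delta>) * w1 \<le> m * (l - w1 powr (q - 1))"
    using lift_rate_exists[OF m(1) w1(1) w1l] .
  have *: "w1 * (1 - exp (- \<delta> * t)) \<le> amp v x" if "0 \<le> t" for t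
    using amp_lift[OF v _ m(1) w1(1) w1l \<delta> m(2) x, of 1 "ln (norm x) - t"] that by simp
  have "((\<lambda>t. w1 * (1 - exp (- \<delta> * t))) \<longlongrightarrow> w1 * (1 - 0)) at_top"
  proof (intro tendsto_intros)
    have "filterlim (\<lambda>t. - \<delta> * t) at_bot at_top"
      using \<delta>(1) by (intro filterlim_tendsto_neg_mult_at_bot[OF tendsto_const _ filterlim_ident]) simp
    then show "((\<lambda>t. exp (- \<delta> * t)) \<longlongrightarrow> 0) at_top"
      by (rule filterlim_compose[OF exp_at_bot])
  qed
  then have "w1 * (1 - 0) \<le> amp v x"
  proof (rule tendsto_upperbound)
    show "\<forall>\<^sub>F t in at_top. w1 * (1 - exp (- \<delta> * t)) \<le> amp v x"
      by (rule eventually_mono[OF eventually_ge_at_top[of 0]]) (rule *)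
  qed simp
  then show "w1 \<le> amp v x" by simp
qed

text \<open>If \<open>l > k\<^sup>2\<close>, the linear equation oscillates, so that positive subsolutions of compact support
  can be centred at any radius.\<close>

lemma amp_eq_w0:
  assumes v: "solution v dv" and lk: "k\<^sup>2 < l" and x: "x \<noteq> 0"
  shows "amp v x = w0"
proof -
  \<comment> \<open>Half of l - k^2 produces the oscillation, the other half absorbs
    g^(q-1).\<close>
  define \<mu> where "\<mu> = sqrt ((l - k\<^sup>2) / 2)"
  have mu: "0 < \<mu>" "\<mu>\<^sup>2 = (l - k\<^sup>2) / 2" using lk by (auto simp: \<mu>_def)
  define L where "L = pi / (2 * \<mu>)"
  have L: "0 < L" "\<mu> * L = pi / 2" using mu by (auto simp: L_def)
  \<comment> \<open>The barrier is at most \<delta> exp(|k| L), so that g^(q-1) \<le> \<mu>^2. Its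
    value \<delta> at the centre does not depend on the centre, which makes the lower bound
    global.\<close>
  define \<delta> where "\<delta> = (\<mu>\<^sup>2) powr (1 / (q - 1)) / exp (\<bar>k\<bar> * L)"
  have d: "0 < \<delta>" using mu by (simp add: \<delta>_def)
  have "\<delta> \<le> amp v x0" if x0: "x0 \<noteq> 0" for x0
  proof -
    define t0 where "t0 = ln (norm x0)"
    define E where "E t = exp (k * (t - t0))" for t
    define C where "C t = cos (\<mu> * (t - t0))" for t
    define Sn where "Sn t = sin (\<mu> * (t - t0))" for t
    \<comment> \<open>A solution of g'' - 2 k g' + (k^2 + \<mu>^2) g = 0 that is positive between
      two consecutive zeros at t0 - L and t0 + L.\<close>
    define g where "g t = \<delta> * E t * C t" for t
    define g' where "g' t = \<delta> * E t * (k * C t - \<mu> * Sn t)" for t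
    define g'' where "g'' t = \<delta> * E t * ((k\<^sup>2 - \<mu>\<^sup>2) * C t - 2 * k * \<mu> * Sn t)" for t
    have dd: "(E has_real_derivative (k * E t)) (at t)" "(C has_real_derivative (- \<mu> * Sn t)) (at t)"
      "(Sn has_real_derivative (\<mu> * C t)) (at t)" for t
      unfolding E_def C_def Sn_def by (auto intro!: derivative_eq_intros)
    have "g (1 * ln (norm x0)) \<le> amp v x0"
    proof (rule barrier_sub[OF v, of 1 "t0 - L" "t0 + L" g g' g''])
      show "continuous_on {t0 - L..t0 + L} g" "continuous_on {t0 - L<..<t0 + L} g''"
        unfolding g_def g''_def E_def C_def Sn_def by (intro continuous_intros)+
      show "(g has_real_derivative g' t) (at t)" for t
        unfolding g_def g'_def by (rule derivative_eq_intros dd refl)+ (simp add: algebra_simps)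
      show "(g' has_real_derivative g'' t) (at t)" for t
        unfolding g'_def g''_def by (rule derivative_eq_intros dd refl)+ (simp add: algebra_simps power2_eq_square)
      show "g (t0 - L) < amp v y" "g (t0 + L) < amp v y" if "y \<noteq> 0" for y
      proof -
        have "cos (\<mu> * (- L)) = 0" "cos (\<mu> * L) = 0"
          by (simp_all only: mult_minus_right cos_minus L(2) cos_pi_half)
        then show "g (t0 - L) < amp v y" "g (t0 + L) < amp v y"
          using solutionD(3)[OF v that] by (simp_all only: g_def C_def add_diff_cancel_left' diff_add_cancel, simp_all)
      qed
      fix y t assume y: "y \<noteq> 0" and t: "t0 - L < t" "t < t0 + L" and lt: "amp v y < g t"
      have gp: "0 < g t" using solutionD(3)[OF v y] lt by simp
      have "k * (t - t0) \<le> \<bar>k\<bar> * \<bar>t - t0\<bar>" by (metis abs_ge_self abs_mult)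
      also have "\<dots> \<le> \<bar>k\<bar> * L" using t by (intro mult_left_mono) auto
      finally have "E t \<le> exp (\<bar>k\<bar> * L)" by (simp add: E_def)
      moreover have "\<delta> * E t * C t \<le> \<delta> * E t * 1"
        using d by (intro mult_left_mono) (auto simp: C_def E_def)
      ultimately have "\<delta> * E t * C t \<le> \<delta> * exp (\<bar>k\<bar> * L)"
        using mult_left_mono[of "E t" "exp (\<bar>k\<bar> * L)" \<delta>] d by simp
      then have "g t \<le> (\<mu>\<^sup>2) powr (1 / (q - 1))" by (simp add: g_def \<delta>_def)
      then have "g t powr (q - 1) \<le> ((\<mu>\<^sup>2) powr (1 / (q - 1))) powr (q - 1)"
        using gp q by (intro powr_mono2) auto
      also have "\<dots> = \<mu>\<^sup>2" using q mu by (simp add: powr_powr)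
      finally have "0 \<le> g t * (l - k\<^sup>2 - \<mu>\<^sup>2 - g t powr (q - 1))" using gp mu by simp
      moreover have "g'' t - 2 * 1 * k * g' t = - (k\<^sup>2 + \<mu>\<^sup>2) * g t"
        by (simp add: g_def g'_def g''_def algebra_simps power2_eq_square)
      ultimately show "0 \<le> g'' t - 2 * 1 * k * g' t + l * g t - g t powr q"
        using l_rhs_pos[OF gp] by (simp add: algebra_simps)
    qed (use x0 L in \<open>auto simp: t0_def\<close>)
    then show ?thesis by (simp add: g_def E_def C_def t0_def)
  qed
  then have "w0 \<le> amp v x" using amp_ge_w0[OF v d _ x] by blast
  then show ?thesis using amp_le_w0[OF v x] by simp
qed

text \<open>Constants and exp(2 e k t) solve g'' - 2 e k g' = 0. As e k > 0, the second one grows,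
  and subtracting a small multiple of it from m gives a barrier that is negative far out. So a bound
  on a single sphere propagates in the direction of increasing t.\<close>

lemma amp_ge_sphere:
  assumes v: "solution v dv" and e: "e * e = 1" and ek: "0 < e * k" and m: "0 < m" "m \<le> w0"
    and T: "\<And>x. x \<noteq> 0 \<Longrightarrow> e * ln (norm x) = T \<Longrightarrow> m \<le> amp v x"
    and x: "x \<noteq> 0" "T \<le> e * ln (norm x)"
  shows "m \<le> amp v x"
proof (rule field_le_epsilon)
  fix \<eta> :: real assume \<eta>: "0 < \<eta>"
  have l: "0 < l" by (rule solution_imp_l_pos[OF v])
  let ?s = "e * ln (norm x)"
  define c where "c = 2 * (e * k)"
  have c: "c > 0" using ek by (simp add: c_def)
  define \<epsilon> where "\<epsilon> = \<eta> / exp (c * (?s - T))"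
  have eps: "0 < \<epsilon>" using \<eta> by (simp add: \<epsilon>_def)
  define P where "P t = exp (c * (t - T))" for t
  have dP: "(P has_real_derivative c * P t) (at t)" for t
    unfolding P_def by (auto intro!: derivative_eq_intros)
  define g where "g t = m - \<epsilon> * P t" for t
  define g' where "g' t = - \<epsilon> * c * P t" for t
  define g'' where "g'' t = - \<epsilon> * c\<^sup>2 * P t" for t
  define \<beta> where "\<beta> = max ?s (T + \<bar>ln (m / \<epsilon>)\<bar> / c)"
  have mb: "m \<le> \<epsilon> * P \<beta>"
  proof -
    have "\<beta> - T \<ge> \<bar>ln (m / \<epsilon>)\<bar> / c" by (simp add: \<beta>_def)
    then have "c * (\<beta> - T) \<ge> ln (m / \<epsilon>)" using c by (simp add: divide_le_eq mult.commute)
    then have "exp (ln (m / \<epsilon>)) \<le> P \<beta>" unfolding P_def by (subst exp_le_cancel_iff)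
    then show ?thesis using m eps by (simp add: divide_le_eq mult.commute)
  qed
  have "g ?s \<le> amp v x"
  proof (rule barrier_sub[OF v e, of T \<beta> g g' g''])
    show "continuous_on {T..\<beta>} g" "continuous_on {T<..<\<beta>} g''"
      unfolding g_def g''_def P_def by (intro continuous_intros)+
    show "(g has_real_derivative g' t) (at t)" for t
      unfolding g_def g'_def by (rule derivative_eq_intros dP refl)+ simp
    show "(g' has_real_derivative g'' t) (at t)" for t
      unfolding g'_def g''_def by (rule derivative_eq_intros dP refl)+ (simp add: power2_eq_square)
    show "g T < amp v y" if "y \<noteq> 0" "e * ln (norm y) = T" for y
      using T[OF that] eps by (simp add: g_def P_def)
    show "g \<beta> < amp v y" if "y \<noteq> 0" for y
      using solutionD(3)[OF v that] mb by (simp add: g_def)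
    fix y t assume y: "y \<noteq> 0" and lt: "amp v y < g t"
    have gp: "0 < g t" using solutionD(3)[OF v y] lt by simp
    have "g t \<le> m" using eps by (simp add: g_def P_def)
    then have "g t powr (q - 1) \<le> l" using powr_le_l_iff(1)[OF l gp] m by simp
    then have "0 \<le> l * g t - g t powr q" using l_rhs_pos[OF gp] gp by simp
    moreover have "g'' t - 2 * e * k * g' t = 0" by (simp add: g'_def g''_def c_def power2_eq_square)
    ultimately show "0 \<le> g'' t - 2 * e * k * g' t + l * g t - g t powr q" by simp
  qed (use x in \<open>auto simp: \<beta>_def\<close>)
  moreover have "\<epsilon> * P ?s = \<eta>" by (simp add: \<epsilon>_def P_def)
  ultimately show "m \<le> amp v x + \<eta>" by (simp add: g_def)
qed

text \<open>The minimum over one sphere is positive by compactness, propagates by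
  \<open>amp_ge_sphere\<close>, and is then lifted to any level below w0.\<close>

lemma amp_tendsto_w0:
  assumes v: "solution v dv" and e: "e * e = 1" and ek: "0 < e * k" and \<eta>: "\<eta> < w0"
  obtains T where "\<And>x. x \<noteq> 0 \<Longrightarrow> T \<le> e * ln (norm x) \<Longrightarrow> \<eta> \<le> amp v x"
proof -
  have l: "0 < l" by (rule solution_imp_l_pos[OF v])
  then have w0: "0 < w0" by (simp add: w0_def)
  obtain w1 where w1: "max 0 \<eta> < w1" "w1 < w0" using dense[of "max 0 \<eta>" w0] \<eta> w0 by auto
  have w1p: "0 < w1" using w1 by simp
  have w1l: "w1 powr (q - 1) < l" using powr_le_l_iff(2)[OF l w1p] w1 by simp
  obtain m0 where m0: "0 < m0" "\<And>x. x \<noteq> 0 \<Longrightarrow> e * ln (norm x) = 0 \<Longrightarrow> m0 \<le> amp v x"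
    using amp_lower_bound[OF v e, of 0] by blast
  define m where "m = min m0 w0"
  have m: "0 < m" using m0 w0 by (simp add: m_def)
  have ge: "m \<le> amp v x" if "x \<noteq> 0" "0 \<le> e * ln (norm x)" for x
    by (rule amp_ge_sphere[OF v e ek m _ _ that]) (use m0 in \<open>force simp: m_def\<close>)+
  obtain \<delta> where \<delta>: "0 < \<delta>" "(\<delta>\<^sup>2 + 2 * \<bar>k\<bar> * \<delta>) * w1 \<le> m * (l - w1 powr (q - 1))"
    using lift_rate_exists[OF m w1p w1l] .
  define T where "T = max 0 (- ln (1 - max 0 \<eta> / w1) / \<delta>)"
  show ?thesis
  proof (rule that[of T])
    fix x :: 'a assume x: "x \<noteq> 0" "T \<le> e * ln (norm x)"
    let ?s = "e * ln (norm x)"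
    have s: "0 \<le> ?s" "- ln (1 - max 0 \<eta> / w1) / \<delta> \<le> ?s" using x by (auto simp: T_def)
    have r: "0 < 1 - max 0 \<eta> / w1" using w1 w1p by (simp add: field_simps)
    have "- \<delta> * ?s \<le> ln (1 - max 0 \<eta> / w1)" using s(2) \<delta>(1) pos_divide_le_eq[of \<delta> "- ln (1 - max 0 \<eta> / w1)" ?s]
      by (simp add: mult.commute)
    then have "exp (- \<delta> * ?s) \<le> exp (ln (1 - max 0 \<eta> / w1))" by (simp only: exp_le_cancel_iff)
    then have "exp (- \<delta> * ?s) \<le> 1 - max 0 \<eta> / w1" using r by simp
    then have "max 0 \<eta> / w1 \<le> 1 - exp (- \<delta> * ?s)" by linarith
    then have "max 0 \<eta> \<le> w1 * (1 - exp (- \<delta> * ?s))" using w1p by (simp add: pos_divide_le_eq mult.commute)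
    also have "\<dots> \<le> amp v x"
      using amp_lift[OF v e m w1p w1l \<delta> ge x(1) s(1)] by simp
    finally show "\<eta> \<le> amp v x" by simp
  qed
qed

section \<open>Classification of solutions\<close>

text \<open>The order is asked only on spheres that accumulate at t = - \<infinity>. At the other
  end both amplitudes are close to w0, so v1 is below (1 + \<epsilon>) v2 there; this multiple is
  still a supersolution because q > 1. The factor also gives strict inequality on the inner
  sphere.\<close>

lemma ends_comparison:
  assumes v1: "solution v1 dv1" and v2: "solution v2 dv2" and e: "e * e = 1" and ek: "0 < e * k"
    and low: "\<And>\<tau>. \<exists>t<\<tau>. \<forall>x. x \<noteq> 0 \<longrightarrow> e * ln (norm x) = t \<longrightarrow> amp v1 x \<le> amp v2 x"
    and x: "x \<noteq> 0"
  shows "amp v1 x \<le> amp v2 x"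
proof (rule field_le_epsilon)
  fix \<eta> :: real assume \<eta>: "0 < \<eta>"
  have l: "0 < l" by (rule solution_imp_l_pos[OF v1])
  then have w0: "0 < w0" by (simp add: w0_def)
  note A1 = solutionD[OF v1] and A2 = solutionD[OF v2]
  let ?s = "\<lambda>x. e * ln (norm x)"
  define \<epsilon> where "\<epsilon> = \<eta> / amp v2 x"
  have eps: "0 < \<epsilon>" using \<eta> A2(3)[OF x] by (simp add: \<epsilon>_def)
  have "w0 / (1 + \<epsilon>) < w0" using eps w0 by (simp add: divide_less_eq algebra_simps)
  then obtain w1 where w1: "w0 / (1 + \<epsilon>) < w1" "w1 < w0" using dense by blast
  obtain T where T: "\<And>x. x \<noteq> 0 \<Longrightarrow> T \<le> ?s x \<Longrightarrow> w1 \<le> amp v2 x"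
    using amp_tendsto_w0[OF v2 e ek w1(2)] by blast
  have up: "amp v1 y < (1 + \<epsilon>) * amp v2 y" if "y \<noteq> 0" "T \<le> ?s y" for y
  proof -
    have "amp v1 y \<le> w0" by (rule amp_le_w0[OF v1 that(1)])
    also have "w0 < (1 + \<epsilon>) * w1" using w1(1) eps by (simp add: divide_less_eq mult.commute)
    also have "\<dots> \<le> (1 + \<epsilon>) * amp v2 y" using T[OF that] eps by (intro mult_left_mono) auto
    finally show ?thesis .
  qed
  obtain \<alpha> where \<alpha>: "\<alpha> < ?s x" "\<And>y. y \<noteq> 0 \<Longrightarrow> ?s y = \<alpha> \<Longrightarrow> amp v1 y \<le> amp v2 y"
    using low[of "?s x"] by blast
  define \<beta> where "\<beta> = max T (?s x) + 1"
  have \<beta>: "T \<le> \<beta>" "?s x < \<beta>" by (auto simp: \<beta>_def)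
  let ?S = "{y::'a. y \<noteq> 0 \<and> ?s y \<in> {\<alpha><..<\<beta>}}"
  let ?K = "{y::'a. y \<noteq> 0 \<and> \<alpha> \<le> ?s y \<and> ?s y \<le> \<beta> \<and> 0 \<le> amp v1 y - (1 + \<epsilon>) * amp v2 y}"
  have K: "compact ?K"
  proof -
    have "continuous_on (- {0}) (\<lambda>y. amp v1 y - (1 + \<epsilon>) * amp v2 y)"
      by (intro continuous_intros A1(5) A2(5))
    from compact_annulus_subset(2)[OF e this continuous_on_const, of \<alpha> \<beta> 0] show ?thesis by simp
  qed
  have KS: "?K \<subseteq> ?S"
  proof
    fix y assume y: "y \<in> ?K"
    then have y0: "y \<noteq> 0" by simp
    have "?s y \<noteq> \<alpha>"
    proof
      assume "?s y = \<alpha>"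
      then have "amp v1 y \<le> amp v2 y" using \<alpha>(2) y0 by blast
      also have "\<dots> < (1 + \<epsilon>) * amp v2 y" using A2(3)[OF y0] eps by (simp add: algebra_simps)
      finally show False using y by simp
    qed
    moreover have "?s y \<noteq> \<beta>" using up[OF y0] y \<beta>(1) by force
    ultimately show "y \<in> ?S" using y by auto
  qed
  have iff: "v1 y \<le> (1 + \<epsilon>) * v2 y \<longleftrightarrow> amp v1 y \<le> (1 + \<epsilon>) * amp v2 y" if "y \<noteq> 0" for y
    using that of_amp[of y v1] of_amp[of y v2] by (simp add: mult.left_commute)
  have sub: "?S \<subseteq> - {0}" by auto
  have "v1 x \<le> (1 + \<epsilon>) * v2 x"
  proof (rule weak_comparison[OF open_radial[OF open_greaterThanLessThan] weak_lap_subset[OF A1(1) sub]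
        weak_lap_subset[OF weak_lap_cmult[OF A2(1)] sub] K KS])
    show "v1 y \<le> (1 + \<epsilon>) * v2 y" if "y \<in> ?S - ?K" for y using that iff[of y] by auto
    show "0 < (1 + \<epsilon>) * v2 y" if "y \<in> ?S" for y using that A2(2)[of y] eps by auto
    show "x \<in> ?S" using x \<alpha>(1) \<beta>(2) by simp
    fix y assume y: "y \<in> ?S" and lt: "(1 + \<epsilon>) * v2 y < v1 y"
    have y0: "y \<noteq> 0" using y by auto
    \<comment> \<open>Both sides of the comparison condition carry the factor 1 + \<epsilon>, so it
      reduces to amp v2 < amp v1.\<close>
    have "(1 + \<epsilon>) * amp v2 y < amp v1 y" using lt iff[OF y0] by auto
    moreover have "amp v2 y < (1 + \<epsilon>) * amp v2 y" using A2(3)[OF y0] eps by (simp add: algebra_simps)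
    ultimately have "amp v2 y < amp v1 y" by simp
    from rhs_less[OF A2(3)[OF y0] this q, of "norm y powr (- \<sigma> - 2)" "norm y powr (- \<sigma>)" D, OF _ _ order_refl order_refl]
    have "(1 + \<epsilon>) * (norm y powr (- \<sigma> - 2) * (amp v2 y powr q - D * amp v2 y) * v1 y)
        < (1 + \<epsilon>) * (norm y powr (- \<sigma> - 2) * (amp v1 y powr q - D * amp v1 y) * v2 y)"
      using y0 eps of_amp[OF y0, of v1] of_amp[OF y0, of v2] by simp
    then show "(1 + \<epsilon>) * (norm y powr (- \<sigma> - 2) * (amp v2 y powr q - D * amp v2 y)) * v1 y
        < norm y powr (- \<sigma> - 2) * (amp v1 y powr q - D * amp v1 y) * ((1 + \<epsilon>) * v2 y)"
      by (simp only: mult_ac)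
  qed
  then have "amp v1 x \<le> (1 + \<epsilon>) * amp v2 x" using iff[OF x] by simp
  also have "\<dots> = amp v2 x + \<eta>" using A2(3)[OF x] by (simp add: \<epsilon>_def algebra_simps)
  finally show "amp v1 x \<le> amp v2 x + \<eta>" .
qed

section \<open>Harnack's inequality for amplitudes\<close>

text \<open>For amplitudes up to w0 the function w^q - D w has Lipschitz constant at most q l + |D|
  and vanishes at 0; so one constant serves both solutions and differences of solutions.\<close>

definition harnack_const :: real where
  "harnack_const = (3 ^ (DIM('a) + 2) * exp (q * l + \<bar>D\<bar>)) ^ (48 * DIM('a))"

lemma harnack_const_pos: "0 < harnack_const"
  by (simp add: harnack_const_def)

lemma amp_powr_le:
  assumes "solution v dv" "x \<noteq> 0" shows "amp v x powr (q - 1) \<le> l"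
  using powr_le_l_iff(1)[OF solution_imp_l_pos[OF assms(1)] solutionD(3)[OF assms]] amp_le_w0[OF assms] by simp

lemma harnack_amp:
  assumes N: "2 \<le> DIM('a)" and v: "solution v dv" and x: "norm x1 = norm x2" "x2 \<noteq> 0"
  shows "amp v x1 \<le> harnack_const * amp v x2"
proof -
  have l: "0 < l" by (rule solution_imp_l_pos[OF v])
  have "v x1 \<le> harnack_const * v x2" unfolding harnack_const_def
  proof (rule harnack_sphere[OF N solutionD(1)[OF v] _ _ _ x])
    show "0 \<le> q * l + \<bar>D\<bar>" using q l by simp
    show "0 \<le> v y" if "y \<noteq> 0" for y using solutionD(2)[OF v that] by simp
    fix y :: 'a assume y: "y \<noteq> 0"
    have a: "0 < amp v y" by (rule solutionD(3)[OF v y])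
    have "\<bar>amp v y powr q - D * amp v y\<bar> = \<bar>amp v y powr (q - 1) - D\<bar> * amp v y"
      using powr_eq_mult[OF a, of q] a by (simp add: abs_mult flip: left_diff_distrib)
        (metis abs_mult abs_of_pos left_diff_distrib mult.commute)
    also have "\<dots> \<le> (q * l + \<bar>D\<bar>) * amp v y"
    proof (rule mult_right_mono)
      have "l \<le> q * l" using q l by simp
      then show "\<bar>amp v y powr (q - 1) - D\<bar> \<le> q * l + \<bar>D\<bar>"
        using amp_powr_le[OF v y] powr_ge_zero[of "amp v y" "q - 1"] by linarith
    qed (use a in simp)
    finally have "norm y powr (- \<sigma> - 2) * \<bar>amp v y powr q - D * amp v y\<bar> \<le> norm y powr (- \<sigma> - 2) * ((q * l + \<bar>D\<bar>) * amp v y)"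
      by (intro mult_left_mono) auto
    also have "\<dots> = (q * l + \<bar>D\<bar>) / (norm y)\<^sup>2 * v y"
      using y of_amp[OF y, of v] by (simp add: powr_diff)
    finally show "\<bar>norm y powr (- \<sigma> - 2) * (amp v y powr q - D * amp v y)\<bar> \<le> (q * l + \<bar>D\<bar>) / (norm y)\<^sup>2 * v y"
      by (simp add: abs_mult)
  qed
  then have "norm x2 powr \<sigma> * v x1 \<le> norm x2 powr \<sigma> * (harnack_const * v x2)" by (intro mult_left_mono) auto
  then show ?thesis using x(1) by (simp add: amp_def mult_ac)
qed

text \<open>The difference is nonnegative, and since w^q has slope at most q l below w0, its
  Laplacian is bounded by a multiple of the difference over |x|^2.\<close>

lemma harnack_amp_diff:
  assumes N: "2 \<le> DIM('a)" and v: "solution v dv" and u: "solution u du"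
    and le: "\<And>x. x \<noteq> 0 \<Longrightarrow> amp u x \<le> amp v x" and x: "norm x1 = norm x2" "x2 \<noteq> 0"
  shows "amp v x1 - amp u x1 \<le> harnack_const * (amp v x2 - amp u x2)"
proof -
  have l: "0 < l" by (rule solution_imp_l_pos[OF v])
  have "v x1 - u x1 \<le> harnack_const * (v x2 - u x2)" unfolding harnack_const_def
  proof (rule harnack_sphere[OF N weak_lap_diff[OF solutionD(1)[OF v] solutionD(1)[OF u]] _ _ _ x])
    show "0 \<le> q * l + \<bar>D\<bar>" using q l by simp
    fix y :: 'a assume y: "y \<noteq> 0"
    have d: "v y - u y = norm y powr (- \<sigma>) * (amp v y - amp u y)"
      using of_amp[OF y, of v] of_amp[OF y, of u] by (simp add: right_diff_distrib)
    show "0 \<le> v y - u y" unfolding d using le[OF y] by simp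
    have a: "0 < amp u y" "0 < amp v y" using solutionD(3) u v y by blast+
    have "amp v y powr q - amp u y powr q \<le> q * amp v y powr (q - 1) * (amp v y - amp u y)"
      by (rule powr_diff_le) (use a le[OF y] q in auto)
    also have "\<dots> \<le> q * l * (amp v y - amp u y)"
      using amp_powr_le[OF v y] q le[OF y] by (intro mult_right_mono mult_left_mono) auto
    finally have 1: "amp v y powr q - amp u y powr q \<le> q * l * (amp v y - amp u y)" .
    have 2: "0 \<le> amp v y powr q - amp u y powr q" using a le[OF y] q by (simp add: powr_mono2)
    have "\<bar>(amp v y powr q - amp u y powr q) - D * (amp v y - amp u y)\<bar> \<le> \<bar>amp v y powr q - amp u y powr q\<bar> + \<bar>D\<bar> * (amp v y - amp u y)"
      using abs_triangle_ineq4[of "amp v y powr q - amp u y powr q" "D * (amp v y - amp u y)"] le[OF y] by (simp add: abs_mult)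
    also have "\<dots> \<le> (q * l + \<bar>D\<bar>) * (amp v y - amp u y)" using 1 2 by (simp add: distrib_right)
    finally have "norm y powr (- \<sigma> - 2) * \<bar>(amp v y powr q - amp u y powr q) - D * (amp v y - amp u y)\<bar>
        \<le> norm y powr (- \<sigma> - 2) * ((q * l + \<bar>D\<bar>) * (amp v y - amp u y))" by (intro mult_left_mono) auto
    also have "\<dots> = (q * l + \<bar>D\<bar>) / (norm y)\<^sup>2 * (v y - u y)"
      unfolding d using y by (simp add: powr_diff)
    also have "norm y powr (- \<sigma> - 2) * \<bar>(amp v y powr q - amp u y powr q) - D * (amp v y - amp u y)\<bar>
      = \<bar>norm y powr (- \<sigma> - 2) * ((amp v y powr q - amp u y powr q) - D * (amp v y - amp u y))\<bar>" by (simp add: abs_mult)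
    also have "norm y powr (- \<sigma> - 2) * ((amp v y powr q - amp u y powr q) - D * (amp v y - amp u y))
      = norm y powr (- \<sigma> - 2) * (amp v y powr q - D * amp v y) - norm y powr (- \<sigma> - 2) * (amp u y powr q - D * amp u y)"
      by (simp add: algebra_simps)
    finally show "\<bar>norm y powr (- \<sigma> - 2) * (amp v y powr q - D * amp v y) - norm y powr (- \<sigma> - 2) * (amp u y powr q - D * amp u y)\<bar>
       \<le> (q * l + \<bar>D\<bar>) / (norm y)\<^sup>2 * (v y - u y)" .
  qed
  then have "norm x2 powr \<sigma> * (v x1 - u x1) \<le> norm x2 powr \<sigma> * (harnack_const * (v x2 - u x2))" by (intro mult_left_mono) auto
  then show ?thesis using x(1) by (simp add: amp_def algebra_simps)
qed

lemma radius_exists: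
  assumes "e * e = (1::real)"
  obtains x :: 'a where "x \<noteq> 0" "e * ln (norm x) = t"
proof -
  obtain b :: 'a where b: "b \<in> Basis" using nonempty_Basis by blast
  show ?thesis
  proof (rule that[of "exp (e * t) *\<^sub>R b"])
    have "e * (e * t) = (e * e) * t" by simp
    then show "e * ln (norm (exp (e * t) *\<^sub>R b)) = t" using b assms by simp
  qed (use b in auto)
qed

end

text \<open>The sign \<open>e = \<plusminus>1\<close> orients the cylinder: the variable of the wave is \<open>e ln |x|\<close>, so that \<open>Z\<close> vanishes at
  the origin if \<open>e = 1\<close> and at infinity if \<open>e = -1\<close>.\<close>

locale emden_wave = emden B D q \<sigma> k l space
  for B D q \<sigma> k l :: real and space :: "'a::euclidean_space itself" +
  fixes e \<theta> :: real and Z Z' :: "real \<Rightarrow> real"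
  assumes N2: "2 \<le> DIM('a)" and e: "e * e = 1" and ek: "0 < e * k" and th: "0 < \<theta>"
    and dZ: "\<And>t. (Z has_real_derivative Z' t) (at t)"
    and dZ': "\<And>t. (Z' has_real_derivative 2 * (e * k) * Z' t - l * Z t + Z t powr q) (at t)"
    and Zpos: "\<And>t. 0 < Z t"
    and Zshift: "\<And>c. ((\<lambda>t. Z (t + c) / Z t) \<longlongrightarrow> exp (\<theta> * c)) at_bot"
begin

section \<open>Translates of the wave\<close>

definition wv :: "real \<Rightarrow> 'a \<Rightarrow> real" where "wv c = cyl e (\<lambda>t. Z (t + c))"

lemma amp_wv: "x \<noteq> 0 \<Longrightarrow> amp (wv c) x = Z (e * ln (norm x) + c)"
  by (simp add: wv_def amp_cyl)

lemma wv_solution: "\<exists>dv. solution (wv c) dv"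
  unfolding wv_def
proof (rule solution_cyl[OF e])
  show "((\<lambda>t. Z (t + c)) has_real_derivative Z' (t + c)) (at t)" for t
    using dZ[of "t + c"] by (simp add: DERIV_shift)
  show "((\<lambda>t. Z' (t + c)) has_real_derivative 2 * (e * k) * Z' (t + c) - l * Z (t + c) + Z (t + c) powr q) (at t)" for t
    using dZ'[of "t + c"] by (simp add: DERIV_shift)
qed (use Zpos in auto)

lemma Z_cont: "isCont Z t" using dZ DERIV_isCont by blast

lemma Z_ratio: "((\<lambda>t. Z (t + a) / Z (t + b)) \<longlongrightarrow> exp (\<theta> * (a - b))) at_bot"
proof -
  have "filterlim (\<lambda>t::real. t + b) at_bot at_bot"
    unfolding filterlim_at_bot
  proof
    fix r show "eventually (\<lambda>t. t + b \<le> r) at_bot"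
      using eventually_le_at_bot[of "r - b"] by eventually_elim simp
  qed
  from filterlim_compose[OF Zshift[of "a - b"] this] show ?thesis by (simp add: add.commute add.left_commute)
qed

text \<open>Every bound for solutions of the partial differential equation holds for the wave, read
  as a radial solution.\<close>

lemma Z_le_w0: "Z t \<le> w0"
proof -
  obtain x :: 'a where x: "x \<noteq> 0" "e * ln (norm x) = t" by (rule radius_exists[OF e])
  obtain dv where "solution (wv 0) dv" using wv_solution by blast
  from amp_le_w0[OF this x(1)] show ?thesis using x by (simp add: amp_wv)
qed

lemma Z_tendsto_w0:
  assumes "\<eta> < w0" obtains T where "\<And>t. T \<le> t \<Longrightarrow> \<eta> \<le> Z t"
proof -
  obtain dv where dv: "solution (wv 0) dv" using wv_solution by blast
  obtain T where T: "\<And>x. x \<noteq> 0 \<Longrightarrow> T \<le> e * ln (norm x) \<Longrightarrow> \<eta> \<le> amp (wv 0) x"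
    using amp_tendsto_w0[OF dv e ek assms] by blast
  show ?thesis
  proof (rule that[of T])
    fix t assume t: "T \<le> t"
    obtain x :: 'a where x: "x \<noteq> 0" "e * ln (norm x) = t" by (rule radius_exists[OF e])
    show "\<eta> \<le> Z t" using T[OF x(1)] t x by (simp add: amp_wv)
  qed
qed

lemma eventually_at_botD:
  fixes P :: "real \<Rightarrow> bool"
  assumes "eventually P at_bot" shows "\<exists>t<\<tau>. P t"
proof -
  have "eventually (\<lambda>t. P t \<and> t < \<tau>) at_bot"
    using assms eventually_gt_at_bot[of \<tau>] by eventually_elim simp
  then show ?thesis using eventually_happens'[OF trivial_limit_at_bot_linorder] by blast
qed

lemma le_wv:
  assumes v: "solution v dv" and x: "x \<noteq> 0"
    and ev: "eventually (\<lambda>t. \<forall>x. x \<noteq> 0 \<longrightarrow> e * ln (norm x) = t \<longrightarrow> amp v x \<le> Z (t + c)) at_bot"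
  shows "amp v x \<le> Z (e * ln (norm x) + c)"
proof -
  obtain dw where dw: "solution (wv c) dw" using wv_solution by blast
  have "amp v x \<le> amp (wv c) x"
    by (rule ends_comparison[OF v dw e ek _ x]) (use eventually_at_botD[OF ev] in \<open>auto simp: amp_wv\<close>)
  then show ?thesis using x by (simp add: amp_wv)
qed

text \<open>Near minus infinity the ratio of the two translates is close to exp(\<theta> (b - a)) >
  1, and comparison carries this order to the whole line.\<close>

lemma Z_mono_strictly: "a < b \<Longrightarrow> Z a \<le> Z b"
proof -
  assume ab: "a < b"
  obtain x :: 'a where x: "x \<noteq> 0" "e * ln (norm x) = 0" by (rule radius_exists[OF e])
  obtain dw where dw: "solution (wv a) dw" using wv_solution by blast
  have "1 < exp (\<theta> * (b - a))" using th ab by simp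
  then have "eventually (\<lambda>t. 1 < Z (t + b) / Z (t + a)) at_bot"
    by (rule order_tendstoD(1)[OF Z_ratio])
  then have "eventually (\<lambda>t. \<forall>x. x \<noteq> 0 \<longrightarrow> e * ln (norm x) = t \<longrightarrow> amp (wv a) x \<le> Z (t + b)) at_bot"
    by eventually_elim (use Zpos in \<open>auto simp: amp_wv less_divide_eq intro: less_imp_le\<close>)
  from le_wv[OF dw x(1) this] show ?thesis using x by (simp add: amp_wv)
qed

lemma Z_mono: "a \<le> b \<Longrightarrow> Z a \<le> Z b"
  using Z_mono_strictly[of a b] by (cases "a = b") auto

text \<open>Near minus infinity each unit step to the left divides Z by at least a fixed \<rho> >
  1.\<close>

lemma Z_small:
  assumes "0 < \<epsilon>" obtains t where "Z t < \<epsilon>"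
proof -
  define \<rho> where "\<rho> = (1 + exp \<theta>) / 2"
  have e1: "1 < exp \<theta>" using th by simp
  then have \<rho>: "1 < \<rho>" "\<rho> < exp \<theta>" by (auto simp: \<rho>_def)
  have "eventually (\<lambda>t. \<rho> < Z (t + 1) / Z t) at_bot"
    using order_tendstoD(1)[OF Zshift[of 1]] \<rho>(2) by simp
  then obtain \<tau> where \<tau>: "\<And>t. t \<le> \<tau> \<Longrightarrow> \<rho> < Z (t + 1) / Z t"
    unfolding eventually_at_bot_linorder by blast
  have "\<rho> ^ n * Z (\<tau> + 1 - real n) \<le> Z (\<tau> + 1)" for n
  proof (induction n)
    case (Suc n)
    have "\<rho> * Z (\<tau> - real n) \<le> Z (\<tau> - real n + 1)"
      using \<tau>[of "\<tau> - real n"] Zpos[of "\<tau> - real n"] by (simp add: less_divide_eq)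
    then have "\<rho> ^ n * (\<rho> * Z (\<tau> - real n)) \<le> \<rho> ^ n * Z (\<tau> - real n + 1)"
      using \<rho> by (intro mult_left_mono) auto
    also have "\<dots> \<le> Z (\<tau> + 1)" using Suc by (simp add: algebra_simps)
    finally show ?case by (simp add: mult_ac algebra_simps)
  qed simp
  moreover obtain n where "Z (\<tau> + 1) / \<epsilon> < \<rho> ^ n" using real_arch_pow[OF \<rho>(1)] by blast
  ultimately have "\<rho> ^ n * Z (\<tau> + 1 - real n) < \<rho> ^ n * \<epsilon>"
    using assms by (smt (verit) pos_divide_less_eq)
  then have "Z (\<tau> + 1 - real n) < \<epsilon>" using \<rho>(1) by simp
  then show ?thesis by (rule that)
qed

theorem solution_cases:
  assumes v: "solution v dv"
  shows "(\<forall>x. x \<noteq> 0 \<longrightarrow> amp v x = w0) \<or> (\<exists>c. \<forall>x. x \<noteq> 0 \<longrightarrow> amp v x = Z (e * ln (norm x) + c))"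
proof -
  let ?s = "\<lambda>x::'a. e * ln (norm x)"
  let ?H = harnack_const
  have same: "norm x = norm y" if "?s x = ?s y" "x \<noteq> 0" "y \<noteq> 0" for x y
    using that e by (metis ln_inj_iff mult_cancel_left mult_zero_left zero_less_norm_iff zero_neq_one)
  define Cs where "Cs = {c. \<forall>x. x \<noteq> 0 \<longrightarrow> Z (?s x + c) \<le> amp v x}"
  \<comment> \<open>The contrapositive of \<open>ends_comparison\<close>: if the translate lay below
    v on spheres accumulating at t = - \<infinity>, it would do so everywhere.\<close>
  have notin: "eventually (\<lambda>t. \<exists>x. x \<noteq> 0 \<and> ?s x = t \<and> amp v x < Z (t + c)) at_bot" if "c \<notin> Cs" for c
  proof -
    obtain dw where dw: "solution (wv c) dw" using wv_solution by blast
    have "\<exists>\<tau>. \<forall>t<\<tau>. \<exists>x. x \<noteq> 0 \<and> ?s x = t \<and> amp v x < Z (t + c)"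
    proof (rule ccontr)
      assume n: "\<not> (\<exists>\<tau>. \<forall>t<\<tau>. \<exists>x. x \<noteq> 0 \<and> ?s x = t \<and> amp v x < Z (t + c))"
      have "\<exists>t<\<tau>. \<forall>x. x \<noteq> 0 \<longrightarrow> ?s x = t \<longrightarrow> amp (wv c) x \<le> amp v x" for \<tau>
      proof -
        obtain t where t: "t < \<tau>" "\<not> (\<exists>x. x \<noteq> 0 \<and> ?s x = t \<and> amp v x < Z (t + c))" using n by blast
        then show ?thesis by (intro exI[of _ t]) (auto simp: amp_wv not_less)
      qed
      then have "amp (wv c) x \<le> amp v x" if "x \<noteq> 0" for x
        using ends_comparison[OF dw v e ek _ that] by blast
      then have "c \<in> Cs" by (auto simp: Cs_def amp_wv)
      then show False using that by simp
    qed
    then show ?thesis unfolding eventually_at_bot_dense .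
  qed
  \<comment> \<open>Otherwise, on all spheres near t = - \<infinity>, v falls below each translate
    somewhere. Harnack's inequality extends this to the whole sphere at the cost of a further
    translation, so v lies below all translates, whose infimum at a point is 0.\<close>
  have ne: "Cs \<noteq> {}"
  proof
    assume empty: "Cs = {}"
    have all: "amp v x \<le> Z (?s x + c')" if x: "x \<noteq> 0" for x c'
    proof (rule le_wv[OF v x])
      \<comment> \<open>This gives exp(\<theta> (c - c')) < 1 / H, so the translation from c to c'
        absorbs Harnack's constant.\<close>
      define c where "c = c' - (\<bar>ln ?H\<bar> + 1) / \<theta>"
      have "\<theta> * (c - c') = - \<bar>ln ?H\<bar> - 1" using th by (simp add: c_def)
      then have "exp (\<theta> * (c - c')) < exp (- ln ?H)" by simp
      also have "\<dots> = 1 / ?H" using harnack_const_pos by (simp add: exp_minus inverse_eq_divide)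
      finally have "eventually (\<lambda>t. Z (t + c) / Z (t + c') < 1 / ?H) at_bot"
        by (rule order_tendstoD(2)[OF Z_ratio])
      moreover have "eventually (\<lambda>t. \<exists>x. x \<noteq> 0 \<and> ?s x = t \<and> amp v x < Z (t + c)) at_bot"
        using notin empty by blast
      ultimately show "eventually (\<lambda>t. \<forall>x. x \<noteq> 0 \<longrightarrow> ?s x = t \<longrightarrow> amp v x \<le> Z (t + c')) at_bot"
      proof eventually_elim
        case (elim t)
        then obtain y where y: "y \<noteq> 0" "?s y = t" "amp v y < Z (t + c)" by blast
        have H: "?H * Z (t + c) \<le> Z (t + c')"
          using elim(1) Zpos[of "t + c'"] harnack_const_pos by (simp add: field_simps)
        show ?case
        proof (intro allI impI)
          fix x assume x: "x \<noteq> 0" "?s x = t"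
          have "amp v x \<le> ?H * amp v y"
            by (rule harnack_amp[OF N2 v same y(1)]) (use x y in auto)
          also have "\<dots> \<le> ?H * Z (t + c)" using y(3) harnack_const_pos by simp
          finally show "amp v x \<le> Z (t + c')" using H by simp
        qed
      qed
    qed
    obtain x :: 'a where x: "x \<noteq> 0" "?s x = 0" by (rule radius_exists[OF e])
    obtain t where "Z t < amp v x" using Z_small[OF solutionD(3)[OF v x(1)]] .
    then show False using all[OF x(1), of t] x(2) by simp
  qed
  show ?thesis
  proof (cases "bdd_above Cs")
    case False
    \<comment> \<open>Translates with arbitrarily large shifts lie below v, and Z tends to w0 at
      plus infinity.\<close>
    have "amp v x = w0" if x: "x \<noteq> 0" for x
    proof (rule antisym)
      show "amp v x \<le> w0" by (rule amp_le_w0[OF v x])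
      show "w0 \<le> amp v x"
      proof (rule dense_le)
        fix \<eta> assume "\<eta> < w0"
        then obtain T where T: "\<And>t. T \<le> t \<Longrightarrow> \<eta> \<le> Z t" using Z_tendsto_w0 by blast
        obtain c where c: "c \<in> Cs" "T - ?s x < c" using False unfolding bdd_above_def by (meson not_less)
        have "\<eta> \<le> Z (?s x + c)" using T c(2) by simp
        also have "\<dots> \<le> amp v x" using c(1) x by (simp add: Cs_def)
        finally show "\<eta> \<le> amp v x" .
      qed
    qed
    then show ?thesis by blast
  next
    case True
    define c0 where "c0 = Sup Cs"
    have below: "c \<in> Cs" if "c < c0" for c
    proof -
      obtain c1 where c1: "c1 \<in> Cs" "c < c1" using \<open>c < c0\<close> less_cSup_iff[OF ne True] unfolding c0_def by blast
      show ?thesis unfolding Cs_def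
      proof (intro CollectI allI impI)
        fix x :: 'a assume "x \<noteq> 0"
        then show "Z (?s x + c) \<le> amp v x"
          using Z_mono[of "?s x + c" "?s x + c1"] c1 by (force simp: Cs_def)
      qed
    qed
    have cont: "((\<lambda>c. Z (r + c)) \<longlongrightarrow> Z (r + c0)) (at c0 within A)" for r A
      by (rule isCont_tendsto_compose[OF Z_cont]) (intro tendsto_intros)
    have ge: "Z (?s x + c0) \<le> amp v x" if "x \<noteq> 0" for x
    proof (rule tendsto_upperbound[OF cont[of _ "{..<c0}"]])
      show "eventually (\<lambda>c. Z (?s x + c) \<le> amp v x) (at_left c0)"
        unfolding eventually_at_filter
        by (rule always_eventually) (use below that in \<open>auto simp: Cs_def\<close>)
    qed simp
    have le1: "amp v x \<le> Z (?s x + c1)" if x: "x \<noteq> 0" and c1: "c0 < c1" for x c1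
    proof (rule le_wv[OF v x])
      define E1 where "E1 = exp (\<theta> * (c1 - c0))"
      have E1: "1 < E1" using th c1 by (simp add: E1_def)
      \<comment> \<open>Relative to the critical translate, v exceeds it by a factor of at most
        about 1 + a at some point of each sphere, hence by at most about 1 + H a = (1 + E1) / 2 on
        the whole sphere. This is less than E1, the limiting ratio for the shift c1.\<close>
      define a where "a = (E1 - 1) / (2 * ?H)"
      have a: "0 < a" using E1 harnack_const_pos by (simp add: a_def)
      define c where "c = c0 + ln (1 + a) / \<theta>"
      have c: "c0 < c" using a th by (simp add: c_def)
      have Ec: "exp (\<theta> * (c - c0)) = 1 + a" using a th by (simp add: c_def)
      have "c \<notin> Cs" using c cSup_upper[OF _ True, of c] unfolding c0_def by force
      then have ev1: "eventually (\<lambda>t. \<exists>x. x \<noteq> 0 \<and> ?s x = t \<and> amp v x < Z (t + c)) at_bot" by (rule notin)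
      have "((\<lambda>t. Z (t + c1) / Z (t + c0) - (1 + ?H * (Z (t + c) / Z (t + c0) - 1))) \<longlongrightarrow> E1 - (1 + ?H * ((1 + a) - 1))) at_bot"
        unfolding E1_def Ec[symmetric] by (intro tendsto_intros Z_ratio)
      moreover have "0 < E1 - (1 + ?H * ((1 + a) - 1))" using E1 harnack_const_pos by (simp add: a_def field_simps)
      ultimately have ev2: "eventually (\<lambda>t. 0 < Z (t + c1) / Z (t + c0) - (1 + ?H * (Z (t + c) / Z (t + c0) - 1))) at_bot"
        by (rule order_tendstoD(1))
      show "eventually (\<lambda>t. \<forall>x. x \<noteq> 0 \<longrightarrow> ?s x = t \<longrightarrow> amp v x \<le> Z (t + c1)) at_bot"
        using ev1 ev2
      proof eventually_elim
        case (elim t)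
        then obtain y where y: "y \<noteq> 0" "?s y = t" "amp v y < Z (t + c)" by blast
        define r where "r = Z (t + c0)"
        have r: "0 < r" using Zpos by (simp add: r_def)
        have "0 < (Z (t + c1) / r - (1 + ?H * (Z (t + c) / r - 1))) * r" using elim(2) r by (simp add: r_def)
        also have "\<dots> = Z (t + c1) - (r + ?H * (Z (t + c) - r))" using r by (simp add: field_simps)
        finally have z: "r + ?H * (Z (t + c) - r) < Z (t + c1)" by simp
        obtain dw where dw: "solution (wv c0) dw" using wv_solution by blast
        show ?case
        proof (intro allI impI)
          fix x assume x: "x \<noteq> 0" "?s x = t"
          have rr: "amp (wv c0) x = r" "amp (wv c0) y = r" using x y by (auto simp: amp_wv r_def)
          have "amp v x - amp (wv c0) x \<le> ?H * (amp v y - amp (wv c0) y)"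
            by (rule harnack_amp_diff[OF N2 v dw _ same y(1)]) (use x y ge in \<open>auto simp: amp_wv\<close>)
          then have "amp v x - r \<le> ?H * (amp v y - r)" unfolding rr .
          also have "?H * (amp v y - r) \<le> ?H * (Z (t + c) - r)" using y(3) harnack_const_pos by simp
          finally show "amp v x \<le> Z (t + c1)" using z by simp
        qed
      qed
    qed
    have le: "amp v x \<le> Z (?s x + c0)" if "x \<noteq> 0" for x
    proof (rule tendsto_lowerbound[OF cont[of _ "{c0<..}"]])
      show "eventually (\<lambda>c. amp v x \<le> Z (?s x + c)) (at_right c0)"
        unfolding eventually_at_filter
        by (rule always_eventually) (use le1 that in auto)
    qed simp
    show ?thesis using ge le by (intro disjI2 exI[of _ c0]) (auto intro: antisym)
  qed
qed

end

section \<open>Removing the weight\<close>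

lemma test_function_iff: "test_function \<phi> \<longleftrightarrow> (\<exists>d\<phi>. test_on (- {0}) \<phi> d\<phi>)"
proof
  assume t: "test_function \<phi>"
  then obtain g where g: "\<And>x. GDERIV \<phi> x :> g x" "continuous_on UNIV g"
    unfolding test_function_def C1_on_def by auto
  let ?K = "closure {x. \<phi> x \<noteq> 0}"
  have "compact ?K" "?K \<subseteq> - {0}" using t unfolding test_function_def by auto
  moreover have "\<phi> x = 0" if "x \<notin> ?K" for x using that closure_subset[of "{x. \<phi> x \<noteq> 0}"] by blast
  ultimately show "\<exists>d\<phi>. test_on (- {0}) \<phi> d\<phi>" unfolding test_on_def using g by blast
next
  assume "\<exists>d\<phi>. test_on (- {0}) \<phi> d\<phi>"
  then obtain d\<phi> where t: "test_on (- {0}) \<phi> d\<phi>" ..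
  obtain K where K: "compact K" "K \<subseteq> - {0}" "\<And>x. x \<notin> K \<Longrightarrow> \<phi> x = 0" "\<And>x. GDERIV \<phi> x :> d\<phi> x" "continuous_on UNIV d\<phi>"
    by (rule test_onE[OF t]) blast
  have sub: "closure {x. \<phi> x \<noteq> 0} \<subseteq> K"
    by (rule closure_minimal) (use K compact_imp_closed in auto)
  have "compact (closure {x. \<phi> x \<noteq> 0})"
    using compact_Int_closed[OF K(1) closed_closure[of "{x. \<phi> x \<noteq> 0}"]] sub by (simp add: Int_absorb1)
  then show "test_function \<phi>"
    unfolding test_function_def C1_on_def using sub K(2,4,5) by blast
qed

lemma grad_eq: "GDERIV f x :> D \<Longrightarrow> grad f x = D"
  unfolding grad_def by (rule the_equality) (auto intro: GDERIV_unique)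

lemma GDERIV_norm_powr:
  fixes x :: "'a::real_inner"
  assumes "x \<noteq> 0" shows "GDERIV (\<lambda>x. norm x powr a) x :> (a * norm x powr a / (norm x)\<^sup>2) *\<^sub>R x"
proof -
  have "((\<lambda>z. z powr a) has_real_derivative a * norm x powr (a - 1)) (at (norm x))"
    by (rule has_real_derivative_powr) (use assms in simp)
  from GDERIV_DERIV_compose[OF GDERIV_norm[OF assms] this] show ?thesis
    using assms by (simp add: sgn_div_norm powr_diff power2_eq_square divide_inverse mult.assoc)
qed

text \<open>The power can be singular only at the origin, near which test functions vanish.
  Multiplication by it is thus invertible on test functions, with the exponent -a for the
  inverse.\<close>

lemma test_on_norm_powr:
  assumes t: "test_on (- {0}) \<psi> d\<psi>"
  shows "test_on (- {0}) (\<lambda>x. norm x powr a * \<psi> x) (\<lambda>x. norm x powr a *\<^sub>R (d\<psi> x + (a * \<psi> x / (norm x)\<^sup>2) *\<^sub>R x))"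
proof -
  obtain K where K: "compact K" "K \<subseteq> - {0}" "\<And>x. x \<notin> K \<Longrightarrow> \<psi> x = 0" "\<And>x. x \<notin> K \<Longrightarrow> d\<psi> x = 0"
    "\<And>x. GDERIV \<psi> x :> d\<psi> x" "continuous_on UNIV d\<psi>" "continuous_on UNIV \<psi>"
    by (rule test_onE[OF t]) blast
  have "test_on (- {0}) (\<lambda>x. if x \<in> - {0} then norm x powr a * \<psi> x else 0)
     (\<lambda>x. if x \<in> - {0} then norm x powr a *\<^sub>R (d\<psi> x + (a * \<psi> x / (norm x)\<^sup>2) *\<^sub>R x) else 0)"
  proof (rule test_on_extend[OF _ _ _ K(1,2)])
    show "GDERIV (\<lambda>x. norm x powr a * \<psi> x) x :> norm x powr a *\<^sub>R (d\<psi> x + (a * \<psi> x / (norm x)\<^sup>2) *\<^sub>R x)" if "x \<in> - {0}" for x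
      by (rule GDERIV_subst[OF GDERIV_mult[OF GDERIV_norm_powr K(5)]])
         (use that in \<open>auto simp: scaleR_add_right mult_ac\<close>)
    show "continuous_on (- {0}) (\<lambda>x. norm x powr a *\<^sub>R (d\<psi> x + (a * \<psi> x / (norm x)\<^sup>2) *\<^sub>R x))"
      by (intro continuous_intros continuous_on_subset[OF K(6)] continuous_on_subset[OF K(7)]) auto
  qed (use K(3) in auto)
  moreover have "(\<lambda>x. if x \<in> - {0} then norm x powr a * \<psi> x else 0) = (\<lambda>x. norm x powr a * \<psi> x)" by auto
  moreover have "(\<lambda>x. if x \<in> - {0} then norm x powr a *\<^sub>R (d\<psi> x + (a * \<psi> x / (norm x)\<^sup>2) *\<^sub>R x) else 0)
     = (\<lambda>x. norm x powr a *\<^sub>R (d\<psi> x + (a * \<psi> x / (norm x)\<^sup>2) *\<^sub>R x))" by auto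
  ultimately show ?thesis by simp
qed

text \<open>The substitution \<open>v = |x|\<^sup>a u\<close>, \<open>\<phi> = |x|\<^sup>a \<psi>\<close> removes the weight \<open>|x|\<^bsup>-2a\<^esup>\<close> from the principal part.\<close>

lemma weighted_form:
  fixes u :: "'a::euclidean_space \<Rightarrow> real"
  assumes u: "\<And>x. x \<noteq> 0 \<Longrightarrow> GDERIV u x :> du x" "continuous_on (- {0}) du" and upos: "\<And>x. x \<noteq> 0 \<Longrightarrow> 0 < u x"
    and v: "\<And>x. x \<noteq> 0 \<Longrightarrow> v x = norm x powr a * u x"
    and dv: "\<And>x. x \<noteq> 0 \<Longrightarrow> dv x = norm x powr a *\<^sub>R (du x + (a * u x / (norm x)\<^sup>2) *\<^sub>R x)"
    and t: "test_on (- {0}) \<psi> d\<psi>"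
    and \<phi>: "\<And>x. \<phi> x = norm x powr a * \<psi> x"
    and d\<phi>: "\<And>x. d\<phi> x = norm x powr a *\<^sub>R (d\<psi> x + (a * \<psi> x / (norm x)\<^sup>2) *\<^sub>R x)"
    and D: "D = d + a * (real DIM('a) - 2) - a\<^sup>2" and B: "B = b + a + a * q"
  shows "- (\<integral>x. norm x powr (- 2 * a) * (dv x \<bullet> d\<phi> x) \<partial>lborel)
        + d * (\<integral>x. norm x powr (- 2 * (1 + a)) * v x * \<phi> x \<partial>lborel)
        = (\<integral>x. norm x powr b * v x powr q * \<phi> x \<partial>lborel) \<longleftrightarrow>
     (\<integral>x. du x \<bullet> d\<psi> x \<partial>lborel) = - (\<integral>x. (norm x powr B * u x powr q - D * u x / (norm x)\<^sup>2) * \<psi> x \<partial>lborel)"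
proof -
  let ?N = "real DIM('a)"
  obtain K where K: "compact K" "K \<subseteq> - {0}" "\<And>x. x \<notin> K \<Longrightarrow> \<psi> x = 0" "\<And>x. x \<notin> K \<Longrightarrow> d\<psi> x = 0"
    "\<And>x. GDERIV \<psi> x :> d\<psi> x" "continuous_on UNIV d\<psi>" "continuous_on UNIV \<psi>"
    by (rule test_onE[OF t]) blast
  have z: "\<psi> 0 = 0" "d\<psi> 0 = 0" using K(2,3,4) by auto
  have cu: "continuous_on (- {0}) u" using u(1) by (rule GDERIV_continuous_on) simp
  define I0 where "I0 = (\<integral>x. u x / (norm x)\<^sup>2 * \<psi> x \<partial>lborel)"
  have i0: "integrable lborel (\<lambda>x. u x / (norm x)\<^sup>2 * \<psi> x)"
    by (rule integrable_mult_test[OF t]) (intro continuous_intros cu, auto)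
  have i1: "integrable lborel (\<lambda>x. du x \<bullet> d\<psi> x)" by (rule integrable_inner_test[OF t u(2)])
  \<comment> \<open>The cross terms of the two gradients add up to x \<bullet> \<nabla>(u \<psi>) /
    |x|^2. The radial divergence theorem for |x|^(-2) u \<psi> turns their integral into -(N - 2)
    times that of u \<psi> / |x|^2; this is the source of a (N - 2) in D.\<close>
  define R where "R x = (x \<bullet> (u x *\<^sub>R d\<psi> x + \<psi> x *\<^sub>R du x)) / (norm x)\<^sup>2" for x
  have iR: "integrable lborel R" and R: "(\<integral>x. R x \<partial>lborel) = - (?N - 2) * I0"
  proof -
    let ?F = "\<lambda>x. if x \<in> - {0} then norm x powr (-2) * (u x * \<psi> x) else 0"
    let ?dF = "\<lambda>x. if x \<in> - {0} then norm x powr (-2) *\<^sub>R (u x *\<^sub>R d\<psi> x + \<psi> x *\<^sub>R du x) + (u x * \<psi> x) *\<^sub>R (((-2) * norm x powr (-2) / (norm x)\<^sup>2) *\<^sub>R x) else 0"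
    have tF: "test_on (- {0}) ?F ?dF"
    proof (rule test_on_extend[OF _ _ _ K(1,2)])
      show "GDERIV (\<lambda>x. norm x powr (-2) * (u x * \<psi> x)) x :> norm x powr (-2) *\<^sub>R (u x *\<^sub>R d\<psi> x + \<psi> x *\<^sub>R du x) + (u x * \<psi> x) *\<^sub>R (((-2) * norm x powr (-2) / (norm x)\<^sup>2) *\<^sub>R x)"
        if "x \<in> - {0}" for x
        using that by (intro GDERIV_mult GDERIV_norm_powr u K(5)) auto
      show "continuous_on (- {0}) (\<lambda>x. norm x powr (-2) *\<^sub>R (u x *\<^sub>R d\<psi> x + \<psi> x *\<^sub>R du x) + (u x * \<psi> x) *\<^sub>R (((-2) * norm x powr (-2) / (norm x)\<^sup>2) *\<^sub>R x))"
        by (intro continuous_intros cu u(2) continuous_on_subset[OF K(6)] continuous_on_subset[OF K(7)]) auto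
    qed (use K(3) in auto)
    have n2: "norm x powr (-2) = 1 / (norm x)\<^sup>2" if "x \<noteq> 0" for x :: 'a
      using that by (simp add: powr_minus inverse_eq_divide)
    have F: "?F x = u x / (norm x)\<^sup>2 * \<psi> x" for x using n2[of x] z by simp
    have dF: "x \<bullet> ?dF x = R x - 2 * (u x / (norm x)\<^sup>2 * \<psi> x)" for x
    proof (cases "x = 0")
      case False
      let ?X = "u x *\<^sub>R d\<psi> x + \<psi> x *\<^sub>R du x"
      have gen: "x \<bullet> (p *\<^sub>R X + c *\<^sub>R (k *\<^sub>R x)) = p * (x \<bullet> X) + c * (k * (norm x)\<^sup>2)" for p c k X
        by (simp add: inner_add_right power2_norm_eq_inner)
      have "?dF x = norm x powr (-2) *\<^sub>R ?X + (u x * \<psi> x) *\<^sub>R (((-2) * norm x powr (-2) / (norm x)\<^sup>2) *\<^sub>R x)"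
        using False by simp
      then have "x \<bullet> ?dF x = norm x powr (-2) * (x \<bullet> ?X) + (u x * \<psi> x) * (((-2) * norm x powr (-2) / (norm x)\<^sup>2) * (norm x)\<^sup>2)"
        by (simp only: gen)
      also have "norm x powr (-2) * (x \<bullet> ?X) = R x" unfolding n2[OF False] R_def by simp
      also have "((-2) * norm x powr (-2) / (norm x)\<^sup>2) * (norm x)\<^sup>2 = - 2 / (norm x)\<^sup>2"
      proof -
        have "(- 2) * (1 / n) / n * n = - 2 / n" if "n \<noteq> 0" for n :: real using that by simp
        then show ?thesis unfolding n2[OF False] using False by (simp del: times_divide_eq_right times_divide_eq_left)
      qed
      finally show ?thesis by simp
    qed (simp add: R_def z)
    have iF: "integrable lborel (\<lambda>x. x \<bullet> ?dF x)" by (rule integrable_inner_test[OF tF continuous_on_id])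
    have "integrable lborel (\<lambda>x. x \<bullet> ?dF x + 2 * (u x / (norm x)\<^sup>2 * \<psi> x))"
      by (intro Bochner_Integration.integrable_add iF Bochner_Integration.integrable_mult_right i0)
    then show iR: "integrable lborel R" unfolding dF by simp
    have "(\<integral>x. R x \<partial>lborel) - 2 * I0 = (\<integral>x. x \<bullet> ?dF x \<partial>lborel)"
      unfolding dF I0_def
      by (subst Bochner_Integration.integral_diff[OF iR Bochner_Integration.integrable_mult_right[OF i0]])
        (simp only: Bochner_Integration.integral_mult_right_zero)
    also have "\<dots> = - ?N * I0" using integral_radial_derivative[OF tF] unfolding F I0_def .
    finally show "(\<integral>x. R x \<partial>lborel) = - (?N - 2) * I0" by (simp add: algebra_simps)
  qed
  have e1: "norm x powr (- 2 * a) * (dv x \<bullet> d\<phi> x) = du x \<bullet> d\<psi> x + a * R x + a\<^sup>2 * (u x / (norm x)\<^sup>2 * \<psi> x)" for x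
  proof (cases "x = 0")
    case True
    then show ?thesis by (simp add: d\<phi> z R_def)
  next
    case False
    define m where "m = (norm x)\<^sup>2"
    have m: "m \<noteq> 0" "x \<bullet> x = m" using False by (auto simp: m_def power2_norm_eq_inner)
    have "norm x powr (- 2 * a) * (dv x \<bullet> d\<phi> x) = (norm x powr (- 2 * a) * (norm x powr a * norm x powr a)) *
       ((du x + (a * u x / m) *\<^sub>R x) \<bullet> (d\<psi> x + (a * \<psi> x / m) *\<^sub>R x))"
      using False by (simp add: dv d\<phi> m_def)
    also have "norm x powr (- 2 * a) * (norm x powr a * norm x powr a) = 1"
      using False by (simp add: powr_add[symmetric])
    also have "(du x + (a * u x / m) *\<^sub>R x) \<bullet> (d\<psi> x + (a * \<psi> x / m) *\<^sub>R x)
      = du x \<bullet> d\<psi> x + a * ((u x * (x \<bullet> d\<psi> x) + \<psi> x * (x \<bullet> du x)) / m) + a\<^sup>2 * (u x / m * \<psi> x)"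
      using m by (simp add: inner_add_left inner_add_right inner_commute[of "du x" x] power2_eq_square add_divide_distrib
            distrib_left mult_ac)
    finally show ?thesis by (simp add: R_def m_def inner_add_right)
  qed
  have e2: "norm x powr (- 2 * (1 + a)) * v x * \<phi> x = u x / (norm x)\<^sup>2 * \<psi> x" for x
  proof (cases "x = 0")
    case False
    have "norm x powr (- 2 * (1 + a)) * (norm x powr a * norm x powr a) = norm x powr (-2)"
      by (simp add: powr_add[symmetric])
    also have "\<dots> = 1 / (norm x)\<^sup>2" using False by (simp add: powr_minus inverse_eq_divide)
    finally show ?thesis using False by (simp add: v \<phi> mult_ac)
  qed (simp add: \<phi> z)
  have e3: "norm x powr b * v x powr q * \<phi> x = norm x powr B * u x powr q * \<psi> x" for x
  proof (cases "x = 0")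
    case False
    have "v x powr q = norm x powr (a * q) * u x powr q"
      using upos[OF False] by (simp add: v[OF False] powr_mult powr_powr)
    then have "norm x powr b * v x powr q * \<phi> x = (norm x powr b * norm x powr a * norm x powr (a * q)) * (u x powr q * \<psi> x)"
      by (simp add: \<phi> mult_ac)
    also have "norm x powr b * norm x powr a * norm x powr (a * q) = norm x powr B" by (simp add: B powr_add)
    finally show ?thesis by simp
  qed (simp add: \<phi> z)
  have i3: "integrable lborel (\<lambda>x. norm x powr B * u x powr q * \<psi> x)"
    by (rule integrable_mult_test[OF t]) (intro continuous_intros cu, use upos in \<open>auto simp: less_imp_neq[symmetric]\<close>)
  have L: "(\<integral>x. norm x powr (- 2 * a) * (dv x \<bullet> d\<phi> x) \<partial>lborel) = (\<integral>x. du x \<bullet> d\<psi> x \<partial>lborel) - a * (?N - 2) * I0 + a\<^sup>2 * I0"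
  proof -
    have lin: "(\<integral>x. f x + a * g x + c * h x \<partial>lborel) = (\<integral>x. f x \<partial>lborel) + a * (\<integral>x. g x \<partial>lborel) + c * (\<integral>x. h x \<partial>lborel)"
      if "integrable lborel f" "integrable lborel g" "integrable lborel h" for f g h :: "'a \<Rightarrow> real" and a c :: real
      using that by simp
    show ?thesis unfolding e1 lin[OF i1 iR i0] I0_def[symmetric] R by (simp add: algebra_simps)
  qed
  have "(\<integral>x. (norm x powr B * u x powr q - D * u x / (norm x)\<^sup>2) * \<psi> x \<partial>lborel)
     = (\<integral>x. norm x powr B * u x powr q * \<psi> x - D * (u x / (norm x)\<^sup>2 * \<psi> x) \<partial>lborel)"
    by (rule Bochner_Integration.integral_cong) (auto simp: algebra_simps)
  also have "\<dots> = (\<integral>x. norm x powr B * u x powr q * \<psi> x \<partial>lborel) - D * I0"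
    unfolding I0_def
    by (subst Bochner_Integration.integral_diff[OF i3 Bochner_Integration.integrable_mult_right[OF i0]])
      (simp only: Bochner_Integration.integral_mult_right_zero)
  finally have Rr: "(\<integral>x. (norm x powr B * u x powr q - D * u x / (norm x)\<^sup>2) * \<psi> x \<partial>lborel)
     = (\<integral>x. norm x powr B * u x powr q * \<psi> x \<partial>lborel) - D * I0" .
  have DI: "D * I0 = d * I0 + a * (?N - 2) * I0 - a\<^sup>2 * I0" by (simp add: D algebra_simps)
  show ?thesis
    unfolding L e2 e3 I0_def[symmetric] Rr DI by (intro iffI; linarith)
qed

lemma W_solution_iff:
  fixes v :: "'a::euclidean_space \<Rightarrow> real"
  assumes D: "D = d + a * (real DIM('a) - 2) - a\<^sup>2" and B: "B = b + a + a * q"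
  shows "W_solution a b d q v \<longleftrightarrow> v \<in> (- {0}) \<rightarrow>\<^sub>E {0<..} \<and>
    (\<exists>du. weak_lap (- {0}) (\<lambda>x. norm x powr (- a) * v x) du
      (\<lambda>x. norm x powr B * (norm x powr (- a) * v x) powr q - D * (norm x powr (- a) * v x) / (norm x)\<^sup>2))"
proof -
  define u where "u x = norm x powr (- a) * v x" for x
  have vu: "v x = norm x powr a * u x" if "x \<noteq> 0" for x using that by (simp add: u_def powr_minus)
  have upos: "0 < u x" if "x \<noteq> 0" "v \<in> (- {0}) \<rightarrow>\<^sub>E {0<..}" for x
    using that PiE_mem[of v "- {0}" "\<lambda>_. {0<..}" x] by (simp add: u_def)
  show ?thesis unfolding u_def[symmetric]
  proof
    assume W: "W_solution a b d q v"
    then have ext: "v \<in> (- {0}) \<rightarrow>\<^sub>E {0<..}" unfolding W_solution_def by blast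
    obtain dv where dv: "\<And>x. x \<noteq> 0 \<Longrightarrow> GDERIV v x :> dv x" "continuous_on (- {0}) dv"
      using W unfolding W_solution_def C1_on_def by auto
    have cv: "continuous_on (- {0}) v" using dv(1) by (rule GDERIV_continuous_on) simp
    define du where "du x = norm x powr (- a) *\<^sub>R dv x + v x *\<^sub>R (((- a) * norm x powr (- a) / (norm x)\<^sup>2) *\<^sub>R x)" for x
    have gu: "GDERIV u x :> du x" if "x \<noteq> 0" for x
      unfolding u_def[abs_def] du_def by (rule GDERIV_mult[OF GDERIV_norm_powr[OF that] dv(1)[OF that]])
    have cdu: "continuous_on (- {0}) du" unfolding du_def by (intro continuous_intros cv dv(2)) auto
    have cu: "continuous_on (- {0}) u" using gu by (rule GDERIV_continuous_on) simp
    have dvu: "dv x = norm x powr a *\<^sub>R (du x + (a * u x / (norm x)\<^sup>2) *\<^sub>R x)" if "x \<noteq> 0" for x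
    proof -
      have "du x + (a * u x / (norm x)\<^sup>2) *\<^sub>R x = norm x powr (- a) *\<^sub>R dv x"
        by (simp add: du_def u_def mult_ac)
      then show ?thesis using that by (simp add: powr_add[symmetric])
    qed
    have "weak_lap (- {0}) u du (\<lambda>x. norm x powr B * u x powr q - D * u x / (norm x)\<^sup>2)"
    proof (rule weak_lapI)
      show "GDERIV u x :> du x" if "x \<in> - {0}" for x using gu that by simp
      show "continuous_on (- {0}) du" by (rule cdu)
      show "continuous_on (- {0}) (\<lambda>x. norm x powr B * u x powr q - D * u x / (norm x)\<^sup>2)"
        by (intro continuous_intros cu) (use upos[OF _ ext] in \<open>auto simp: less_imp_neq[symmetric]\<close>)
      fix \<psi> :: "'a \<Rightarrow> real" and d\<psi> assume t: "test_on (- {0}) \<psi> d\<psi>"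
      note tp = test_on_norm_powr[OF t, of a]
      let ?\<phi> = "\<lambda>x::'a. norm x powr a * \<psi> x" and ?d\<phi> = "\<lambda>x::'a. norm x powr a *\<^sub>R (d\<psi> x + (a * \<psi> x / (norm x)\<^sup>2) *\<^sub>R x)"
      have "test_function ?\<phi>" using tp test_function_iff by blast
      then have eq: "- (\<integral>x. norm x powr (- 2 * a) * (grad v x \<bullet> grad ?\<phi> x) \<partial>lborel)
        + d * (\<integral>x. norm x powr (- 2 * (1 + a)) * v x * ?\<phi> x \<partial>lborel)
        = (\<integral>x. norm x powr b * v x powr q * ?\<phi> x \<partial>lborel)"
        using W unfolding W_solution_def by blast
      have gphi: "grad ?\<phi> x = ?d\<phi> x" for x by (rule grad_eq) (use tp in \<open>auto simp: test_on_def\<close>)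
      have "norm x powr (- 2 * a) * (grad v x \<bullet> grad ?\<phi> x) = norm x powr (- 2 * a) * (dv x \<bullet> ?d\<phi> x)" for x
        using grad_eq[OF dv(1)] gphi by (cases "x = 0") auto
      then have eq': "- (\<integral>x. norm x powr (- 2 * a) * (dv x \<bullet> ?d\<phi> x) \<partial>lborel)
        + d * (\<integral>x. norm x powr (- 2 * (1 + a)) * v x * ?\<phi> x \<partial>lborel)
        = (\<integral>x. norm x powr b * v x powr q * ?\<phi> x \<partial>lborel)"
        using eq by presburger
      show "(\<integral>x. du x \<bullet> d\<psi> x \<partial>lborel) = - (\<integral>x. (norm x powr B * u x powr q - D * u x / (norm x)\<^sup>2) * \<psi> x \<partial>lborel)"
        by (rule iffD1[OF weighted_form[OF gu cdu upos[OF _ ext] vu dvu t refl refl D B] eq'])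
    qed
    then show "v \<in> (- {0}) \<rightarrow>\<^sub>E {0<..} \<and> (\<exists>du. weak_lap (- {0}) u du (\<lambda>x. norm x powr B * u x powr q - D * u x / (norm x)\<^sup>2))"
      using ext by blast
  next
    assume "v \<in> (- {0}) \<rightarrow>\<^sub>E {0<..} \<and> (\<exists>du. weak_lap (- {0}) u du (\<lambda>x. norm x powr B * u x powr q - D * u x / (norm x)\<^sup>2))"
    then obtain du where ext: "v \<in> (- {0}) \<rightarrow>\<^sub>E {0<..}"
      and w: "weak_lap (- {0}) u du (\<lambda>x. norm x powr B * u x powr q - D * u x / (norm x)\<^sup>2)" by blast
    have gu: "GDERIV u x :> du x" if "x \<noteq> 0" for x using weak_lapD(1)[OF w] that by simp
    have cdu: "continuous_on (- {0}) du" by (rule weak_lapD(2)[OF w])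
    have cu: "continuous_on (- {0}) u" by (rule weak_lap_continuous[OF w])
    define dv where "dv x = norm x powr a *\<^sub>R (du x + (a * u x / (norm x)\<^sup>2) *\<^sub>R x)" for x
    have gv: "GDERIV v x :> dv x" if x: "x \<noteq> 0" for x
    proof (rule GDERIV_cong_open[of "\<lambda>x. norm x powr a * u x" _ _ "- {0}"])
      show "GDERIV (\<lambda>x. norm x powr a * u x) x :> dv x"
        by (rule GDERIV_subst[OF GDERIV_mult[OF GDERIV_norm_powr[OF x] gu[OF x]]])
           (simp add: dv_def scaleR_add_right mult_ac)
    qed (use x vu in auto)
    have cdv: "continuous_on (- {0}) dv" unfolding dv_def by (intro continuous_intros cu cdu) auto
    show "W_solution a b d q v"
      unfolding W_solution_def
    proof (intro conjI allI impI ext)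
      show "C1_on (- {0}) v" unfolding C1_on_def using gv cdv by blast
      fix \<phi> :: "'a \<Rightarrow> real" assume "test_function \<phi>"
      then obtain d\<phi> where tp: "test_on (- {0}) \<phi> d\<phi>" using test_function_iff by blast
      obtain K where K: "K \<subseteq> - {0}" "\<And>x. x \<notin> K \<Longrightarrow> \<phi> x = 0" "\<And>x. x \<notin> K \<Longrightarrow> d\<phi> x = 0" by (rule test_onE[OF tp]) blast
      note t = test_on_norm_powr[OF tp, of "- a"]
      let ?\<psi> = "\<lambda>x::'a. norm x powr (- a) * \<phi> x" and ?d\<psi> = "\<lambda>x::'a. norm x powr (- a) *\<^sub>R (d\<phi> x + ((- a) * \<phi> x / (norm x)\<^sup>2) *\<^sub>R x)"
      have p: "norm x powr a * norm x powr (- a) = 1" if "x \<noteq> 0" for x :: 'a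
        using that by (simp add: powr_add[symmetric])
      have phi: "\<phi> x = norm x powr a * ?\<psi> x" for x
        using p[of x] K(1) K(2)[of x] by (cases "x = 0") (auto simp: mult.assoc[symmetric])
      have dphi: "d\<phi> x = norm x powr a *\<^sub>R (?d\<psi> x + (a * ?\<psi> x / (norm x)\<^sup>2) *\<^sub>R x)" for x
      proof (cases "x = 0")
        case True
        then show ?thesis using K(1) K(3)[of x] by auto
      next
        case False
        have "?d\<psi> x + (a * ?\<psi> x / (norm x)\<^sup>2) *\<^sub>R x = norm x powr (- a) *\<^sub>R d\<phi> x"
          by (simp add: scaleR_add_right scaleR_diff_right mult_ac)
        then show ?thesis using p[OF False] by simp
      qed
      have eq: "- (\<integral>x. norm x powr (- 2 * a) * (dv x \<bullet> d\<phi> x) \<partial>lborel)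
        + d * (\<integral>x. norm x powr (- 2 * (1 + a)) * v x * \<phi> x \<partial>lborel)
        = (\<integral>x. norm x powr b * v x powr q * \<phi> x \<partial>lborel)"
        by (rule iffD2[OF weighted_form[OF gu cdu upos[OF _ ext] vu dv_def t phi dphi D B] weak_lapD(4)[OF w t]])
      have "grad \<phi> x = d\<phi> x" for x by (rule grad_eq) (use tp in \<open>auto simp: test_on_def\<close>)
      then have "norm x powr (- 2 * a) * (grad v x \<bullet> grad \<phi> x) = norm x powr (- 2 * a) * (dv x \<bullet> d\<phi> x)" for x
        using grad_eq[OF gv] by (cases "x = 0") auto
      then show "- (\<integral>x. norm x powr (- 2 * a) * (grad v x \<bullet> grad \<phi> x) \<partial>lborel)
        + d * (\<integral>x. norm x powr (- 2 * (1 + a)) * v x * \<phi> x \<partial>lborel)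
        = (\<integral>x. norm x powr b * v x powr q * \<phi> x \<partial>lborel)"
        using eq by presburger
    qed
  qed
qed

context emden
begin

section \<open>Asymptotics\<close>

lemma solution_cong:
  assumes "solution u du" "\<And>x. x \<noteq> 0 \<Longrightarrow> u x = u' x"
  shows "solution u' du"
proof -
  have "weak_lap (- {0}) u' du (\<lambda>x. norm x powr B * u x powr q - D * u x / (norm x)\<^sup>2)"
  proof (rule weak_lap_cong_fun)
    show "weak_lap (- {0}) u du (\<lambda>x. norm x powr B * u x powr q - D * u x / (norm x)\<^sup>2)"
      using assms(1) unfolding solution_def by blast
  qed (use assms(2) in auto)
  then have "weak_lap (- {0}) u' du (\<lambda>x. norm x powr B * u' x powr q - D * u' x / (norm x)\<^sup>2)"
    by (rule weak_lap_cong) (use assms(2) in auto)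
  then show ?thesis using assms unfolding solution_def by auto
qed

lemma const_solution:
  assumes "0 < l" shows "\<exists>dv. solution (cyl 1 (\<lambda>_. w0)) dv"
proof (rule solution_cyl)
  have w: "0 < w0" using assms by (simp add: w0_def)
  show "0 - 2 * 1 * k * 0 + l * w0 - w0 powr q = 0"
    using powr_eq_mult[OF w, of q] w0_powr[OF assms] by simp
  show "0 < w0" by (rule w)
qed auto

end

context emden_wave
begin

text \<open>The end of the punctured space, origin or infinity, at which Z(e ln |x|) tends to 0; at
  \<open>one_end\<close> it tends to w0.\<close>

definition zero_end :: "'a filter" where "zero_end = (if e = 1 then at 0 else at_infinity)"
definition one_end :: "'a filter" where "one_end = (if e = 1 then at_infinity else at 0)"

lemma ends: "e = 1 \<or> e = -1" by (rule sign_cases[OF e])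

lemma ln_norm_at_0: "filterlim (\<lambda>x::'a. ln (norm x)) at_bot (at 0)"
proof -
  have "filterlim (\<lambda>x::'a. norm x) (at_right 0) (at 0)"
    unfolding filterlim_at
    by (auto intro!: tendsto_eq_intros simp: eventually_at_filter)
  then show ?thesis by (rule filterlim_compose[OF ln_at_0])
qed

lemma ln_norm_at_infinity: "filterlim (\<lambda>x::'a. ln (norm x)) at_top at_infinity"
  by (rule filterlim_compose[OF ln_at_top filterlim_norm_at_top])

lemma s_zero_end: "filterlim (\<lambda>x. e * ln (norm x)) at_bot zero_end"
  using ends
proof
  assume "e = 1"
  then show ?thesis unfolding zero_end_def using ln_norm_at_0 by simp
next
  assume "e = -1"
  then show ?thesis unfolding zero_end_def using ln_norm_at_infinity by (simp add: filterlim_uminus_at_top)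
qed

lemma s_one_end: "filterlim (\<lambda>x. e * ln (norm x)) at_top one_end"
  using ends
proof
  assume "e = 1"
  then show ?thesis unfolding one_end_def using ln_norm_at_infinity by simp
next
  assume "e = -1"
  then show ?thesis unfolding one_end_def using ln_norm_at_0 by (simp add: filterlim_uminus_at_bot)
qed

lemma end_nontrivial: "zero_end \<noteq> bot"
  by (simp add: zero_end_def trivial_limit_at_infinity)

lemma Z_tendsto_0: "(Z \<longlongrightarrow> 0) at_bot"
proof (rule order_tendstoI)
  fix a :: real assume "a < 0"
  then show "eventually (\<lambda>t. a < Z t) at_bot" 
    by (intro always_eventually allI) (rule less_trans[OF _ Zpos])
next
  fix a :: real assume "0 < a"
  then obtain t where t: "Z t < a" using Z_small by blast
  show "eventually (\<lambda>t. Z t < a) at_bot"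
    using eventually_le_at_bot[of t] by eventually_elim (use t Z_mono in \<open>meson le_less_trans\<close>)
qed

lemma Z_tendsto_top: "(Z \<longlongrightarrow> w0) at_top"
proof (rule order_tendstoI)
  fix a assume "a < w0"
  then obtain b where b: "a < b" "b < w0" using dense by blast
  obtain T where "\<And>t. T \<le> t \<Longrightarrow> b \<le> Z t" using Z_tendsto_w0[OF b(2)] by blast
  then show "eventually (\<lambda>t. a < Z t) at_top"
    using b(1) by (intro eventually_mono[OF eventually_ge_at_top[of T]]) force
next
  fix a assume "w0 < a"
  then show "eventually (\<lambda>t. Z t < a) at_top"
    by (intro always_eventually allI) (rule le_less_trans[OF Z_le_w0])
qed

text \<open>For amplitudes, the four cases of \<open>limit_behavior\<close> become this single
  condition.\<close>

definition asympt :: "(real \<Rightarrow> real) \<Rightarrow> real \<Rightarrow> ('a \<Rightarrow> real) \<Rightarrow> bool" where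
  "asympt lin \<gamma> w \<longleftrightarrow> ((\<lambda>x. w x / lin (e * ln (norm x))) \<longlongrightarrow> \<gamma>) zero_end \<and> ((\<lambda>x. w x / w0) \<longlongrightarrow> 1) one_end"

text \<open>At the end where Z vanishes, the shift c acts as the factor exp(\<theta> c); this is how
  the parameter \<gamma> labels the translates.\<close>

lemma asympt_wave:
  assumes lin: "((\<lambda>t. Z t / lin t) \<longlongrightarrow> 1) at_bot" and w: "\<And>x. x \<noteq> 0 \<Longrightarrow> w x = Z (e * ln (norm x) + c)"
  shows "asympt lin \<gamma> w \<longleftrightarrow> \<gamma> = exp (\<theta> * c)"
proof -
  have nz: "eventually (\<lambda>x::'a. x \<noteq> 0) zero_end" "eventually (\<lambda>x::'a. x \<noteq> 0) one_end"
    using eventually_not_equal_at_infinity[of "0::'a"] by (auto simp: zero_end_def one_end_def eventually_at_filter)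
  have w0: "0 < w0" using less_le_trans[OF Zpos Z_le_w0] by blast
  have "((\<lambda>t. (Z (t + c) / Z t) * (Z t / lin t)) \<longlongrightarrow> exp (\<theta> * c) * 1) at_bot"
    by (intro tendsto_intros Zshift lin)
  then have "((\<lambda>t. Z (t + c) / lin t) \<longlongrightarrow> exp (\<theta> * c)) at_bot"
    using Zpos by (simp add: less_imp_neq[symmetric])
  from filterlim_compose[OF this s_zero_end]
  have "((\<lambda>x. Z (e * ln (norm x) + c) / lin (e * ln (norm x))) \<longlongrightarrow> exp (\<theta> * c)) zero_end" .
  then have 1: "((\<lambda>x. w x / lin (e * ln (norm x))) \<longlongrightarrow> exp (\<theta> * c)) zero_end"
    by (rule Lim_transform_eventually) (rule eventually_mono[OF nz(1)], simp add: w)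
  have "filterlim (\<lambda>x. c + e * ln (norm x)) at_top one_end"
    by (rule filterlim_tendsto_add_at_top[OF tendsto_const s_one_end])
  then have "((\<lambda>x. Z (c + e * ln (norm x)) / w0) \<longlongrightarrow> w0 / w0) one_end"
    by (intro tendsto_intros filterlim_compose[OF Z_tendsto_top]) (use w0 in auto)
  then have "((\<lambda>x. w x / w0) \<longlongrightarrow> w0 / w0) one_end"
    by (rule Lim_transform_eventually) (rule eventually_mono[OF nz(2)], simp add: w add.commute)
  then have 2: "((\<lambda>x. w x / w0) \<longlongrightarrow> 1) one_end" using w0 by simp
  show ?thesis
  proof
    assume "asympt lin \<gamma> w"
    then have "((\<lambda>x. w x / lin (e * ln (norm x))) \<longlongrightarrow> \<gamma>) zero_end" by (simp add: asympt_def)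
    then show "\<gamma> = exp (\<theta> * c)" by (rule tendsto_unique[OF end_nontrivial _ 1])
  qed (use 1 2 in \<open>auto simp: asympt_def\<close>)
qed

text \<open>If w0 / lin had a positive limit \<gamma>, then Z / w0, the quotient of Z / lin by w0 /
  lin, would tend to 1 / \<gamma>, whereas it tends to 0.\<close>

lemma asympt_const:
  assumes lin: "((\<lambda>t. Z t / lin t) \<longlongrightarrow> 1) at_bot" and w: "\<And>x. x \<noteq> 0 \<Longrightarrow> w x = w0" and \<gamma>: "0 < \<gamma>"
  shows "\<not> asympt lin \<gamma> w"
proof
  assume "asympt lin \<gamma> w"
  then have 1: "((\<lambda>x. w x / lin (e * ln (norm x))) \<longlongrightarrow> \<gamma>) zero_end" by (simp add: asympt_def)
  have w0: "0 < w0" using less_le_trans[OF Zpos Z_le_w0] by blast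
  have nz: "eventually (\<lambda>x::'a. x \<noteq> 0) zero_end"
    using eventually_not_equal_at_infinity[of "0::'a"] by (auto simp: zero_end_def eventually_at_filter)
  have "eventually (\<lambda>t. 0 < Z t / lin t) at_bot" by (rule order_tendstoD(1)[OF lin]) simp
  then have ev: "eventually (\<lambda>t. lin t \<noteq> 0) at_bot" by eventually_elim auto
  then have ev': "eventually (\<lambda>x. lin (e * ln (norm x)) \<noteq> 0) zero_end"
    using eventually_compose_filterlim[OF ev s_zero_end] by simp
  have "((\<lambda>x. (Z (e * ln (norm x)) / lin (e * ln (norm x))) / (w x / lin (e * ln (norm x)))) \<longlongrightarrow> 1 / \<gamma>) zero_end"
    using \<gamma> by (intro tendsto_divide filterlim_compose[OF lin s_zero_end] 1) simp
  then have "((\<lambda>x. Z (e * ln (norm x)) / w0) \<longlongrightarrow> 1 / \<gamma>) zero_end"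
    by (rule Lim_transform_eventually)
      (use ev' nz in \<open>eventually_elim, simp add: w\<close>)
  moreover have "((\<lambda>x. Z (e * ln (norm x)) / w0) \<longlongrightarrow> 0 / w0) zero_end"
    using w0 by (intro tendsto_divide filterlim_compose[OF Z_tendsto_0 s_zero_end] tendsto_const) simp
  ultimately have "1 / \<gamma> = 0 / w0" by (rule tendsto_unique[OF end_nontrivial])
  then show False using \<gamma> by simp
qed

end

section \<open>Transfer to the weighted problem\<close>

theorem theorem1p6:
  fixes a b d q \<sigma> \<rho> l :: real
    and v\<^sub>0 :: "real ^ 'n \<Rightarrow> real"
  assumes "CARD('n) \<ge> 3" and "q > 1"
    and "\<sigma> = (2 * a + b + 2) / (q - 1)"
    and "\<rho> = a - (real CARD('n) - 2) / 2"
    and "l = (\<sigma> + \<rho>)\<^sup>2 - \<rho>\<^sup>2 + d"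
    and "v\<^sub>0 = (\<lambda>x\<in>- {0}. l powr (1 / (q - 1)) * norm x powr (- \<sigma>))"
  shows "((\<exists>v :: real ^ 'n \<Rightarrow> real. W_solution a b d q v) \<longleftrightarrow> l > 0) \<and>
    (d > \<rho>\<^sup>2 \<longrightarrow> {v. W_solution a b d q v} = {v\<^sub>0}) \<and>
    ((\<sigma> + \<rho>)\<^sup>2 > \<rho>\<^sup>2 - d \<and> \<rho>\<^sup>2 - d \<ge> 0 \<and> \<sigma> \<noteq> - \<rho> \<longrightarrow>
      infinite {v :: real ^ 'n \<Rightarrow> real. W_solution a b d q v} \<and>
      (\<forall>v :: real ^ 'n \<Rightarrow> real. W_solution a b d q v \<longrightarrow> radially_symmetric v) \<and>
      (\<forall>\<gamma>>0. \<exists>!v. W_solution a b d q v \<and> limit_behavior d \<sigma> \<rho> v\<^sub>0 \<gamma> v) \<and>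
      {v. W_solution a b d q v} =
        {v\<^sub>0} \<union> {(THE v. W_solution a b d q v \<and> limit_behavior d \<sigma> \<rho> v\<^sub>0 \<gamma> v) | \<gamma>. \<gamma> > 0})"
proof -
  define D where "D = d + a * (real DIM(real ^ 'n) - 2) - a\<^sup>2"
  define B where "B = b + a + a * q"
  define k where "k = \<sigma> + \<rho>"
  note q = assms(2) and rho = assms(4) and v0 = assms(6)
  have lk: "l = k\<^sup>2 - (\<rho>\<^sup>2 - d)" using assms(5) by (simp add: k_def)
  \<comment> \<open>The function |x|^(-a) v solves the unweighted problem, whose scaling exponent is
    \<sigma> + a; accordingly k = \<sigma> + a - (N - 2) / 2 = \<sigma> + \<rho>.\<close>
  interpret E: emden B D q "\<sigma> + a" k l "TYPE(real ^ 'n)"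
  proof
    have "\<sigma> * (q - 1) = 2 * a + b + 2" using assms(3) q by simp
    then show "(\<sigma> + a) * (q - 1) = B + 2" by (simp add: B_def algebra_simps)
    show "k = \<sigma> + a - (real DIM(real ^ 'n) - 2) / 2" by (simp add: k_def rho)
    have "l = \<sigma>\<^sup>2 + 2 * \<sigma> * \<rho> + d" using assms(5) by (simp add: power2_eq_square algebra_simps)
    then show "l = (\<sigma> + a)\<^sup>2 - (real DIM(real ^ 'n) - 2) * (\<sigma> + a) + D"
      by (simp add: D_def rho power2_eq_square field_simps)
  qed (rule q)
  define w where "w v x = norm x powr \<sigma> * v x" for v :: "real ^ 'n \<Rightarrow> real" and x
  have W: "W_solution a b d q v \<longleftrightarrow> v \<in> (- {0}) \<rightarrow>\<^sub>E {0<..} \<and> (\<exists>du. E.solution (\<lambda>x. norm x powr (- a) * v x) du)"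
    for v :: "real ^ 'n \<Rightarrow> real"
  proof -
    have "\<forall>x. x \<noteq> 0 \<longrightarrow> 0 < norm x powr (- a) * v x" if "v \<in> (- {0}) \<rightarrow>\<^sub>E {0<..}"
      using that PiE_mem[of v "- {0}" "\<lambda>_. {0<..}"] by auto
    then show ?thesis unfolding W_solution_iff[OF D_def B_def] E.solution_def by blast
  qed
  have amp_w: "E.amp (\<lambda>x. norm x powr (- a) * v x) x = w v x" if "x \<noteq> 0" for v x
  proof -
    have "norm x powr (\<sigma> + a) * norm x powr (- a) = norm x powr \<sigma>" by (simp add: powr_add[symmetric])
    then show ?thesis by (simp add: E.amp_def w_def mult.assoc[symmetric])
  qed
  \<comment> \<open>Equality as extensional functions: both sides are \<open>undefined\<close> at
    the origin.\<close>
  have w_eqI: "v = (\<lambda>x\<in>- {0 :: real ^ 'n}. norm x powr (- \<sigma>) * f x)"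
    if "W_solution a b d q v" "\<And>x. x \<noteq> 0 \<Longrightarrow> w v x = f x" for v f
  proof
    fix x
    show "v x = (\<lambda>x\<in>- {0}. norm x powr (- \<sigma>) * f x) x"
    proof (cases "x = 0")
      case True
      then show ?thesis using that(1) PiE_arb[of v "- {0}" "\<lambda>_. {0<..}" x] W by auto
    next
      case False
      have "norm x powr (- \<sigma>) * norm x powr \<sigma> = 1" using False by (simp add: powr_add[symmetric])
      then have "v x = norm x powr (- \<sigma>) * w v x" by (simp add: w_def mult.assoc[symmetric])
      then show ?thesis using False that(2)[OF False] by simp
    qed
  qed
  have W_cyl: "W_solution a b d q (\<lambda>x\<in>- {0 :: real ^ 'n}. norm x powr (- \<sigma>) * g (e * ln (norm x)))"
    if "E.solution (E.cyl e g) dv" for e g dv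
  proof -
    have pos: "0 < norm x powr (- \<sigma>) * g (e * ln (norm x))" if x: "x \<noteq> 0" for x :: "real ^ 'n"
      using E.solutionD(3)[OF \<open>E.solution (E.cyl e g) dv\<close> x] x by (simp add: E.amp_cyl)
    have "E.cyl e g x = norm x powr (- a) * (\<lambda>x\<in>- {0 :: real ^ 'n}. norm x powr (- \<sigma>) * g (e * ln (norm x))) x" if "x \<noteq> 0" for x
    proof -
      have "- (\<sigma> + a) = - a + - \<sigma>" by simp
      then have "norm x powr (- (\<sigma> + a)) = norm x powr (- a) * norm x powr (- \<sigma>)" by (simp only: powr_add)
      then show ?thesis using \<open>x \<noteq> 0\<close> by (simp add: E.cyl_def)
    qed
    from E.solution_cong[OF that this]
    have "\<exists>du. E.solution (\<lambda>x. norm x powr (- a) * (\<lambda>x\<in>- {0 :: real ^ 'n}. norm x powr (- \<sigma>) * g (e * ln (norm x))) x) du" by blast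
    moreover have "(\<lambda>x\<in>- {0 :: real ^ 'n}. norm x powr (- \<sigma>) * g (e * ln (norm x))) \<in> (- {0}) \<rightarrow>\<^sub>E {0<..}"
      by (intro restrict_PiE_iff[THEN iffD2] ballI) (use pos in simp)
    ultimately show ?thesis unfolding W by blast
  qed
  have l_pos: "0 < l" if "W_solution a b d q v" for v :: "real ^ 'n \<Rightarrow> real"
    using that E.solution_imp_l_pos unfolding W by blast
  have v0': "v\<^sub>0 = (\<lambda>x\<in>- {0}. norm x powr (- \<sigma>) * E.w0)"
    unfolding v0 E.w0_def by (simp add: mult.commute)
  have v0_sol: "W_solution a b d q v\<^sub>0" if "0 < l"
    using E.const_solution[OF that] W_cyl[of 1 "\<lambda>_. E.w0"] unfolding v0' by blast
  have eq_v0: "v = v\<^sub>0" if "W_solution a b d q v" "\<And>x. x \<noteq> 0 \<Longrightarrow> w v x = E.w0" for v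
    using w_eqI[OF that(1), of "\<lambda>_. E.w0"] that(2) unfolding v0' by blast
  have part1: "(\<exists>v :: real ^ 'n \<Rightarrow> real. W_solution a b d q v) \<longleftrightarrow> l > 0"
    using l_pos v0_sol by blast
  have part2: "{v. W_solution a b d q v} = {v\<^sub>0}" if "d > \<rho>\<^sup>2"
  proof -
    have kl: "k\<^sup>2 < l" using that lk by simp
    then have "0 < l" using zero_le_power2[of k] by linarith
    moreover have "v = v\<^sub>0" if v: "W_solution a b d q v" for v
    proof (rule eq_v0[OF v])
      obtain du where du: "E.solution (\<lambda>x. norm x powr (- a) * v x) du" using v unfolding W by blast
      show "w v x = E.w0" if "x \<noteq> 0" for x
        using E.amp_eq_w0[OF du kl that] amp_w[OF that] by simp
    qed
    ultimately show ?thesis using v0_sol by blast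
  qed
  have part3: "infinite {v :: real ^ 'n \<Rightarrow> real. W_solution a b d q v} \<and>
      (\<forall>v :: real ^ 'n \<Rightarrow> real. W_solution a b d q v \<longrightarrow> radially_symmetric v) \<and>
      (\<forall>\<gamma>>0. \<exists>!v. W_solution a b d q v \<and> limit_behavior d \<sigma> \<rho> v\<^sub>0 \<gamma> v) \<and>
      {v. W_solution a b d q v} =
        {v\<^sub>0} \<union> {(THE v. W_solution a b d q v \<and> limit_behavior d \<sigma> \<rho> v\<^sub>0 \<gamma> v) | \<gamma>. \<gamma> > 0}"
    if k2: "k\<^sup>2 > \<rho>\<^sup>2 - d" and rd: "\<rho>\<^sup>2 - d \<ge> 0"
  proof -
    have lp: "0 < l" "l \<le> k\<^sup>2" using k2 rd lk by auto
    have k0: "k \<noteq> 0" using lp by auto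
    \<comment> \<open>The cylinder is oriented so that the drift e k = |k| is positive. Thus the
      wave vanishes at the origin if \<sigma> + \<rho> > 0 and at infinity if \<sigma> + \<rho> <
      0.\<close>
    define e where "e = sgn k"
    define \<kappa> where "\<kappa> = \<bar>k\<bar>"
    define r where "r = sqrt (\<rho>\<^sup>2 - d)"
    have e: "e * e = 1" "e * k = \<kappa>" "0 < \<kappa>" "\<kappa>\<^sup>2 = k\<^sup>2"
      using k0 by (auto simp: e_def \<kappa>_def sgn_real_def)
    have r: "0 \<le> r" "r < \<kappa>" "r\<^sup>2 = \<rho>\<^sup>2 - d"
      using rd k2 e(3,4) by (auto simp: r_def intro!: real_less_lsqrt)
    interpret V: wave \<kappa> l q
      by unfold_locales (use lp e q in auto)
    have th: "V.\<theta> = \<kappa> - r"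
      unfolding V.\<theta>_def r_def using lk e(4) by simp
    have lin: "V.lin t = (if d < \<rho>\<^sup>2 then exp ((\<kappa> - r) * t) else - t * exp (\<kappa> * t))" for t
      unfolding V.lin_def th using lk e(4) by simp
    obtain Z Z' where Z: "\<And>t. (Z has_real_derivative Z' t) (at t)"
      "\<And>t. (Z' has_real_derivative 2 * \<kappa> * Z' t - l * Z t + Z t powr q) (at t)"
      "\<And>t. 0 < Z t" "((\<lambda>t. Z t / V.lin t) \<longlongrightarrow> 1) at_bot"
      "\<And>c. ((\<lambda>t. Z (t + c) / Z t) \<longlongrightarrow> exp (V.\<theta> * c)) at_bot"
      by (rule V.wave_exists) blast
    interpret X: emden_wave B D q "\<sigma> + a" k l "TYPE(real ^ 'n)" e V.\<theta> Z Z'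
      by unfold_locales (use Z e V.lam assms(1) in auto)
    define vw where "vw c = (\<lambda>x\<in>- {0 :: real ^ 'n}. norm x powr (- \<sigma>) * Z (e * ln (norm x) + c))" for c
    have vw_sol: "W_solution a b d q (vw c)" for c
      using X.wv_solution[of c] W_cyl[of e "\<lambda>t. Z (t + c)"] unfolding vw_def X.wv_def by blast
    have w_vw: "w (vw c) x = Z (e * ln (norm x) + c)" if "x \<noteq> 0" for c x
      using that by (simp add: w_def vw_def powr_add[symmetric] mult.assoc[symmetric])
    have w_v0: "w v\<^sub>0 x = E.w0" if "x \<noteq> 0" for x
      using that by (simp add: w_def v0' powr_add[symmetric] mult.assoc[symmetric])
    have sols: "W_solution a b d q v \<longleftrightarrow> v = v\<^sub>0 \<or> (\<exists>c. v = vw c)" for v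
    proof
      assume v: "W_solution a b d q v"
      then obtain du where du: "E.solution (\<lambda>x. norm x powr (- a) * v x) du" unfolding W by blast
      from X.solution_cases[OF du] show "v = v\<^sub>0 \<or> (\<exists>c. v = vw c)"
      proof
        assume "\<forall>x. x \<noteq> 0 \<longrightarrow> E.amp (\<lambda>x. norm x powr (- a) * v x) x = E.w0"
        then have "w v x = E.w0" if "x \<noteq> 0" for x using that amp_w by simp
        then show ?thesis using eq_v0[OF v] by blast
      next
        assume "\<exists>c. \<forall>x. x \<noteq> 0 \<longrightarrow> E.amp (\<lambda>x. norm x powr (- a) * v x) x = Z (e * ln (norm x) + c)"
        then obtain c where "\<And>x. x \<noteq> 0 \<Longrightarrow> w v x = Z (e * ln (norm x) + c)" using amp_w by force
        from w_eqI[OF v this] show ?thesis unfolding vw_def by blast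
      qed
    qed (use v0_sol lp vw_sol in auto)
    have nz: "eventually (\<lambda>x. x \<noteq> 0) (at (0 :: real ^ 'n))" "eventually (\<lambda>x. x \<noteq> 0) (at_infinity :: (real ^ 'n) filter)"
      using eventually_not_equal_at_infinity[of "0 :: real ^ 'n"] by (auto simp: eventually_at_filter)
    have tend: "(f \<longlongrightarrow> L) (at 0) \<longleftrightarrow> (g \<longlongrightarrow> L) (at 0)" "(f \<longlongrightarrow> L) at_infinity \<longleftrightarrow> (g \<longlongrightarrow> L) at_infinity"
      if "\<And>x. x \<noteq> 0 \<Longrightarrow> f x = g x" for f g :: "real ^ 'n \<Rightarrow> real" and L
      by (rule tendsto_cong, rule eventually_mono[OF nz(1)], simp add: that,
          rule tendsto_cong, rule eventually_mono[OF nz(2)], simp add: that)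
    have w0: "0 < E.w0" using lp by (simp add: E.w0_def)
    have q0: "v x / v\<^sub>0 x = w v x / E.w0" if "x \<noteq> 0" for v x
      using that w0 by (simp add: v0' w_def powr_minus field_simps)
    have quot: "v x / norm x powr m = w v x / norm x powr (m + \<sigma>)" if "x \<noteq> 0" for v x m
      using that by (simp add: w_def powr_add)
    \<comment> \<open>The sign of k and the alternative d < \<rho>^2 or d = \<rho>^2 select one of
      the four cases. Passing to the amplitude adds \<sigma> to the exponents: \<rho> - r becomes
      \<theta> for k > 0, and \<rho> + r becomes -\<theta> for k < 0.\<close>
    have LB: "limit_behavior d \<sigma> \<rho> v\<^sub>0 \<gamma> v \<longleftrightarrow> X.asympt V.lin \<gamma> (w v)" for \<gamma> v
    proof -
      have ex: "exp (m * ln (norm x)) = norm x powr m" if "x \<noteq> 0" for m and x :: "real ^ 'n"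
        using that by (simp add: powr_def)
      show ?thesis
      proof (cases "0 < k")
        case True
        have e1: "e = 1" "\<kappa> = k" using True by (auto simp: e_def \<kappa>_def)
        have c: "\<not> \<sigma> + \<rho> < - r" "r < \<sigma> + \<rho>" "\<not> \<sigma> < - \<rho>" "- \<rho> < \<sigma>" using r e1 True by (auto simp: k_def)
        have A: "X.asympt V.lin \<gamma> (w v) \<longleftrightarrow> ((\<lambda>x. w v x / V.lin (ln (norm x))) \<longlongrightarrow> \<gamma>) (at 0) \<and> ((\<lambda>x. w v x / E.w0) \<longlongrightarrow> 1) at_infinity"
          unfolding X.asympt_def X.zero_end_def X.one_end_def using e1(1) by simp
        have B0: "((\<lambda>x. v x / v\<^sub>0 x) \<longlongrightarrow> 1) at_infinity \<longleftrightarrow> ((\<lambda>x. w v x / E.w0) \<longlongrightarrow> 1) at_infinity"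
          by (rule tend(2)) (rule q0)
        show ?thesis
        proof (cases "d < \<rho>\<^sup>2")
          case d: True
          have eqx: "v x / norm x powr (\<rho> - r) = w v x / V.lin (ln (norm x))" if "x \<noteq> 0" for x
          proof -
            have eq: "\<rho> - r + \<sigma> = \<kappa> - r" using e1 by (simp add: k_def)
            show ?thesis unfolding quot[OF that, of v "\<rho> - r", unfolded eq] using ex[OF that] d by (simp add: lin)
          qed
          have C: "((\<lambda>x. v x / norm x powr (\<rho> - r)) \<longlongrightarrow> \<gamma>) (at 0) \<longleftrightarrow> ((\<lambda>x. w v x / V.lin (ln (norm x))) \<longlongrightarrow> \<gamma>) (at 0)"
            by (rule tend(1)) (rule eqx)
          show ?thesis unfolding A limit_behavior_def r_def[symmetric] C B0 using c d by auto
        next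
          case d: False
          then have d': "d = \<rho>\<^sup>2" using rd by simp
          have eqx: "v x / (norm x powr \<rho> * ln (1 / norm x)) = w v x / V.lin (ln (norm x))" if "x \<noteq> 0" for x
          proof -
            have eq: "\<rho> + \<sigma> = \<kappa>" using e1 by (simp add: k_def)
            have "v x / norm x powr \<rho> / ln (1 / norm x) = w v x / norm x powr \<kappa> / - ln (norm x)"
              unfolding quot[OF that, of v \<rho>, unfolded eq] using that by (simp add: ln_div)
            then show ?thesis using ex[OF that] d by (simp add: lin mult.commute)
          qed
          have C: "((\<lambda>x. v x / (norm x powr \<rho> * ln (1 / norm x))) \<longlongrightarrow> \<gamma>) (at 0) \<longleftrightarrow> ((\<lambda>x. w v x / V.lin (ln (norm x))) \<longlongrightarrow> \<gamma>) (at 0)"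
            by (rule tend(1)) (rule eqx)
          show ?thesis unfolding A limit_behavior_def r_def[symmetric] C B0 using c d d' by auto
        qed
      next
        case False
        then have kn: "k < 0" using k0 by simp
        have e1: "e = -1" "\<kappa> = - k" using kn by (auto simp: e_def \<kappa>_def)
        have c: "\<sigma> + \<rho> < - r" "\<not> r < \<sigma> + \<rho>" "\<sigma> < - \<rho>" "\<not> - \<rho> < \<sigma>" using r e1 kn by (auto simp: k_def)
        have A: "X.asympt V.lin \<gamma> (w v) \<longleftrightarrow> ((\<lambda>x. w v x / V.lin (- ln (norm x))) \<longlongrightarrow> \<gamma>) at_infinity \<and> ((\<lambda>x. w v x / E.w0) \<longlongrightarrow> 1) (at 0)"
          unfolding X.asympt_def X.zero_end_def X.one_end_def using e1(1) by simp
        have B0: "((\<lambda>x. v x / v\<^sub>0 x) \<longlongrightarrow> 1) (at 0) \<longleftrightarrow> ((\<lambda>x. w v x / E.w0) \<longlongrightarrow> 1) (at 0)"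
          by (rule tend(1)) (rule q0)
        show ?thesis
        proof (cases "d < \<rho>\<^sup>2")
          case d: True
          have eqx: "v x / norm x powr (\<rho> + r) = w v x / V.lin (- ln (norm x))" if "x \<noteq> 0" for x
          proof -
            have eq: "\<rho> + r + \<sigma> = - (\<kappa> - r)" using e1 by (simp add: k_def)
            show ?thesis unfolding quot[OF that, of v "\<rho> + r", unfolded eq] ex[OF that, of "- (\<kappa> - r)", symmetric]
              using d by (simp add: lin algebra_simps)
          qed
          have C: "((\<lambda>x. v x / norm x powr (\<rho> + r)) \<longlongrightarrow> \<gamma>) at_infinity \<longleftrightarrow> ((\<lambda>x. w v x / V.lin (- ln (norm x))) \<longlongrightarrow> \<gamma>) at_infinity"
            by (rule tend(2)) (rule eqx)
          show ?thesis unfolding A limit_behavior_def r_def[symmetric] C B0 using c d by auto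
        next
          case d: False
          then have d': "d = \<rho>\<^sup>2" using rd by simp
          have eqx: "v x / (norm x powr \<rho> * ln (norm x)) = w v x / V.lin (- ln (norm x))" if "x \<noteq> 0" for x
          proof -
            have eq: "\<rho> + \<sigma> = - \<kappa>" using e1 by (simp add: k_def)
            have "v x / norm x powr \<rho> / ln (norm x) = w v x / norm x powr (- \<kappa>) / ln (norm x)"
              unfolding quot[OF that, of v \<rho>, unfolded eq] by simp
            then show ?thesis using ex[OF that, of "- \<kappa>"] d by (simp add: lin mult.commute)
          qed
          have C: "((\<lambda>x. v x / (norm x powr \<rho> * ln (norm x))) \<longlongrightarrow> \<gamma>) at_infinity \<longleftrightarrow> ((\<lambda>x. w v x / V.lin (- ln (norm x))) \<longlongrightarrow> \<gamma>) at_infinity"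
            by (rule tend(2)) (rule eqx)
          show ?thesis unfolding A limit_behavior_def r_def[symmetric] C B0 using c d d' by auto
        qed
      qed
    qed
    have LB_vw: "limit_behavior d \<sigma> \<rho> v\<^sub>0 \<gamma> (vw c) \<longleftrightarrow> \<gamma> = exp (V.\<theta> * c)" for \<gamma> c
      unfolding LB by (rule X.asympt_wave[OF Z(4) w_vw])
    have LB_v0: "\<not> limit_behavior d \<sigma> \<rho> v\<^sub>0 \<gamma> v\<^sub>0" if "0 < \<gamma>" for \<gamma>
      unfolding LB by (rule X.asympt_const[OF Z(4) w_v0 that])
    have \<theta>: "0 < V.\<theta>" by (rule V.lam)
    have inj: "c = c'" if "vw c = vw c'" for c c'
      using LB_vw[of "exp (V.\<theta> * c)" c] LB_vw[of "exp (V.\<theta> * c)" c'] that \<theta> by simp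
    \<comment> \<open>The shift is determined by exp(\<theta> c) = \<gamma>.\<close>
    have uniq: "W_solution a b d q v \<and> limit_behavior d \<sigma> \<rho> v\<^sub>0 \<gamma> v \<longleftrightarrow> v = vw (ln \<gamma> / V.\<theta>)" if g: "0 < \<gamma>" for \<gamma> v
    proof
      assume v: "W_solution a b d q v \<and> limit_behavior d \<sigma> \<rho> v\<^sub>0 \<gamma> v"
      then have "v = v\<^sub>0 \<or> (\<exists>c. v = vw c)" by (intro iffD1[OF sols]) simp
      then obtain c where c: "v = vw c" using v LB_v0[OF g] by auto
      then have "\<gamma> = exp (V.\<theta> * c)" using v LB_vw by blast
      then show "v = vw (ln \<gamma> / V.\<theta>)" using c \<theta> by simp
    next
      assume "v = vw (ln \<gamma> / V.\<theta>)"
      then show "W_solution a b d q v \<and> limit_behavior d \<sigma> \<rho> v\<^sub>0 \<gamma> v"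
        using vw_sol LB_vw[of \<gamma> "ln \<gamma> / V.\<theta>"] g \<theta> by simp
    qed
    have the: "(THE v. W_solution a b d q v \<and> limit_behavior d \<sigma> \<rho> v\<^sub>0 \<gamma> v) = vw (ln \<gamma> / V.\<theta>)" if "0 < \<gamma>" for \<gamma>
      unfolding uniq[OF that] by simp
    have inf: "infinite {v :: real ^ 'n \<Rightarrow> real. W_solution a b d q v}"
    proof
      assume "finite {v :: real ^ 'n \<Rightarrow> real. W_solution a b d q v}"
      then have "finite (range vw)" by (rule finite_subset[rotated]) (use vw_sol in auto)
      then have "finite (UNIV :: real set)" by (rule finite_imageD) (use inj in \<open>auto intro: injI\<close>)
      then show False using infinite_UNIV_char_0 by blast
    qed
    have rad: "radially_symmetric v" if v: "W_solution a b d q v" for v :: "real ^ 'n \<Rightarrow> real"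
      using v unfolding sols radially_symmetric_def by (auto simp: v0' vw_def)
    have set: "{v. W_solution a b d q v} =
        {v\<^sub>0} \<union> {(THE v. W_solution a b d q v \<and> limit_behavior d \<sigma> \<rho> v\<^sub>0 \<gamma> v) | \<gamma>. \<gamma> > 0}" (is "?L = ?R")
    proof
      show "?L \<subseteq> ?R"
      proof
        fix v assume "v \<in> ?L"
        then have "v = v\<^sub>0 \<or> (\<exists>c. v = vw c)" using sols by blast
        then show "v \<in> ?R"
        proof
          assume "\<exists>c. v = vw c"
          then obtain c where "v = vw c" ..
          then have "v = (THE v. W_solution a b d q v \<and> limit_behavior d \<sigma> \<rho> v\<^sub>0 (exp (V.\<theta> * c)) v)"
            using the[of "exp (V.\<theta> * c)"] \<theta> by simp
          then show ?thesis by (intro UnI2 CollectI exI[of _ "exp (V.\<theta> * c)"]) simp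
        qed simp
      qed
      show "?R \<subseteq> ?L" using the sols by auto
    qed
    have ex1: "\<exists>!v. W_solution a b d q v \<and> limit_behavior d \<sigma> \<rho> v\<^sub>0 \<gamma> v" if "0 < \<gamma>" for \<gamma>
      unfolding uniq[OF that] by simp
    show ?thesis by (intro conjI allI impI inf rad ex1 set)
  qed
  show ?thesis
    by (rule conjI[OF part1 conjI[OF impI[OF part2] impI]], assumption, elim conjE, rule part3) (simp_all add: k_def)
qed

end
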